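(* Let $\Sigma^2 \subset \mathbb{H}^n$ be a closed (smooth, immersed) 2-surface and let $o \in \Sigma$ be a point of multiplicity $k \geqslant 1$. Let $r(x) = \operatorname{dist}_{\mathbb{H}^n}(o,x)$, $w(r) = \int_0^r \sinh t \, \mathrm{d}t$, and $X = \sinh r \, \nabla r$. Then $$|\Sigma| + 4k\pi = -\int_{\Sigma} \left| \frac{1}{w} X^{\bot} + \frac{1}{2}\mathbf{H} \right|^2 + \frac{1}{4}\int_{\Sigma} |\mathbf{H}|^2 .$$
   Context: $\mathbb{H}^n$ is the standard hyperbolic $n$-space of constant sectional curvature $-1$, with Levi-Civita connection $\nabla$; $\nabla r$ is the gradient of $r$ in $\mathbb{H}^n$. A closed 2-surface is a compact smooth 2-dimensional surface without boundary, smoothly immersed in the ambient space; integrals over $\Sigma$ are taken with respect to the induced area measure (on the immersed surface, i.e. counted with multiplicity), and $|\Sigma|$ is the area. A point $o$ of the image has multiplicity $k$ if it has exactly $k$ preimages under the immersion. $\mathbf{H}$ is the mean curvature vector of $\Sigma$, normalized as the trace of the second fundamental form, so that the first variation formula $\int_\Sigma \operatorname{div}_\Sigma Y = -\int_\Sigma \langle Y, \mathbf{H}\rangle$ holds for Lipschitz vector fields $Y$. $X^{\bot}$ is the component of $X$ normal to $\Sigma$, and $w$ in the integrand means $w(r(x))$; the integrand is defined away from the preimages of $o$, a set of measure zero. *)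

theory Defs
  imports "HOL-Analysis.Analysis"
begin

section \<open>Smooth maps on open sets\<close>

text \<open>On an open subset of a finite-dimensional space, continuity of all directional derivatives
  \<open>x \<mapsto> Df(x) v\<close> is the same as continuity of \<open>x \<mapsto> Df(x)\<close> in operator norm, so this is the usual
  \<open>C\<^sup>k\<close>. It is only meant for open sets.\<close>

primrec Ck_on :: "nat \<Rightarrow> 'a::real_normed_vector set \<Rightarrow> ('a \<Rightarrow> 'b::real_normed_vector) \<Rightarrow> bool" where
  "Ck_on 0 U f \<longleftrightarrow> continuous_on U f"
| "Ck_on (Suc k) U f \<longleftrightarrow> (\<forall>x\<in>U. f differentiable (at x)) \<and>
     (\<forall>v. Ck_on k U (\<lambda>x. frechet_derivative f (at x) v))"

definition smooth_on :: "'a::real_normed_vector set \<Rightarrow> ('a \<Rightarrow> 'b::real_normed_vector) \<Rightarrow> bool" where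
  "smooth_on U f \<longleftrightarrow> (\<forall>k. Ck_on k U f)"


section \<open>Hyperbolic space: the hyperboloid model\<close>

text \<open>Hyperbolic \<open>n\<close>-space, \<open>n = CARD('n)\<close>, is the upper sheet of the unit hyperboloid in Minkowski space
  \<open>\<real> \<times> \<real>\<^sup>n\<close> (time coordinate first). The Minkowski form is positive definite on the tangent spaces
  of the sheet, and its restriction is the Riemannian metric of curvature \<open>-1\<close>.\<close>

definition mink :: "real \<times> (real^'n) \<Rightarrow> real \<times> (real^'n) \<Rightarrow> real" where
  "mink p q = snd p \<bullet> snd q - fst p * fst q"

definition hyp_space :: "(real \<times> (real^'n)) set" where
  "hyp_space = {p. mink p p = -1 \<and> fst p > 0}"

definition hyp_tangent :: "real \<times> (real^'n) \<Rightarrow> (real \<times> (real^'n)) set" where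
  "hyp_tangent p = {v. mink p v = 0}"

definition hyp_dist :: "real \<times> (real^'n) \<Rightarrow> real \<times> (real^'n) \<Rightarrow> real" where
  "hyp_dist p q = arcosh (- mink p q)"

text \<open>The Riemannian gradient of a function on \<open>hyp_space\<close>; differentials are tested along curves in
  \<open>hyp_space\<close>, since the function need not be meaningful off the hyperboloid.\<close>

definition hyp_grad :: "(real \<times> (real^'n) \<Rightarrow> real) \<Rightarrow> real \<times> (real^'n) \<Rightarrow> real \<times> (real^'n)" where
  "hyp_grad f q = (THE v. v \<in> hyp_tangent q \<and>
     (\<forall>c u. (\<forall>t::real. c t \<in> hyp_space) \<and> c 0 = q \<and> (c has_vector_derivative u) (at 0) \<longrightarrow>
        ((\<lambda>t. f (c t)) has_real_derivative mink v u) (at 0)))"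

text \<open>The Minkowski-orthogonal projection onto \<open>hyp_tangent q\<close> for \<open>q \<in> hyp_space\<close> (recall
  \<open>mink q q = -1\<close>). The Levi-Civita connection of \<open>hyp_space\<close> is the flat derivative of
  \<open>\<real> \<times> \<real>\<^sup>n\<close> followed by this projection.\<close>

definition hyp_proj :: "real \<times> (real^'n) \<Rightarrow> real \<times> (real^'n) \<Rightarrow> real \<times> (real^'n)" where
  "hyp_proj q v = v + mink v q *\<^sub>R q"

definition w :: "real \<Rightarrow> real" where
  "w s = integral {0..s} sinh"

text \<open>The field \<open>X = sinh r \<nabla>r\<close>, \<open>r = dist(p, -)\<close>. At \<open>p\<close> itself, where \<open>r\<close> is not differentiable,
  the factor \<open>sinh r\<close> makes it \<open>0\<close>.\<close>

definition radial_field :: "real \<times> (real^'n) \<Rightarrow> real \<times> (real^'n) \<Rightarrow> real \<times> (real^'n)" where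
  "radial_field p q = sinh (hyp_dist p q) *\<^sub>R hyp_grad (hyp_dist p) q"


section \<open>Closed surfaces\<close>

type_synonym 'm chart = "'m set \<times> ('m \<Rightarrow> real^2)"

text \<open>A surface is a set \<open>S\<close> with the subspace topology and a (not necessarily maximal) smooth atlas of
  charts onto open subsets of the plane, hence without boundary. It need not be connected. The
  Hausdorff property comes from the sort of \<open>'m\<close>; second countability follows from compactness.\<close>

definition smooth_atlas :: "'m::t2_space set \<Rightarrow> 'm chart set \<Rightarrow> bool" where
  "smooth_atlas S \<A> \<longleftrightarrow>
     (\<forall>(U, \<phi>)\<in>\<A>. openin (top_of_set S) U \<and> open (\<phi> ` U) \<and>
        homeomorphism U (\<phi> ` U) \<phi> (inv_into U \<phi>)) \<and>
     (\<Union>(U, \<phi>)\<in>\<A>. U) = S \<and>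
     (\<forall>(U, \<phi>)\<in>\<A>. \<forall>(V, \<psi>)\<in>\<A>. smooth_on (\<phi> ` (U \<inter> V)) (\<psi> \<circ> inv_into U \<phi>))"

definition closed_surface :: "'m::t2_space set \<Rightarrow> 'm chart set \<Rightarrow> bool" where
  "closed_surface S \<A> \<longleftrightarrow> compact S \<and> smooth_atlas S \<A>"

definition in_chart :: "('m \<Rightarrow> 'b) \<Rightarrow> 'm chart \<Rightarrow> real^2 \<Rightarrow> 'b" where
  "in_chart F c = F \<circ> inv_into (fst c) (snd c)"

definition smooth_immersion ::
  "'m::t2_space set \<Rightarrow> 'm chart set \<Rightarrow> ('m \<Rightarrow> real \<times> (real^'n)) \<Rightarrow> bool" where
  "smooth_immersion S \<A> F \<longleftrightarrow> F ` S \<subseteq> hyp_space \<and>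
     (\<forall>c\<in>\<A>. smooth_on (snd c ` fst c) (in_chart F c) \<and>
        (\<forall>y\<in>snd c ` fst c. inj (frechet_derivative (in_chart F c) (at y))))"


section \<open>Induced area\<close>

definition partial_deriv ::
  "2 \<Rightarrow> (real^2 \<Rightarrow> 'b::real_normed_vector) \<Rightarrow> real^2 \<Rightarrow> 'b" where
  "partial_deriv i f y = frechet_derivative f (at y) (axis i 1)"

definition first_fund_form :: "(real^2 \<Rightarrow> real \<times> (real^'n)) \<Rightarrow> real^2 \<Rightarrow> real^2^2" where
  "first_fund_form f y = (\<chi> i j. mink (partial_deriv i f y) (partial_deriv j f y))"

text \<open>The induced area measure is the unique Borel measure on \<open>S\<close> that has density
  \<open>sqrt (det g)\<close> in every chart.\<close>

definition area_measure ::
  "'m::t2_space set \<Rightarrow> 'm chart set \<Rightarrow> ('m \<Rightarrow> real \<times> (real^'n)) \<Rightarrow> 'm measure" where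
  "area_measure S \<A> F = (THE \<mu>. sets \<mu> = sets (restrict_space borel S) \<and>
     (\<forall>c\<in>\<A>. \<forall>B\<in>sets \<mu>. B \<subseteq> fst c \<longrightarrow>
        emeasure \<mu> B = (\<integral>\<^sup>+y\<in>snd c ` B.
          ennreal (sqrt (det (first_fund_form (in_chart F c) y))) \<partial>lborel)))"


section \<open>Second fundamental form and mean curvature\<close>

text \<open>The following notions at a point \<open>x\<close> do not depend on the chart around \<open>x\<close> that is used.\<close>

definition chart_at :: "'m chart set \<Rightarrow> 'm \<Rightarrow> 'm chart" where
  "chart_at \<A> x = (SOME c. c \<in> \<A> \<and> x \<in> fst c)"

definition surf_tangent ::
  "'m chart set \<Rightarrow> ('m \<Rightarrow> real \<times> (real^'n)) \<Rightarrow> 'm \<Rightarrow> (real \<times> (real^'n)) set" where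
  "surf_tangent \<A> F x =
     (let c = chart_at \<A> x in range (frechet_derivative (in_chart F c) (at (snd c x))))"

definition normal_part ::
  "'m chart set \<Rightarrow> ('m \<Rightarrow> real \<times> (real^'n)) \<Rightarrow> 'm \<Rightarrow> real \<times> (real^'n) \<Rightarrow> real \<times> (real^'n)" where
  "normal_part \<A> F x v =
     (THE u. v - u \<in> surf_tangent \<A> F x \<and> (\<forall>z\<in>surf_tangent \<A> F x. mink u z = 0))"

text \<open>\<open>second_fund_form \<A> F x i j\<close> is the normal part of \<open>\<nabla>\<^sub>i \<partial>\<^sub>j F\<close>, in the coordinates of
  \<open>chart_at \<A> x\<close>.\<close>

definition second_fund_form ::
  "'m chart set \<Rightarrow> ('m \<Rightarrow> real \<times> (real^'n)) \<Rightarrow> 'm \<Rightarrow> 2 \<Rightarrow> 2 \<Rightarrow> real \<times> (real^'n)" where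
  "second_fund_form \<A> F x i j =
     (let c = chart_at \<A> x; f = in_chart F c
      in normal_part \<A> F x (hyp_proj (F x) (partial_deriv i (partial_deriv j f) (snd c x))))"

definition mean_curvature ::
  "'m chart set \<Rightarrow> ('m \<Rightarrow> real \<times> (real^'n)) \<Rightarrow> 'm \<Rightarrow> real \<times> (real^'n)" where
  "mean_curvature \<A> F x =
     (let c = chart_at \<A> x;
          ginv = matrix_inv (first_fund_form (in_chart F c) (snd c x))
      in \<Sum>i\<in>UNIV. \<Sum>j\<in>UNIV. (ginv $ i $ j) *\<^sub>R second_fund_form \<A> F x i j)"

text \<open>The squared length of a tangent vector of \<open>hyp_space\<close>.\<close>

definition hyp_normsq :: "real \<times> (real^'n) \<Rightarrow> real" where
  "hyp_normsq v = mink v v"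

end

theory Submission
  imports Defs
begin

text \<open>
  In the hyperboloid model \<open>u = w(r)\<close> is the affine function \<open>- mink p F - 1\<close> and \<open>X\<close> is its gradient.
  Its tangential part over \<open>u\<close> is the surface gradient of \<open>ln u\<close>, which is singular at the preimages of
  \<open>p\<close>. Instead of cutting out small discs, regularize: the field \<open>X\<^sup>T / (u + e) = grad (ln (u + e))\<close> is smooth
  on the whole closed surface, so its divergence
  \<open>1 + (2 e - e\<^sup>2) / (u + e)\<^sup>2 + |X\<^sup>\<bottom> / (u + e) + H / 2|\<^sup>2 - |H|\<^sup>2 / 4\<close> integrates to \<open>0\<close>.
  As \<open>e\<close> tends to \<open>0\<close>, \<open>2 e / (u + e)\<^sup>2\<close> concentrates with mass \<open>4 \<pi>\<close> at every preimage
  of \<open>p\<close> (rescale by \<open>sqrt e\<close>), while \<open>|X\<^sup>\<bottom>|\<^sup>2 \<le> C u\<^sup>2\<close>, a consequence of Taylor's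
  formula, allows dominated convergence in the square.
\<close>

section \<open>Minkowski geometry of the hyperboloid\<close>

text \<open>The weight is adapted to the curvature: \<open>1 + u\<close> is the hyperbolic cosine of
  the distance, and the Hessian of \<open>u\<close> on hyperbolic space is \<open>1 + u\<close>
  times the metric. On a surface the tangential part of the radial field therefore has divergence 2
  (1 + u) plus the product of its normal part with the mean curvature vector. Dimension two is what
  makes the next step work: 2 (1 + u) (u + e) - u (u + 2) = (u + e)^2 + 2 e - e^2, so dividing by u
  + e leaves exactly the constant 1, which integrates to the area, and a kernel of fixed mass. That
  mass is 4 pi because \<open>u\<close> is close to half the squared distance, so the rescaled
  kernel tends to 2 / (1 + |z|^2 / 2)^2. The other obstacle is that area, normal part and mean
  curvature are given by definite descriptions or by an arbitrarily picked chart. Much of the proof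
  shows that these descriptions denote and do not depend on the chart; afterwards every computation
  takes place in one convenient chart, and a partition of unity of class C^1 assembles the
  results.\<close>

lemma mink_commute: "mink p q = mink q p"
  by (simp add: mink_def inner_commute mult.commute)

text \<open>Gives \<open>mink\<close> the product rule, continuity and limits of bounded bilinear
  maps; although indefinite, the form is a difference of two bounded products.\<close>

lemma bounded_bilinear_mink: "bounded_bilinear (mink :: real \<times> (real^'n) \<Rightarrow> _)"
proof -
  interpret I: bounded_bilinear "\<lambda>(p :: real \<times> (real^'n)) (q :: real \<times> (real^'n)). snd p \<bullet> snd q"
    by (rule bounded_bilinear.comp[OF bounded_bilinear_inner bounded_linear_snd bounded_linear_snd])
  interpret M: bounded_bilinear "\<lambda>(p :: real \<times> (real^'n)) (q :: real \<times> (real^'n)). fst p * fst q"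
    by (rule bounded_bilinear.comp[OF bounded_bilinear_mult bounded_linear_fst bounded_linear_fst])
  obtain K where K: "\<And>(a :: real \<times> (real^'n)) (b :: real \<times> (real^'n)). norm (snd a \<bullet> snd b) \<le> norm a * norm b * K"
    using I.bounded by blast
  obtain L where L: "\<And>(a :: real \<times> (real^'n)) (b :: real \<times> (real^'n)). norm (fst a * fst b) \<le> norm a * norm b * L"
    using M.bounded by blast
  show ?thesis
  proof
    show "\<exists>K. \<forall>(a :: real \<times> (real^'n)) (b :: real \<times> (real^'n)). norm (mink a b) \<le> norm a * norm b * K"
    proof (intro exI allI)
      fix a b :: "real \<times> (real^'n)"
      have "norm (mink a b) \<le> norm (snd a \<bullet> snd b) + norm (fst a * fst b)"
        unfolding mink_def by (rule norm_triangle_ineq4)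
      also have "\<dots> \<le> norm a * norm b * (K + L)"
        using K[of a b] L[of a b] by (simp add: algebra_simps)
      finally show "norm (mink a b) \<le> norm a * norm b * (K + L)" .
    qed
  qed (simp_all add: mink_def inner_add_left inner_add_right algebra_simps)
qed

interpretation mink: bounded_bilinear "mink :: real \<times> (real^'n) \<Rightarrow> _"
  by (rule bounded_bilinear_mink)

lemmas mink_linear = mink.add_left mink.add_right mink.diff_left mink.diff_right
  mink.scaleR_left mink.scaleR_right mink.minus_left mink.minus_right

lemma mink_self_le: "mink v v \<le> (norm v)\<^sup>2"
proof -
  have "(norm v)\<^sup>2 = fst v * fst v + snd v \<bullet> snd v"
    by (simp add: power2_norm_eq_inner inner_prod_def)
  moreover have "0 \<le> fst v * fst v" by simp
  ultimately show ?thesis unfolding mink_def by linarith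
qed

lemma hyp_space_mink: "q \<in> hyp_space \<Longrightarrow> mink q q = -1"
  by (simp add: hyp_space_def)

text \<open>With time parts q0, v0 and space parts q', v', orthogonality says that q0 v0 is the
  inner product of q' and v', while q0^2 = 1 + |q'|^2. Cauchy-Schwarz bounds q0^2 v0^2 by (q0^2 - 1)
  |v'|^2, which is strictly less than q0^2 |v'|^2 because v' = 0 would force v = 0.\<close>

lemma mink_pos_tangent:
  assumes q: "q \<in> hyp_space" and v: "mink q v = 0" "v \<noteq> 0"
  shows "0 < mink v v"
proof -
  have a: "(fst q)\<^sup>2 = 1 + snd q \<bullet> snd q" "fst q > 0"
    using q by (auto simp: hyp_space_def mink_def power2_eq_square)
  have e: "snd q \<bullet> snd v = fst q * fst v"
    using v by (simp add: mink_def)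
  have cs: "(fst q * fst v)\<^sup>2 \<le> ((fst q)\<^sup>2 - 1) * (snd v \<bullet> snd v)"
    using Cauchy_Schwarz_ineq[of "snd q" "snd v"] a e by simp
  have s: "snd v \<bullet> snd v > 0"
  proof (rule ccontr)
    assume "\<not> ?thesis"
    hence "snd v = 0" by simp
    with e a have "fst v = 0" by simp
    with \<open>snd v = 0\<close> v show False by (simp add: prod_eq_iff)
  qed
  have "(fst q)\<^sup>2 * (fst v)\<^sup>2 < (fst q)\<^sup>2 * (snd v \<bullet> snd v)"
    using cs s unfolding left_diff_distrib mult_1 power_mult_distrib by linarith
  hence "(fst v)\<^sup>2 < snd v \<bullet> snd v"
    using a(2) by simp
  thus ?thesis by (simp add: mink_def power2_eq_square)
qed

lemma mink_nonneg_tangent: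
  "q \<in> hyp_space \<Longrightarrow> mink q v = 0 \<Longrightarrow> 0 \<le> mink v v"
  using mink_pos_tangent[of q v] by (cases "v = 0") (auto simp: mink.zero_left)

lemma mink_hyp_proj:
  assumes q: "q \<in> hyp_space"
  shows "mink q (hyp_proj q v) = 0" "mink (hyp_proj q v) (hyp_proj q v) = mink v v + (mink v q)\<^sup>2"
proof -
  show "mink q (hyp_proj q v) = 0"
    using q mink_commute[of q v] by (simp add: hyp_space_mink hyp_proj_def mink_linear)
  show "mink (hyp_proj q v) (hyp_proj q v) = mink v v + (mink v q)\<^sup>2"
    using q mink_commute[of q v] by (simp add: hyp_space_mink hyp_proj_def mink_linear power2_eq_square)
qed

lemma norm_snd_less_fst:
  assumes "p \<in> hyp_space"
  shows "norm (snd p) < fst p"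
proof (rule power2_less_imp_less)
  have "snd p \<bullet> snd p - fst p * fst p = -1"
    using assms by (simp add: hyp_space_def mink_def)
  thus "(norm (snd p))\<^sup>2 < (fst p)\<^sup>2"
    unfolding power2_norm_eq_inner power2_eq_square[of "fst p"] by linarith
qed (use assms in \<open>simp add: hyp_space_def\<close>)

text \<open>A reverse Cauchy-Schwarz inequality: the tangential projection of \<open>q\<close> at
  \<open>p\<close> has square \<open>(mink p q)^2 - 1\<close>, which is nonnegative and vanishes
  only if the projection does. The Euclidean Cauchy-Schwarz inequality for the space parts settles
  the sign of \<open>mink p q\<close>.\<close>

lemma mink_hyp_space_le:
  assumes p: "p \<in> hyp_space" and q: "q \<in> hyp_space"
  shows "mink p q \<le> -1" and "mink p q = -1 \<longleftrightarrow> p = q"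
proof -
  have "\<bar>snd p \<bullet> snd q\<bar> \<le> norm (snd p) * norm (snd q)" by (rule Cauchy_Schwarz_ineq2)
  also have "\<dots> < fst p * fst q"
  proof (rule mult_strict_mono')
    show "norm (snd p) < fst p"
      using p by (rule norm_snd_less_fst)
    show "norm (snd q) < fst q"
      using q by (rule norm_snd_less_fst)
  qed auto
  finally have neg: "mink p q < 0" by (simp add: mink_def)
  have "0 \<le> mink (hyp_proj p q) (hyp_proj p q)"
    using mink_hyp_proj[OF p] by (intro mink_nonneg_tangent[OF p])
  hence "1\<^sup>2 \<le> (mink p q)\<^sup>2"
    using mink_hyp_proj(2)[OF p, of q] q by (simp add: hyp_space_mink mink_commute)
  thus le: "mink p q \<le> -1"
    using neg power2_le_imp_le[of 1 "- mink p q"] by simp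
  show "mink p q = -1 \<longleftrightarrow> p = q"
  proof
    assume e: "mink p q = -1"
    hence "mink (hyp_proj p q) (hyp_proj p q) = 0"
      using mink_hyp_proj(2)[OF p, of q] q by (simp add: hyp_space_mink mink_commute)
    hence "hyp_proj p q = 0"
      using mink_pos_tangent[OF p mink_hyp_proj(1)[OF p, of q]] by force
    thus "p = q" using e by (simp add: hyp_proj_def mink_commute)
  qed (use p in \<open>auto simp: hyp_space_mink\<close>)
qed

text \<open>\<open>hyp_grad\<close> tests along curves that stay on the sheet for all times, so
  uniqueness of the gradient requires such a curve in every tangent direction. The space part moves
  along a straight line and the equation of the sheet determines the time part.\<close>

lemma hyp_space_curve:
  assumes q: "q \<in> hyp_space" and u: "mink q u = 0"
  shows "\<exists>c. (\<forall>t::real. c t \<in> hyp_space) \<and> c 0 = q \<and> (c has_vector_derivative u) (at 0)"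
proof -
  define s where "s = (\<lambda>t::real. snd q + t *\<^sub>R snd u)"
  define c where "c = (\<lambda>t. (sqrt (1 + s t \<bullet> s t), s t))"
  have fq: "fst q = sqrt (1 + snd q \<bullet> snd q)"
    using q by (intro real_sqrt_unique[symmetric]) (auto simp: hyp_space_def mink_def power2_eq_square)
  have pos: "1 + s t \<bullet> s t > 0" for t
    using inner_ge_zero[of "s t"] by linarith
  have "c t \<in> hyp_space" for t
    using pos[of t] by (simp add: c_def hyp_space_def mink_def abs_of_pos)
  moreover have "c 0 = q"
    by (simp add: c_def s_def fq prod_eq_iff)
  moreover have "(c has_vector_derivative u) (at 0)"
  proof -
    have s: "(s has_derivative (\<lambda>h. h *\<^sub>R snd u)) (at 0)"
      unfolding s_def by (auto intro!: derivative_eq_intros)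
    have e: "s 0 \<bullet> snd u = fst u * sqrt (1 + s 0 \<bullet> s 0)"
      using u by (simp add: s_def fq[symmetric] mink_def)
    have "((\<lambda>t. 1 + s t \<bullet> s t) has_derivative (\<lambda>h. 0 + (s 0 \<bullet> (h *\<^sub>R snd u) + (h *\<^sub>R snd u) \<bullet> s 0))) (at 0)"
      by (intro has_derivative_add has_derivative_const has_derivative_inner s)
    hence "((\<lambda>t. sqrt (1 + s t \<bullet> s t)) has_derivative
        (\<lambda>h. (0 + (s 0 \<bullet> (h *\<^sub>R snd u) + (h *\<^sub>R snd u) \<bullet> s 0)) * (inverse (sqrt (1 + s 0 \<bullet> s 0)) / 2))) (at 0)"
      by (rule has_derivative_real_sqrt[rotated]) (rule pos)
    moreover have "(\<lambda>h. (0 + (s 0 \<bullet> (h *\<^sub>R snd u) + (h *\<^sub>R snd u) \<bullet> s 0)) * (inverse (sqrt (1 + s 0 \<bullet> s 0)) / 2))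
        = (\<lambda>h. h *\<^sub>R fst u)"
      using pos[of 0] by (simp add: fun_eq_iff inner_commute[of "snd u"] e)
    ultimately have "((\<lambda>t. sqrt (1 + s t \<bullet> s t)) has_derivative (\<lambda>h. h *\<^sub>R fst u)) (at 0)"
      by simp
    with s have "(c has_derivative (\<lambda>h. (h *\<^sub>R fst u, h *\<^sub>R snd u))) (at 0)"
      unfolding c_def by (intro has_derivative_Pair)
    thus ?thesis
      by (simp add: has_vector_derivative_def scaleR_prod_def)
  qed
  ultimately show ?thesis by blast
qed

text \<open>Two candidates for the gradient pair equally with every tangent vector, in particular
  with their own difference, whose square is then 0; positivity on tangent vectors makes the
  difference vanish.\<close>

lemma hyp_grad_eqI:
  assumes q: "q \<in> hyp_space" and v: "mink q v = 0"
    and D: "\<And>c u. (\<forall>t::real. c t \<in> hyp_space) \<Longrightarrow> c 0 = q \<Longrightarrow> (c has_vector_derivative u) (at 0) \<Longrightarrow>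
        ((\<lambda>t. f (c t)) has_real_derivative mink v u) (at 0)"
  shows "hyp_grad f q = v"
  unfolding hyp_grad_def
proof (rule the_equality, intro conjI allI impI)
  fix v' assume v': "v' \<in> hyp_tangent q \<and>
     (\<forall>c u. (\<forall>t::real. c t \<in> hyp_space) \<and> c 0 = q \<and> (c has_vector_derivative u) (at 0) \<longrightarrow>
        ((\<lambda>t. f (c t)) has_real_derivative mink v' u) (at 0))"
  have t: "mink q (v' - v) = 0" using v v' by (simp add: hyp_tangent_def mink_linear)
  obtain c where c: "\<forall>t::real. c t \<in> hyp_space" "c 0 = q" "(c has_vector_derivative (v' - v)) (at 0)"
    using hyp_space_curve[OF q t] by blast
  have "mink v' (v' - v) = mink v (v' - v)"
    using DERIV_unique D[OF c] v' c by blast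
  hence "mink (v' - v) (v' - v) = 0" by (simp add: mink_linear)
  thus "v' = v" using mink_pos_tangent[OF q t] by force
qed (use v D in \<open>auto simp: hyp_tangent_def\<close>)

text \<open>The derivative of \<open>arcosh\<close> at C contributes 1 / sqrt (C^2 - 1), and the
  hyperbolic sine of \<open>arcosh\<close> C is the reciprocal of that factor. At
  \<open>q = p\<close> the factor \<open>sinh 0\<close> annihilates whatever \<open>hyp_grad\<close>
  denotes there, and the projection of \<open>- p\<close> is 0 as well.\<close>

lemma radial_field_eq:
  assumes p: "p \<in> hyp_space" and q: "q \<in> hyp_space"
  shows "radial_field p q = hyp_proj q (- p)"
proof (cases "q = p")
  case True
  thus ?thesis using p by (simp add: radial_field_def hyp_dist_def hyp_proj_def mink_linear hyp_space_mink)
next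
  case False
  define C where "C = - mink p q"
  have C: "C > 1" using mink_hyp_space_le[OF p q] False by (auto simp: C_def order_less_le)
  hence C1: "C\<^sup>2 > 1" by (simp add: one_less_power)
  have "hyp_grad (hyp_dist p) q = (1 / sqrt (C\<^sup>2 - 1)) *\<^sub>R hyp_proj q (- p)"
  proof (rule hyp_grad_eqI[OF q])
    show "mink q ((1 / sqrt (C\<^sup>2 - 1)) *\<^sub>R hyp_proj q (- p)) = 0"
      by (simp add: mink_linear mink_hyp_proj[OF q])
    fix c u assume c: "\<forall>t::real. c t \<in> hyp_space" "c 0 = q" "(c has_vector_derivative u) (at 0)"
    have cd: "(c has_derivative (\<lambda>h. h *\<^sub>R u)) (at 0)"
      using c by (simp add: has_vector_derivative_def)
    \<comment> \<open>Differentiating the equation of the sheet along the curve shows that its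
      velocity is tangent; pairing with it then ignores the component of
      \<open>hyp_proj q (- p)\<close> along \<open>q\<close>.\<close>
    have "((\<lambda>t. mink (c t) (c t)) has_derivative (\<lambda>h. mink (c 0) (h *\<^sub>R u) + mink (h *\<^sub>R u) (c 0))) (at 0)"
      by (rule mink.FDERIV[OF cd cd])
    moreover have "((\<lambda>t. mink (c t) (c t)) has_derivative (\<lambda>h. 0)) (at 0)"
      using c by (simp add: hyp_space_mink)
    ultimately have "(\<lambda>h. mink (c 0) (h *\<^sub>R u) + mink (h *\<^sub>R u) (c 0)) = (\<lambda>h. 0)"
      by (rule has_derivative_unique)
    from fun_cong[OF this, of 1] have qu: "mink q u = 0"
      using c by (simp add: mink_commute)
    have "((\<lambda>t. - mink p (c t)) has_derivative (\<lambda>h. - mink p (h *\<^sub>R u))) (at 0)"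
      by (intro has_derivative_minus bounded_linear.has_derivative[OF mink.bounded_linear_right] cd)
    hence d: "((\<lambda>t. - mink p (c t)) has_real_derivative (- mink p u)) (at 0)"
      unfolding has_field_derivative_def by (rule has_derivative_eq_rhs) (simp add: fun_eq_iff mink_linear)
    have "((\<lambda>t. arcosh (- mink p (c t))) has_real_derivative (1 / sqrt (C\<^sup>2 - 1) * (- mink p u))) (at 0)"
      using DERIV_chain2[OF arcosh_real_has_field_derivative d] C c(2) by (simp add: C_def)
    moreover have "mink ((1 / sqrt (C\<^sup>2 - 1)) *\<^sub>R hyp_proj q (- p)) u = 1 / sqrt (C\<^sup>2 - 1) * (- mink p u)"
      using qu by (simp add: hyp_proj_def mink_linear)
    ultimately show "((\<lambda>t. hyp_dist p (c t)) has_real_derivative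
        mink ((1 / sqrt (C\<^sup>2 - 1)) *\<^sub>R hyp_proj q (- p)) u) (at 0)"
      by (simp add: hyp_dist_def)
  qed
  moreover have "sinh (hyp_dist p q) = sqrt (C\<^sup>2 - 1)"
    using C by (simp add: hyp_dist_def C_def[symmetric] sinh_arcosh_real)
  ultimately show ?thesis using C1 by (simp add: radial_field_def)
qed

lemma w_hyp_dist:
  assumes p: "p \<in> hyp_space" and q: "q \<in> hyp_space"
  shows "w (hyp_dist p q) = - mink p q - 1"
proof -
  have C: "- mink p q \<ge> 1" using mink_hyp_space_le[OF p q] by simp
  hence nn: "hyp_dist p q \<ge> 0" by (simp add: hyp_dist_def arcosh_nonneg_real)
  have "(sinh has_integral (cosh (hyp_dist p q) - cosh 0)) {0..hyp_dist p q}"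
    using nn by (intro fundamental_theorem_of_calculus)
       (auto intro!: derivative_eq_intros simp: has_real_derivative_iff_has_vector_derivative[symmetric])
  hence "w (hyp_dist p q) = cosh (hyp_dist p q) - 1"
    unfolding w_def by (simp add: integral_unique)
  thus ?thesis using C by (simp add: hyp_dist_def cosh_arcosh_real)
qed

section \<open>Calculus in the plane\<close>

lemma smooth_on_imp_differentiable: "smooth_on U f \<Longrightarrow> x \<in> U \<Longrightarrow> f differentiable (at x)"
  unfolding smooth_on_def by (metis Ck_on.simps(2))

lemma smooth_on_imp_continuous_on: "smooth_on U f \<Longrightarrow> continuous_on U f"
  unfolding smooth_on_def by (metis Ck_on.simps(1))

lemma smooth_on_frechet_derivative:
  "smooth_on U f \<Longrightarrow> smooth_on U (\<lambda>x. frechet_derivative f (at x) v)"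
  unfolding smooth_on_def by (metis Ck_on.simps(2))

lemma smooth_on_partial_deriv: "smooth_on U f \<Longrightarrow> smooth_on U (partial_deriv i f)"
  unfolding partial_deriv_def by (rule smooth_on_frechet_derivative)

lemma partial_deriv_eqI: "(f has_derivative f') (at y) \<Longrightarrow> partial_deriv i f y = f' (axis i 1)"
  unfolding partial_deriv_def by (simp flip: frechet_derivative_at)

lemma vec2_eq_sum_axis: "(h :: real^2) = (h $ 1) *\<^sub>R axis 1 1 + (h $ 2) *\<^sub>R axis 2 1"
  by (simp add: vec_eq_iff forall_2 axis_def)

lemma linear_vec2_apply:
  assumes "linear (L :: real^2 \<Rightarrow> 'b::real_vector)"
  shows "L h = (h $ 1) *\<^sub>R L (axis 1 1) + (h $ 2) *\<^sub>R L (axis 2 1)"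
  by (subst vec2_eq_sum_axis[of h]) (simp add: linear_add[OF assms] linear_scale[OF assms])

lemma differentiable_has_derivative_partial:
  assumes "f differentiable (at y)"
  shows "(f has_derivative (\<lambda>h. (h $ 1) *\<^sub>R partial_deriv 1 f y + (h $ 2) *\<^sub>R partial_deriv 2 f y)) (at y)"
proof -
  have d: "(f has_derivative frechet_derivative f (at y)) (at y)"
    using assms by (simp add: frechet_derivative_works)
  show ?thesis
    by (rule has_derivative_eq_rhs[OF d])
       (simp add: fun_eq_iff partial_deriv_def flip: linear_vec2_apply[OF has_derivative_linear[OF d]])
qed

lemma frechet_derivative_apply_partial:
  assumes "f differentiable (at y)"
  shows "frechet_derivative f (at y) h = (h $ 1) *\<^sub>R partial_deriv 1 f y + (h $ 2) *\<^sub>R partial_deriv 2 f y"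
  by (simp flip: frechet_derivative_at[OF differentiable_has_derivative_partial[OF assms]])

section \<open>Symmetry of second derivatives\<close>

lemma mixed_difference_mvt:
  fixes g :: "'a::real_normed_vector \<Rightarrow> real"
  assumes h: "0 < h" and U: "\<And>s t. 0 \<le> s \<Longrightarrow> s \<le> h \<Longrightarrow> 0 \<le> t \<Longrightarrow> t \<le> h \<Longrightarrow> x + s *\<^sub>R e + t *\<^sub>R e' \<in> U"
    and a: "\<And>y. y \<in> U \<Longrightarrow> ((\<lambda>t. g (y + t *\<^sub>R e)) has_real_derivative a y) (at 0)"
    and A: "\<And>y. y \<in> U \<Longrightarrow> ((\<lambda>t. a (y + t *\<^sub>R e')) has_real_derivative A y) (at 0)"
  shows "\<exists>s t. 0 < s \<and> s < h \<and> 0 < t \<and> t < h \<and>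
     g (x + h *\<^sub>R e + h *\<^sub>R e') - g (x + h *\<^sub>R e) - g (x + h *\<^sub>R e') + g x = h\<^sup>2 * A (x + s *\<^sub>R e + t *\<^sub>R e')"
proof -
  have da: "((\<lambda>s. g (x + s *\<^sub>R e + t *\<^sub>R e')) has_real_derivative a (x + s *\<^sub>R e + t *\<^sub>R e')) (at s)"
    if "0 \<le> s" "s \<le> h" "0 \<le> t" "t \<le> h" for s t
    using a[OF U[OF that]] DERIV_shift[of "\<lambda>s. g (x + s *\<^sub>R e + t *\<^sub>R e')" "a (x + s *\<^sub>R e + t *\<^sub>R e')" 0 s]
    by (simp add: algebra_simps)
  have dA: "((\<lambda>t. a (x + s *\<^sub>R e + t *\<^sub>R e')) has_real_derivative A (x + s *\<^sub>R e + t *\<^sub>R e')) (at t)"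
    if "0 \<le> s" "s \<le> h" "0 \<le> t" "t \<le> h" for s t
    using A[OF U[OF that]] DERIV_shift[of "\<lambda>t. a (x + s *\<^sub>R e + t *\<^sub>R e')" "A (x + s *\<^sub>R e + t *\<^sub>R e')" 0 t]
    by (simp add: algebra_simps)
  have "\<exists>s>0. s < h \<and>
     (g (x + h *\<^sub>R e + h *\<^sub>R e') - g (x + h *\<^sub>R e + 0 *\<^sub>R e')) - (g (x + 0 *\<^sub>R e + h *\<^sub>R e') - g (x + 0 *\<^sub>R e + 0 *\<^sub>R e'))
      = (h - 0) * (a (x + s *\<^sub>R e + h *\<^sub>R e') - a (x + s *\<^sub>R e + 0 *\<^sub>R e'))"
    using h by (intro MVT2[where f = "\<lambda>s. g (x + s *\<^sub>R e + h *\<^sub>R e') - g (x + s *\<^sub>R e + 0 *\<^sub>R e')"] DERIV_diff da) auto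
  then obtain s where s: "0 < s" "s < h" and es: "g (x + h *\<^sub>R e + h *\<^sub>R e') - g (x + h *\<^sub>R e) - g (x + h *\<^sub>R e') + g x
      = h * (a (x + s *\<^sub>R e + h *\<^sub>R e') - a (x + s *\<^sub>R e))"
    by (auto simp: algebra_simps)
  have "\<exists>t>0. t < h \<and> a (x + s *\<^sub>R e + h *\<^sub>R e') - a (x + s *\<^sub>R e + 0 *\<^sub>R e') = (h - 0) * A (x + s *\<^sub>R e + t *\<^sub>R e')"
    using h s by (intro MVT2[where f = "\<lambda>t. a (x + s *\<^sub>R e + t *\<^sub>R e')"] dA) auto
  then obtain t where "0 < t" "t < h" "a (x + s *\<^sub>R e + h *\<^sub>R e') - a (x + s *\<^sub>R e) = h * A (x + s *\<^sub>R e + t *\<^sub>R e')"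
    by auto
  with s es show ?thesis by (auto simp: power2_eq_square)
qed

text \<open>The second difference over a small parallelogram is symmetric in \<open>e\<close> and
  \<open>e'\<close>. By the mean value theorem in each order it is \<open>h^2\<close> times either
  mixed derivative at some intermediate point; as the parallelogram shrinks to \<open>x\<close>,
  continuity of both derivatives identifies their values there.\<close>

lemma mixed_derivatives_symmetric:
  fixes g :: "'a::real_normed_vector \<Rightarrow> real"
  assumes U: "open U" "x \<in> U"
    and a: "\<And>y. y \<in> U \<Longrightarrow> ((\<lambda>t. g (y + t *\<^sub>R e)) has_real_derivative a y) (at 0)"
    and b: "\<And>y. y \<in> U \<Longrightarrow> ((\<lambda>t. g (y + t *\<^sub>R e')) has_real_derivative b y) (at 0)"
    and A: "\<And>y. y \<in> U \<Longrightarrow> ((\<lambda>t. a (y + t *\<^sub>R e')) has_real_derivative A y) (at 0)"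
    and B: "\<And>y. y \<in> U \<Longrightarrow> ((\<lambda>t. b (y + t *\<^sub>R e)) has_real_derivative B y) (at 0)"
    and cont: "continuous_on U A" "continuous_on U B"
  shows "A x = B x"
proof -
  obtain r where r: "r > 0" "ball x r \<subseteq> U" using U open_contains_ball by blast
  \<comment> \<open>The summand 1 keeps the denominator positive even for zero directions.\<close>
  define d where "d = r / (norm e + norm e' + 1)"
  have ne: "norm e + norm e' + 1 > 0" by (smt (verit) norm_ge_zero)
  have d: "d > 0" unfolding d_def using r ne by simp
  have near: "norm (s *\<^sub>R e + t *\<^sub>R e') \<le> h * (norm e + norm e' + 1)"
    if "0 \<le> s" "s \<le> h" "0 \<le> t" "t \<le> h" for s t h
  proof -
    have "norm (s *\<^sub>R e + t *\<^sub>R e') \<le> norm (s *\<^sub>R e) + norm (t *\<^sub>R e')" by (rule norm_triangle_ineq)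
    also have "\<dots> = s * norm e + t * norm e'" using that by simp
    also have "\<dots> \<le> h * norm e + h * norm e'" using that by (intro add_mono mult_right_mono) auto
    finally show ?thesis using that by (simp add: algebra_simps)
  qed
  have inU: "x + s *\<^sub>R e + t *\<^sub>R e' \<in> U"
    if "0 \<le> s" "s \<le> h" "0 \<le> t" "t \<le> h" "h < d" for s t h
  proof -
    have "norm (s *\<^sub>R e + t *\<^sub>R e') \<le> h * (norm e + norm e' + 1)" using near that by blast
    also have "\<dots> < d * (norm e + norm e' + 1)" using ne that by simp
    also have "\<dots> = r" using ne by (simp add: d_def)
    finally have "x + (s *\<^sub>R e + t *\<^sub>R e') \<in> ball x r"
      unfolding mem_ball dist_norm diff_add_eq_diff_diff_swap by (metis add_diff_cancel_left' norm_minus_commute diff_diff_eq2 add.commute)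
    thus ?thesis using r by (auto simp: add.assoc)
  qed
  \<comment> \<open>The offset 2, rather than 1, makes already the first side length strictly
    smaller than \<open>d\<close>.\<close>
  define h where "h n = d / (real n + 2)" for n :: nat
  have h: "0 < h n" "h n < d" for n using d by (auto simp: h_def field_simps intro: add_pos_nonneg)
  have h0: "(\<lambda>n. h n * (norm e + norm e' + 1)) \<longlonglongrightarrow> 0"
  proof -
    have "(\<lambda>n. d / real (n + 2)) \<longlonglongrightarrow> 0"
      by (rule LIMSEQ_ignore_initial_segment[OF lim_const_over_n])
    from tendsto_mult_left_zero[OF this, of "norm e + norm e' + 1"] show ?thesis by (simp add: h_def[abs_def] add.commute)
  qed
  have "\<exists>y z. y \<in> U \<and> z \<in> U \<and> norm (y - x) \<le> h n * (norm e + norm e' + 1) \<and>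
      norm (z - x) \<le> h n * (norm e + norm e' + 1) \<and> A y = B z" for n
  proof -
    have U1: "x + s *\<^sub>R e + t *\<^sub>R e' \<in> U" if "0 \<le> s" "s \<le> h n" "0 \<le> t" "t \<le> h n" for s t
      using inU[OF that h(2)] .
    obtain s t where st: "0 < s" "s < h n" "0 < t" "t < h n" and
      1: "g (x + h n *\<^sub>R e + h n *\<^sub>R e') - g (x + h n *\<^sub>R e) - g (x + h n *\<^sub>R e') + g x = (h n)\<^sup>2 * A (x + s *\<^sub>R e + t *\<^sub>R e')"
      using mixed_difference_mvt[OF h(1)[of n] U1 a A] by blast
    have U': "x + s *\<^sub>R e' + t *\<^sub>R e \<in> U" if "0 \<le> s" "s \<le> h n" "0 \<le> t" "t \<le> h n" for s t
      using inU[OF that(3,4,1,2) h(2)] by (simp add: algebra_simps)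
    obtain s' t' where st': "0 < s'" "s' < h n" "0 < t'" "t' < h n" and
      2: "g (x + h n *\<^sub>R e' + h n *\<^sub>R e) - g (x + h n *\<^sub>R e') - g (x + h n *\<^sub>R e) + g x = (h n)\<^sup>2 * B (x + s' *\<^sub>R e' + t' *\<^sub>R e)"
      using mixed_difference_mvt[OF h(1)[of n] U' b B] by blast
    have "(h n)\<^sup>2 * A (x + s *\<^sub>R e + t *\<^sub>R e') = (h n)\<^sup>2 * B (x + t' *\<^sub>R e + s' *\<^sub>R e')"
      using 1 2 by (simp add: algebra_simps)
    hence "A (x + s *\<^sub>R e + t *\<^sub>R e') = B (x + t' *\<^sub>R e + s' *\<^sub>R e')" using h(1)[of n] by simp
    moreover have "norm (x + s *\<^sub>R e + t *\<^sub>R e' - x) \<le> h n * (norm e + norm e' + 1)"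
      using near[of s "h n" t] st by (simp add: algebra_simps)
    moreover have "norm (x + t' *\<^sub>R e + s' *\<^sub>R e' - x) \<le> h n * (norm e + norm e' + 1)"
      using near[of t' "h n" s'] st' by (simp add: algebra_simps)
    ultimately show ?thesis
      using inU[of s "h n" t] inU[of t' "h n" s'] st st' h(2)[of n]
      by (intro exI[of _ "x + s *\<^sub>R e + t *\<^sub>R e'"] exI[of _ "x + t' *\<^sub>R e + s' *\<^sub>R e'"]) auto
  qed
  then obtain y z where yz: "\<And>n. y n \<in> U" "\<And>n. z n \<in> U"
    "\<And>n. norm (y n - x) \<le> h n * (norm e + norm e' + 1)"
    "\<And>n. norm (z n - x) \<le> h n * (norm e + norm e' + 1)" "\<And>n. A (y n) = B (z n)"
    by metis
  have "y \<longlonglongrightarrow> x" "z \<longlonglongrightarrow> x"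
    using yz by (auto intro!: LIM_zero_cancel[where l = x] Lim_null_comparison[OF _ h0] always_eventually)
  hence "(\<lambda>n. A (y n)) \<longlonglongrightarrow> A x" "(\<lambda>n. B (z n)) \<longlonglongrightarrow> B x"
    by (auto intro: continuous_on_tendsto_compose[OF cont(1)] continuous_on_tendsto_compose[OF cont(2)]
        simp: U yz(1,2))
  thus ?thesis using yz(5) LIMSEQ_unique by auto
qed

lemma has_derivative_imp_directional:
  assumes "(f has_derivative f') (at (y::'a::real_normed_vector))"
  shows "((\<lambda>t::real. f (y + t *\<^sub>R e)) has_vector_derivative f' e) (at 0)"
proof -
  have "((\<lambda>t::real. y + t *\<^sub>R e) has_vector_derivative e) (at 0)"
    by (auto intro!: derivative_eq_intros)
  from vector_derivative_diff_chain_within[of "\<lambda>t::real. y + t *\<^sub>R e" e 0 UNIV f f'] this assms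
  show ?thesis by (simp add: o_def has_derivative_at_withinI)
qed

text \<open>The mean value theorem behind the symmetry needs real values, so it is applied to the
  inner product with each basis vector.\<close>

lemma smooth_on_partial_deriv_commute:
  fixes f :: "real^2 \<Rightarrow> 'b::euclidean_space"
  assumes U: "open U" "y \<in> U" and f: "smooth_on U f"
  shows "partial_deriv i (partial_deriv j f) y = partial_deriv j (partial_deriv i f) y"
proof (rule euclidean_eqI)
  fix b :: 'b assume "b \<in> Basis"
  have dir: "((\<lambda>t. k (z + t *\<^sub>R axis i 1) \<bullet> b) has_real_derivative partial_deriv i k z \<bullet> b) (at 0)"
    if "smooth_on U k" "z \<in> U" for k :: "real^2 \<Rightarrow> 'b" and z i
  proof -
    have "(k has_derivative frechet_derivative k (at z)) (at z)"
      using smooth_on_imp_differentiable[OF that] by (simp add: frechet_derivative_works)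
    hence "((\<lambda>z. k z \<bullet> b) has_derivative (\<lambda>h. frechet_derivative k (at z) h \<bullet> b)) (at z)"
      by (rule has_derivative_inner_left)
    from has_derivative_imp_directional[OF this] show ?thesis
      by (simp add: partial_deriv_def has_real_derivative_iff_has_vector_derivative)
  qed
  have cont: "continuous_on U (\<lambda>z. partial_deriv i (partial_deriv j f) z \<bullet> b)" for i j
    by (intro continuous_intros smooth_on_imp_continuous_on smooth_on_partial_deriv f)
  show "partial_deriv i (partial_deriv j f) y \<bullet> b = partial_deriv j (partial_deriv i f) y \<bullet> b"
    by (rule mixed_derivatives_symmetric[OF U, where g = "\<lambda>z. f z \<bullet> b"
            and a = "\<lambda>z. partial_deriv j f z \<bullet> b" and b = "\<lambda>z. partial_deriv i f z \<bullet> b"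
            and e = "axis j 1" and e' = "axis i 1"])
       (intro dir smooth_on_partial_deriv f cont; assumption)+
qed

text \<open>The difference quotients of \<open>g\<close> integrate to \<open>0\<close> by translation invariance.\<close>

lemma integral_directional_derivative_eq_0:
  fixes g :: "'a::euclidean_space \<Rightarrow> real"
  assumes der: "\<And>y. (g has_derivative g' y) (at y)"
    and cont: "continuous_on UNIV (\<lambda>y. g' y e)"
    and K: "compact K" "\<And>y. y \<notin> K \<Longrightarrow> g y = 0"
  shows "integrable lborel (\<lambda>y. g' y e)" "(\<integral>y. g' y e \<partial>lborel) = 0"
proof -
  have dir: "((\<lambda>t. g (y + t *\<^sub>R e)) has_real_derivative g' y e) (at 0)" for y
    using has_derivative_imp_directional[OF der]
    by (simp add: has_real_derivative_iff_has_vector_derivative)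
  have dirs: "((\<lambda>t. g (y + t *\<^sub>R e)) has_real_derivative g' (y + s *\<^sub>R e) e) (at s)" for y s
    using dir[of "y + s *\<^sub>R e"] DERIV_shift[of "\<lambda>t. g (y + t *\<^sub>R e)" "g' (y + s *\<^sub>R e) e" 0 s]
    by (simp add: algebra_simps)
  have out: "g' y e = 0" if "y \<notin> K" for y
  proof -
    have "open (- K)" using K by (simp add: compact_imp_closed open_Compl)
    hence "(g has_derivative (\<lambda>_. 0)) (at y)"
      by (rule has_derivative_transform_within_open[OF has_derivative_const[of 0]]) (use that K(2) in auto)
    with der have "g' y = (\<lambda>_. 0)" by (rule has_derivative_unique)
    thus ?thesis by simp
  qed
  obtain M where M: "M \<ge> 0" "\<And>y. \<bar>g' y e\<bar> \<le> M"
  proof -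
    have "compact ((\<lambda>y. g' y e) ` K)"
      by (rule compact_continuous_image[OF continuous_on_subset[OF cont] K(1)]) simp
    then obtain M where "\<forall>x\<in>(\<lambda>y. g' y e) ` K. norm x \<le> M" "M > 0"
      using compact_imp_bounded bounded_pos by blast
    moreover from this have "\<bar>g' y e\<bar> \<le> M" for y
      using out[of y] by (cases "y \<in> K") auto
    ultimately show ?thesis using that less_imp_le by blast
  qed
  have cg: "continuous_on UNIV g"
    using der by (intro continuous_at_imp_continuous_on ballI has_derivative_continuous)
  have gm [measurable]: "g \<in> borel_measurable borel" by (rule borel_measurable_continuous_onI[OF cg])
  have g'm [measurable]: "(\<lambda>y. g' y e) \<in> borel_measurable borel" by (rule borel_measurable_continuous_onI[OF cont])
  have gi: "integrable lborel g"
  proof -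
    have "integrable lborel (\<lambda>x. indicator K x *\<^sub>R g x)"
      by (rule borel_integrable_compact[OF K(1) continuous_on_subset[OF cg]]) simp
    moreover have "(\<lambda>x. indicator K x *\<^sub>R g x) = g" using K(2) by (auto simp: indicator_def fun_eq_iff)
    ultimately show ?thesis by simp
  qed
  have tr: "integrable lborel (\<lambda>y. g (c + y))" "(\<integral>y. g (c + y) \<partial>lborel) = (\<integral>y. g y \<partial>lborel)" for c
    using gi integrable_distr_eq[of "(+) c" lborel borel g] integral_distr[of "(+) c" lborel borel g]
    by (auto simp: lborel_distr_plus)
  \<comment> \<open>These are the points from which some step \<open>t *\<^sub>R e\<close> with 0
    \<le> t \<le> 1 reaches \<open>K\<close>. All difference quotients \<open>s n\<close> vanish off
    this one compact set, so a constant times its indicator dominates the sequence.\<close>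
  define K' where "K' = (\<lambda>(x, t). x - t *\<^sub>R e) ` (K \<times> {0..1::real})"
  have K': "compact K'"
    unfolding K'_def by (intro compact_continuous_image compact_Times K)
      (auto intro!: continuous_intros simp: case_prod_beta)
  hence K'm [measurable]: "K' \<in> sets borel" by (simp add: compact_imp_closed)
  define s where "s n y = (g (y + (1 / real (Suc n)) *\<^sub>R e) - g y) / (1 / real (Suc n))" for n y
  have s0: "(\<integral>y. s n y \<partial>lborel) = 0" for n
    unfolding s_def using tr[of "(1 / real (Suc n)) *\<^sub>R e"] gi by (simp add: add.commute)
  have bnd: "norm (s n y) \<le> M * indicator K' y" for n y
  proof (cases "y \<in> K'")
    case True
    have "\<exists>z>0. z < 1 / real (Suc n) \<and> g (y + (1 / real (Suc n)) *\<^sub>R e) - g (y + 0 *\<^sub>R e)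
        = (1 / real (Suc n) - 0) * g' (y + z *\<^sub>R e) e"
      by (intro MVT2 dirs) auto
    then obtain z where "g (y + (1 / real (Suc n)) *\<^sub>R e) - g y = (1 / real (Suc n)) * g' (y + z *\<^sub>R e) e" by auto
    hence "s n y = g' (y + z *\<^sub>R e) e" unfolding s_def by simp
    thus ?thesis using M True by simp
  next
    case False
    have "y + t *\<^sub>R e \<notin> K" if "0 \<le> t" "t \<le> 1" for t
    proof
      assume "y + t *\<^sub>R e \<in> K"
      hence "(\<lambda>(x, t). x - t *\<^sub>R e) (y + t *\<^sub>R e, t) \<in> K'"
        unfolding K'_def using that by (intro imageI) auto
      with False show False by simp
    qed
    from this[of 0] this[of "1 / real (Suc n)"] have "s n y = 0" unfolding s_def using K(2) by simp
    thus ?thesis using False by simp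
  qed
  have lim: "(\<lambda>n. s n y) \<longlonglongrightarrow> g' y e" for y
  proof -
    have "((\<lambda>h. (g (y + (0 + h) *\<^sub>R e) - g (y + 0 *\<^sub>R e)) / h) \<longlongrightarrow> g' y e) (at 0)"
      using dir[of y] unfolding DERIV_def .
    hence "((\<lambda>h. (g (y + h *\<^sub>R e) - g y) / h) \<longlongrightarrow> g' y e) (at 0)" by simp
    moreover have "filterlim (\<lambda>n. 1 / real (Suc n)) (at 0) sequentially"
      by (intro filterlim_atI LIMSEQ_Suc lim_1_over_n) auto
    ultimately show ?thesis
      unfolding s_def by (rule filterlim_compose)
  qed
  have sm: "s n \<in> borel_measurable lborel" for n unfolding s_def[abs_def] by measurable
  have int: "integrable lborel (\<lambda>y. M * indicator K' y :: real)"
    using emeasure_compact_finite[OF K'] by (intro integrable_mult_right) (simp add: integrable_real_indicator)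
  show "integrable lborel (\<lambda>y. g' y e)"
    by (rule integrable_dominated_convergence[OF _ _ int, of _ s]) (use lim bnd sm in auto)
  have "(\<lambda>n. \<integral>y. s n y \<partial>lborel) \<longlonglongrightarrow> (\<integral>y. g' y e \<partial>lborel)"
    by (rule integral_dominated_convergence[OF _ _ int]) (use lim bnd sm in auto)
  thus "(\<integral>y. g' y e \<partial>lborel) = 0" using s0 by (simp add: LIMSEQ_const_iff)
qed

text \<open>A function with compact support in \<open>U\<close> is extended by 0. The extension is
  of class C^1 on the open sets \<open>U\<close> and \<open>- K\<close>, which together cover the
  plane. The indicator is there because \<open>g\<close> is arbitrary outside
  \<open>U\<close>.\<close>

lemma integral_partial_deriv_eq_0:
  fixes g :: "real^2 \<Rightarrow> real"
  assumes U: "open U" and g: "Ck_on 1 U g" and K: "compact K" "K \<subseteq> U" "\<And>y. y \<in> U - K \<Longrightarrow> g y = 0"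
  shows "integrable lborel (\<lambda>y. indicator U y * partial_deriv i g y)"
    and "(\<integral>y. indicator U y * partial_deriv i g y \<partial>lborel) = 0"
proof -
  define h where "h y = (if y \<in> U then g y else 0)" for y
  define h' where "h' y = (if y \<in> U then frechet_derivative g (at y) else (\<lambda>_. 0))" for y
  have oK: "open (- K)" using K by (simp add: compact_imp_closed open_Compl)
  have h0: "h y = 0" if "y \<notin> K" for y using that K by (auto simp: h_def)
  have der: "(h has_derivative h' y) (at y)" for y
  proof (cases "y \<in> U")
    case True
    hence "(g has_derivative frechet_derivative g (at y)) (at y)"
      using g by (simp add: frechet_derivative_works)
    moreover have "\<And>x. x \<in> U \<Longrightarrow> g x = h x" by (simp add: h_def)
    ultimately have "(h has_derivative frechet_derivative g (at y)) (at y)"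
      by (rule has_derivative_transform_within_open[OF _ U True])
    moreover have "h' y = frechet_derivative g (at y)" unfolding h'_def using True by (rule if_P)
    ultimately show ?thesis by (simp only:)
  next
    case False
    with K have "y \<in> - K" by auto
    hence "(h has_derivative (\<lambda>_. 0)) (at y)"
      by (rule has_derivative_transform_within_open[OF has_derivative_const[of 0] oK]) (use h0 in auto)
    moreover have "h' y = (\<lambda>_. 0)" unfolding h'_def using False by (rule if_not_P)
    ultimately show ?thesis by (simp only:)
  qed
  have h'0: "h' y = (\<lambda>_. 0)" if "y \<notin> K" for y
  proof -
    have "(h has_derivative (\<lambda>_. 0)) (at y)"
      by (rule has_derivative_transform_within_open[OF has_derivative_const[of 0] oK]) (use that h0 in auto)
    from has_derivative_unique[OF der[of y] this] show ?thesis .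
  qed
  have "continuous_on (U \<union> - K) (\<lambda>y. h' y (axis i 1))"
  proof (rule continuous_on_open_Un[OF U oK])
    have "continuous_on U (\<lambda>y. frechet_derivative g (at y) (axis i 1))"
      using g unfolding One_nat_def Ck_on.simps by blast
    moreover have "\<And>y. y \<in> U \<Longrightarrow> h' y (axis i 1) = frechet_derivative g (at y) (axis i 1)"
      unfolding h'_def by (rule fun_cong[OF if_P])
    ultimately show "continuous_on U (\<lambda>y. h' y (axis i 1))"
      by (simp cong: continuous_on_cong)
    have "\<And>y. y \<in> - K \<Longrightarrow> h' y (axis i 1) = 0" by (simp add: h'0)
    then show "continuous_on (- K) (\<lambda>y. h' y (axis i 1))"
      by (metis (no_types, lifting) continuous_on_cong continuous_on_const)
  qed
  moreover have "U \<union> - K = UNIV" using K(2) by blast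
  ultimately have cont: "continuous_on UNIV (\<lambda>y. h' y (axis i 1))" by simp
  have e: "(\<lambda>y. h' y (axis i 1)) = (\<lambda>y. indicator U y * partial_deriv i g y)"
    by (auto simp: h'_def fun_eq_iff partial_deriv_def)
  from integral_directional_derivative_eq_0[OF der cont K(1) h0]
  show "integrable lborel (\<lambda>y. indicator U y * partial_deriv i g y)"
    "(\<integral>y. indicator U y * partial_deriv i g y \<partial>lborel) = 0" unfolding e by auto
qed

section \<open>Charts and the area measure\<close>

definition chart_image :: "'m chart \<Rightarrow> (real^2) set" where
  "chart_image c = snd c ` fst c"

definition chart_inv :: "'m chart \<Rightarrow> real^2 \<Rightarrow> 'm" where
  "chart_inv c = inv_into (fst c) (snd c)"

definition transition :: "'m chart \<Rightarrow> 'm chart \<Rightarrow> real^2 \<Rightarrow> real^2" where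
  "transition c d = snd d \<circ> chart_inv c"

definition area_density :: "(real^2 \<Rightarrow> real \<times> (real^'n)) \<Rightarrow> real^2 \<Rightarrow> real" where
  "area_density f y = sqrt (det (first_fund_form f y))"

lemma in_chart_apply: "in_chart h c y = h (chart_inv c y)"
  by (simp add: in_chart_def chart_inv_def)

lemma chart_inv_in: "y \<in> chart_image c \<Longrightarrow> chart_inv c y \<in> fst c"
  by (auto simp: chart_image_def chart_inv_def inv_into_into)

lemma chart_chart_inv: "y \<in> chart_image c \<Longrightarrow> snd c (chart_inv c y) = y"
  by (auto simp: chart_image_def chart_inv_def f_inv_into_f)

lemma in_chart_image: "x \<in> fst c \<Longrightarrow> snd c x \<in> chart_image c"
  by (auto simp: chart_image_def)

lemma first_fund_form_transform:
  assumes f: "f differentiable (at y')" and L: "linear L"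
    and k: "(k has_derivative (\<lambda>v. frechet_derivative f (at y') (L v))) (at y)"
  shows "first_fund_form k y = transpose (matrix L) ** first_fund_form f y' ** matrix L"
proof -
  have "partial_deriv i k y = L (axis i 1) $ 1 *\<^sub>R partial_deriv 1 f y' + L (axis i 1) $ 2 *\<^sub>R partial_deriv 2 f y'" for i
    unfolding partial_deriv_eqI[OF k] by (rule frechet_derivative_apply_partial[OF f])
  thus ?thesis
    by (simp add: first_fund_form_def vec_eq_iff matrix_matrix_mult_def transpose_def matrix_def sum_2
        mink_linear algebra_simps)
qed

text \<open>Absolute integrability transfers in both directions under the substitution: either both
  integrands are integrable with equal integrals, or both nonnegative integrals are infinite. This
  turns the formula for absolutely integrable functions into one between values in
  \<open>ennreal\<close>.\<close>

lemma nn_integral_change_of_variables: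
  fixes f :: "real^'m::{finite,wellorder} \<Rightarrow> real" and g :: "real^'m::_ \<Rightarrow> real^'m::_"
  assumes S: "S \<in> sets borel"
    and der: "\<And>x. x \<in> S \<Longrightarrow> (g has_derivative g' x) (at x within S)" and inj: "inj_on g S"
    and nn: "\<And>y. y \<in> g ` S \<Longrightarrow> 0 \<le> f y"
    and h: "\<And>x. x \<in> S \<Longrightarrow> h x = \<bar>det (matrix (g' x))\<bar> * f (g x)"
    and hm: "(\<lambda>x. indicator S x * h x) \<in> borel_measurable borel"
    and fm: "(\<lambda>y. indicator (g ` S) y * f y) \<in> borel_measurable borel"
  shows "(\<integral>\<^sup>+x\<in>S. ennreal (h x) \<partial>lborel) = (\<integral>\<^sup>+y\<in>g ` S. ennreal (f y) \<partial>lborel)"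
proof -
  have abs_iff: "k absolutely_integrable_on T \<longleftrightarrow> integrable lborel (\<lambda>x. indicator T x * k x)"
    and int_eq: "k absolutely_integrable_on T \<Longrightarrow> integral T k = (\<integral>x. indicator T x * k x \<partial>lborel)"
    if "(\<lambda>x. indicator T x * k x) \<in> borel_measurable borel" for k :: "real^'m::_ \<Rightarrow> real" and T
    using that set_lebesgue_integral_eq_integral(2)[of T k]
    by (simp_all add: set_integrable_def set_lebesgue_integral_def integrable_completion integral_completion)
  have nn_eq: "(\<integral>\<^sup>+x\<in>T. ennreal (k x) \<partial>lborel) =
      (if k absolutely_integrable_on T then ennreal (integral T k) else \<infinity>)"
    if m: "(\<lambda>x. indicator T x * k x) \<in> borel_measurable borel" and pos: "\<And>x. x \<in> T \<Longrightarrow> 0 \<le> k x"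
    for k :: "real^'m::_ \<Rightarrow> real" and T
  proof -
    have e: "(\<integral>\<^sup>+x\<in>T. ennreal (k x) \<partial>lborel) = (\<integral>\<^sup>+x. ennreal (indicator T x * k x) \<partial>lborel)"
      by (intro nn_integral_cong) (auto simp: indicator_def)
    have nn': "0 \<le> indicator T x * k x" for x using pos by (simp add: indicator_def)
    show ?thesis
    proof (cases "k absolutely_integrable_on T")
      case True
      thus ?thesis using nn' unfolding e
        by (simp add: int_eq[OF m] abs_iff[OF m] nn_integral_eq_integral)
    next
      case False
      hence "\<not> integrable lborel (\<lambda>x. indicator T x * k x)" using abs_iff[OF m] by simp
      hence "(\<integral>\<^sup>+x. ennreal (norm (indicator T x * k x)) \<partial>lborel) = \<infinity>"
        using m by (simp add: integrable_iff_bounded flip: top.not_eq_extremum)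
      thus ?thesis using nn' False unfolding e by simp
    qed
  qed
  have hnn: "0 \<le> h x" if "x \<in> S" for x using h[OF that] nn that by simp
  have SL: "S \<in> sets lebesgue" using S by simp
  \<comment> \<open>The substitution rule speaks of functions with values in a coordinate space, so
    real values are read as vectors with one component.\<close>
  have cov: "h absolutely_integrable_on S \<and> integral S h = b \<longleftrightarrow> f absolutely_integrable_on (g ` S) \<and> integral (g ` S) f = b" for b
  proof -
    have 1: "(\<lambda>x. (\<bar>det (matrix (g' x))\<bar> *\<^sub>R (vec (f (g x)) :: real^1)) $ 1) absolutely_integrable_on S \<longleftrightarrow> h absolutely_integrable_on S"
      unfolding absolutely_integrable_on_def
      by (intro conj_cong integrable_cong) (auto simp: h)
    have 2: "integral S (\<lambda>x. (\<bar>det (matrix (g' x))\<bar> *\<^sub>R (vec (f (g x)) :: real^1)) $ 1) = integral S h"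
      by (intro integral_cong) (simp add: h)
    show ?thesis
      using has_absolute_integral_change_of_variables[OF SL der inj, of "\<lambda>y. vec (f y) :: real^1" "vec b"]
      unfolding absolutely_integrable_on_1_iff integral_on_1_eq 1 2 by (simp add: vec_eq_iff)
  qed
  have "h absolutely_integrable_on S \<longleftrightarrow> f absolutely_integrable_on (g ` S)"
    and "h absolutely_integrable_on S \<Longrightarrow> integral S h = integral (g ` S) f"
    using cov by blast+
  thus ?thesis using nn_eq[OF hm hnn] nn_eq[OF fm nn] by simp
qed

locale closed_immersed_surface =
  fixes S :: "'m::t2_space set" and \<A> :: "'m chart set" and F :: "'m \<Rightarrow> real \<times> (real^'n)"
  assumes closed_surface: "closed_surface S \<A>" and immersion: "smooth_immersion S \<A> F"
begin

lemma compact_S: "compact S"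
  using closed_surface by (simp add: closed_surface_def)

lemma F_hyp: "x \<in> S \<Longrightarrow> F x \<in> hyp_space"
  using immersion by (auto simp: smooth_immersion_def)

lemma
  assumes "c \<in> \<A>"
  shows chart_openin: "openin (top_of_set S) (fst c)"
    and open_chart_image: "open (chart_image c)"
    and chart_homeomorphism: "homeomorphism (fst c) (chart_image c) (snd c) (chart_inv c)"
  using closed_surface assms unfolding closed_surface_def smooth_atlas_def chart_image_def chart_inv_def
  by (auto simp: split_beta)

lemma chart_subset: "c \<in> \<A> \<Longrightarrow> fst c \<subseteq> S"
  using chart_openin openin_imp_subset by blast

lemma chart_cover: "x \<in> S \<Longrightarrow> \<exists>c\<in>\<A>. x \<in> fst c"
proof -
  assume x: "x \<in> S"
  have "(\<Union>(U, \<phi>)\<in>\<A>. U) = S"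
    using closed_surface unfolding closed_surface_def smooth_atlas_def by blast
  with x show ?thesis by (metis (no_types, lifting) UN_E case_prod_beta)
qed

lemma chart_inv_chart: "c \<in> \<A> \<Longrightarrow> x \<in> fst c \<Longrightarrow> chart_inv c (snd c x) = x"
  using chart_homeomorphism by (simp add: homeomorphism_def)

lemma chart_inv_in_S: "c \<in> \<A> \<Longrightarrow> y \<in> chart_image c \<Longrightarrow> chart_inv c y \<in> S"
  using chart_inv_in chart_subset by blast

lemma in_chart_F_hyp: "c \<in> \<A> \<Longrightarrow> y \<in> chart_image c \<Longrightarrow> in_chart F c y \<in> hyp_space"
  by (simp add: in_chart_apply F_hyp chart_inv_in_S)

lemma smooth_transition:
  assumes "c \<in> \<A>" "d \<in> \<A>"
  shows "smooth_on (snd c ` (fst c \<inter> fst d)) (transition c d)"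
proof -
  have "\<forall>(U, \<phi>)\<in>\<A>. \<forall>(V, \<psi>)\<in>\<A>. smooth_on (\<phi> ` (U \<inter> V)) (\<psi> \<circ> inv_into U \<phi>)"
    using closed_surface unfolding closed_surface_def smooth_atlas_def by blast
  from bspec[OF this assms(1)] have "\<forall>(V, \<psi>)\<in>\<A>. smooth_on (snd c ` (fst c \<inter> V)) (\<psi> \<circ> inv_into (fst c) (snd c))"
    by (simp add: case_prod_beta)
  from bspec[OF this assms(2)] show ?thesis
    by (simp add: case_prod_beta transition_def chart_inv_def)
qed

lemma smooth_in_chart_F: "c \<in> \<A> \<Longrightarrow> smooth_on (chart_image c) (in_chart F c)"
  and inj_frechet_in_chart_F:
    "c \<in> \<A> \<Longrightarrow> y \<in> chart_image c \<Longrightarrow> inj (frechet_derivative (in_chart F c) (at y))"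
  using immersion by (auto simp: smooth_immersion_def chart_image_def)

lemma in_chart_F_differentiable:
  "c \<in> \<A> \<Longrightarrow> y \<in> chart_image c \<Longrightarrow> in_chart F c differentiable (at y)"
  using smooth_in_chart_F smooth_on_imp_differentiable by blast

lemma openin_chart_inv_image:
  assumes "c \<in> \<A>" "open V" "V \<subseteq> chart_image c"
  shows "openin (top_of_set S) (chart_inv c ` V)"
proof -
  have "openin (top_of_set (fst c)) (chart_inv c ` V)"
    using assms homeomorphism_imp_open_map[OF homeomorphism_symD[OF chart_homeomorphism[OF assms(1)]], of V]
    by (simp add: open_subset)
  thus ?thesis using chart_openin[OF assms(1)] openin_trans by blast
qed

lemma open_chart_overlap:
  assumes "c \<in> \<A>" "openin (top_of_set S) V"
  shows "open (snd c ` (fst c \<inter> V))"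
proof -
  have "openin (top_of_set (fst c)) (fst c \<inter> V)"
    using openin_subset_trans[of S "fst c \<inter> V" "fst c"] assms chart_openin chart_subset
    by (simp add: openin_Int)
  from homeomorphism_imp_open_map[OF chart_homeomorphism[OF assms(1)] this]
  show ?thesis using open_chart_image[OF assms(1)] openin_open_trans by blast
qed

lemma transition_has_derivative:
  assumes "c \<in> \<A>" "d \<in> \<A>" "x \<in> fst c" "x \<in> fst d"
  shows "(transition c d has_derivative frechet_derivative (transition c d) (at (snd c x))) (at (snd c x))"
  using smooth_on_imp_differentiable[OF smooth_transition[OF assms(1,2)], of "snd c x"] assms(3,4)
  by (simp add: frechet_derivative_works)

lemma in_chart_transition_has_derivative:
  assumes c: "c \<in> \<A>" "d \<in> \<A>" "x \<in> fst c" "x \<in> fst d"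
    and h: "in_chart h d differentiable (at (snd d x))"
  shows "(in_chart h c has_derivative (\<lambda>v. frechet_derivative (in_chart h d) (at (snd d x))
      (frechet_derivative (transition c d) (at (snd c x)) v))) (at (snd c x))"
proof -
  have tx: "transition c d (snd c x) = snd d x"
    using c by (simp add: transition_def chart_inv_chart)
  have "(in_chart h d has_derivative frechet_derivative (in_chart h d) (at (snd d x))) (at (transition c d (snd c x)))"
    using h by (simp add: frechet_derivative_works tx)
  from diff_chain_at[OF transition_has_derivative[OF c] this]
  have "(in_chart h d \<circ> transition c d has_derivative (\<lambda>v. frechet_derivative (in_chart h d) (at (snd d x))
      (frechet_derivative (transition c d) (at (snd c x)) v))) (at (snd c x))"
    by (simp add: o_def)
  moreover have "(in_chart h d \<circ> transition c d) y = in_chart h c y" if "y \<in> snd c ` (fst c \<inter> fst d)" for y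
    using that c by (auto simp: in_chart_apply transition_def chart_inv_chart)
  moreover have "snd c x \<in> snd c ` (fst c \<inter> fst d)" using c(3,4) by blast
  ultimately show ?thesis
    using has_derivative_transform_within_open open_chart_overlap[OF c(1) chart_openin[OF c(2)]] by blast
qed

lemma area_density_transition:
  assumes c: "c \<in> \<A>" "d \<in> \<A>" "x \<in> fst c" "x \<in> fst d"
  shows "area_density (in_chart F c) (snd c x) =
    \<bar>det (matrix (frechet_derivative (transition c d) (at (snd c x))))\<bar> * area_density (in_chart F d) (snd d x)"
proof -
  have d: "in_chart F d differentiable (at (snd d x))"
    by (rule in_chart_F_differentiable[OF c(2) in_chart_image[OF c(4)]])
  have L: "linear (frechet_derivative (transition c d) (at (snd c x)))"
    using transition_has_derivative[OF c] has_derivative_linear by blast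
  let ?M = "matrix (frechet_derivative (transition c d) (at (snd c x)))"
  have "det (first_fund_form (in_chart F c) (snd c x)) = (det ?M)\<^sup>2 * det (first_fund_form (in_chart F d) (snd d x))"
    unfolding first_fund_form_transform[OF d L in_chart_transition_has_derivative[OF c d]]
    by (simp only: det_mul det_transpose power2_eq_square mult_ac)
  thus ?thesis
    by (simp only: area_density_def real_sqrt_mult real_sqrt_abs)
qed

text \<open>Tangency comes from differentiating the constant -1 = \<open>mink (f z) (f z)\<close>.
  The differential is injective, so nontrivial combinations of the partial derivatives are nonzero
  tangent vectors, and the form is positive on these.\<close>

lemma
  assumes c: "c \<in> \<A>" and y: "y \<in> chart_image c"
  defines "f \<equiv> in_chart F c"
  shows mink_F_partial: "mink (f y) (partial_deriv i f y) = 0"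
    and first_fund_form_pos: "0 < mink (partial_deriv 1 f y) (partial_deriv 1 f y)"
    and det_first_fund_form_pos: "0 < det (first_fund_form f y)"
proof -
  have df: "(f has_derivative frechet_derivative f (at y)) (at y)"
    using in_chart_F_differentiable[OF c y] by (simp add: f_def frechet_derivative_works)
  show tan: "mink (f y) (partial_deriv i f y) = 0" for i
  proof -
    have "((\<lambda>z. mink (f z) (f z)) has_derivative (\<lambda>h. mink (f y) (frechet_derivative f (at y) h) +
        mink (frechet_derivative f (at y) h) (f y))) (at y)"
      by (rule mink.FDERIV[OF df df])
    moreover have "((\<lambda>z. mink (f z) (f z)) has_derivative (\<lambda>h. 0)) (at y)"
      by (rule has_derivative_transform_within_open[OF has_derivative_const[of "-1"] open_chart_image[OF c] y])
         (simp add: f_def hyp_space_mink in_chart_F_hyp[OF c])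
    ultimately have "(\<lambda>h. mink (f y) (frechet_derivative f (at y) h) +
        mink (frechet_derivative f (at y) h) (f y)) = (\<lambda>h. 0)" by (rule has_derivative_unique)
    from fun_cong[OF this, of "axis i 1"] show ?thesis
      by (simp add: partial_deriv_def mink_commute[of _ "f y"])
  qed
  have L: "linear (frechet_derivative f (at y))" using df has_derivative_linear by blast
  have inj: "inj (frechet_derivative f (at y))" using inj_frechet_in_chart_F[OF c y] by (simp add: f_def)
  have nz: "a *\<^sub>R partial_deriv 1 f y + b *\<^sub>R partial_deriv 2 f y \<noteq> 0" if "a \<noteq> 0 \<or> b \<noteq> 0" for a b
  proof
    assume 0: "a *\<^sub>R partial_deriv 1 f y + b *\<^sub>R partial_deriv 2 f y = 0"
    have "frechet_derivative f (at y) (vector [a, b]) = 0"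
      unfolding linear_vec2_apply[OF L, of "vector [a, b]"] using 0 by (simp add: partial_deriv_def)
    hence "vector [a, b] = (0 :: real^2)"
      using inj linear_injective_0[OF L] by blast
    hence "a = 0" "b = 0" by (simp_all add: vec_eq_iff forall_2)
    with that show False by simp
  qed
  have q: "f y \<in> hyp_space" using in_chart_F_hyp[OF c y] by (simp add: f_def)
  define E where "E = mink (partial_deriv 1 f y) (partial_deriv 1 f y)"
  define G where "G = mink (partial_deriv 2 f y) (partial_deriv 2 f y)"
  define K where "K = mink (partial_deriv 1 f y) (partial_deriv 2 f y)"
  show E: "0 < mink (partial_deriv 1 f y) (partial_deriv 1 f y)"
    using mink_pos_tangent[OF q tan[of 1]] nz[of 1 0] by simp
  \<comment> \<open>This combination is orthogonal to the first partial derivative (a Gram-Schmidt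
    step without division); its square is E times the determinant, so both are positive
    together.\<close>
  define v where "v = (- K) *\<^sub>R partial_deriv 1 f y + E *\<^sub>R partial_deriv 2 f y"
  have "0 < mink v v"
    using nz[of "-K" E] E tan by (intro mink_pos_tangent[OF q]) (simp_all add: v_def E_def mink_linear)
  also have "mink v v = E * (E * G - K * K)"
    by (simp add: v_def mink_linear mink_commute[of "partial_deriv 2 f y" "partial_deriv 1 f y"]
        algebra_simps flip: E_def G_def K_def)
  finally have "0 < E * G - K * K" using E by (simp add: zero_less_mult_iff E_def)
  thus "0 < det (first_fund_form f y)"
    by (simp add: det_2 first_fund_form_def E_def G_def K_def
        mink_commute[of "partial_deriv 2 f y" "partial_deriv 1 f y"])
qed

lemma area_density_pos: "c \<in> \<A> \<Longrightarrow> y \<in> chart_image c \<Longrightarrow> 0 < area_density (in_chart F c) y"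
  by (simp add: area_density_def det_first_fund_form_pos)

lemma continuous_on_area_density:
  assumes c: "c \<in> \<A>"
  shows "continuous_on (chart_image c) (area_density (in_chart F c))"
proof -
  have "continuous_on (chart_image c) (\<lambda>y. mink (partial_deriv i (in_chart F c) y) (partial_deriv j (in_chart F c) y))" for i j
    by (intro mink.continuous_on smooth_on_imp_continuous_on smooth_on_partial_deriv smooth_in_chart_F c)
  thus ?thesis
    unfolding area_density_def[abs_def] det_2 first_fund_form_def vec_lambda_beta
    by (intro continuous_on_real_sqrt continuous_on_diff continuous_on_mult)
qed


section \<open>Existence and uniqueness of the induced area measure\<close>

abbreviation borel_S :: "'m measure" where "borel_S \<equiv> restrict_space borel S"

abbreviation area :: "'m measure" where "area \<equiv> area_measure S \<A> F"

text \<open>The target is all of \<open>S\<close> rather than the domain of the chart, so that the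
  measures of different charts share one sigma-algebra and can be compared and added.\<close>

definition chart_measure :: "'m chart \<Rightarrow> 'm measure" where
  "chart_measure c = distr (density (restrict_space lborel (chart_image c))
     (\<lambda>y. ennreal (area_density (in_chart F c) y))) borel_S (chart_inv c)"

lemma space_borel_S: "space borel_S = S"
  by (simp add: space_restrict_space)

lemma openin_sets_borel_S: "openin (top_of_set S) V \<Longrightarrow> V \<in> sets borel_S"
proof -
  assume "openin (top_of_set S) V"
  then obtain T where "open T" "V = S \<inter> T" using openin_open by metis
  thus ?thesis by (simp add: sets_restrict_space)
qed

lemma chart_sets: "c \<in> \<A> \<Longrightarrow> fst c \<in> sets borel_S"
  by (rule openin_sets_borel_S[OF chart_openin])

lemma chart_image_sets: "c \<in> \<A> \<Longrightarrow> chart_image c \<in> sets borel"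
  by (rule borel_open[OF open_chart_image])

lemma chart_inv_measurable:
  assumes c: "c \<in> \<A>"
  shows "chart_inv c \<in> restrict_space lborel (chart_image c) \<rightarrow>\<^sub>M borel_S"
proof -
  have "continuous_on (chart_image c) (chart_inv c)"
    using chart_homeomorphism[OF c] by (simp add: homeomorphism_def)
  hence "chart_inv c \<in> restrict_space borel (chart_image c) \<rightarrow>\<^sub>M borel"
    by (rule borel_measurable_continuous_on_restrict)
  hence "chart_inv c \<in> restrict_space borel (chart_image c) \<rightarrow>\<^sub>M borel_S"
    by (rule measurable_restrict_space2[rotated]) (auto simp: space_restrict_space chart_inv_in_S[OF c])
  moreover have "sets (restrict_space lborel (chart_image c)) = sets (restrict_space borel (chart_image c))"
    by (rule sets_restrict_space_cong) simp
  ultimately show ?thesis using measurable_cong_sets[OF _ refl] by blast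
qed

lemma chart_image_eq_vimage:
  assumes c: "c \<in> \<A>" and B: "B \<subseteq> fst c"
  shows "snd c ` B = chart_inv c -` B \<inter> chart_image c"
proof (intro equalityI subsetI)
  fix y assume "y \<in> snd c ` B"
  then obtain x where "x \<in> B" "y = snd c x" by blast
  thus "y \<in> chart_inv c -` B \<inter> chart_image c"
    using chart_inv_chart[OF c, of x] in_chart_image[of x c] B by auto
next
  fix y assume "y \<in> chart_inv c -` B \<inter> chart_image c"
  thus "y \<in> snd c ` B" using chart_chart_inv by (metis IntE imageI vimageE)
qed

lemma chart_image_borel:
  assumes c: "c \<in> \<A>" and B: "B \<in> sets borel_S" "B \<subseteq> fst c"
  shows "snd c ` B \<in> sets borel"
proof -
  have "chart_inv c -` B \<inter> space (restrict_space lborel (chart_image c)) \<in> sets (restrict_space lborel (chart_image c))"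
    by (rule measurable_sets[OF chart_inv_measurable[OF c] B(1)])
  thus ?thesis
    using chart_image_eq_vimage[OF c B(2)] chart_image_sets[OF c]
    by (simp add: sets_restrict_space_iff space_restrict_space)
qed

lemma area_density_measurable:
  assumes c: "c \<in> \<A>"
  shows "area_density (in_chart F c) \<in> borel_measurable (restrict_space lborel (chart_image c))"
proof -
  have "sets (restrict_space lborel (chart_image c)) = sets (restrict_space borel (chart_image c))"
    by (rule sets_restrict_space_cong) simp
  thus ?thesis
    using borel_measurable_continuous_on_restrict[OF continuous_on_area_density[OF c]]
      measurable_cong_sets[OF _ refl] by blast
qed

lemma sets_chart_measure: "sets (chart_measure c) = sets borel_S"
  by (simp add: chart_measure_def)

lemma emeasure_chart_measure:
  assumes c: "c \<in> \<A>" and B: "B \<in> sets borel_S" "B \<subseteq> fst c"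
  shows "emeasure (chart_measure c) B = (\<integral>\<^sup>+y\<in>snd c ` B. ennreal (area_density (in_chart F c) y) \<partial>lborel)"
proof -
  let ?R = "restrict_space lborel (chart_image c)"
  have sub: "snd c ` B \<subseteq> chart_image c" using B by (auto simp: chart_image_def)
  have "emeasure (chart_measure c) B = emeasure (density ?R (\<lambda>y. ennreal (area_density (in_chart F c) y))) (snd c ` B)"
    unfolding chart_measure_def
    using chart_inv_measurable[OF c] B chart_image_eq_vimage[OF c B(2)]
    by (subst emeasure_distr) (simp_all add: space_restrict_space)
  also have "\<dots> = (\<integral>\<^sup>+y. ennreal (area_density (in_chart F c) y) * indicator (snd c ` B) y \<partial>?R)"
  proof (rule emeasure_density)
    show "(\<lambda>y. ennreal (area_density (in_chart F c) y)) \<in> borel_measurable ?R"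
      using area_density_measurable[OF c] by simp
    show "snd c ` B \<in> sets ?R"
      using chart_image_borel[OF c B] sub chart_image_sets[OF c] by (simp add: sets_restrict_space_iff)
  qed
  also have "\<dots> = (\<integral>\<^sup>+y. ennreal (area_density (in_chart F c) y) * indicator (snd c ` B) y * indicator (chart_image c) y \<partial>lborel)"
    using chart_image_sets[OF c] by (subst nn_integral_restrict_space) auto
  also have "\<dots> = (\<integral>\<^sup>+y\<in>snd c ` B. ennreal (area_density (in_chart F c) y) \<partial>lborel)"
    using sub by (intro nn_integral_cong) (auto simp: indicator_def)
  finally show ?thesis .
qed

lemma indicator_area_density_measurable:
  assumes c: "c \<in> \<A>" and T: "T \<in> sets borel" "T \<subseteq> chart_image c"
  shows "(\<lambda>x. indicator T x * area_density (in_chart F c) x) \<in> borel_measurable borel"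
  using borel_measurable_continuous_on_indicator[OF T(1) continuous_on_subset[OF continuous_on_area_density[OF c] T(2)]]
  by simp

text \<open>The consistency that lets the area measure exist: between two charts the density changes
  by the absolute determinant of the transition map, which is precisely the factor of the
  substitution rule.\<close>

lemma emeasure_chart_measure_overlap:
  assumes c: "c \<in> \<A>" "d \<in> \<A>" and B: "B \<in> sets borel_S" "B \<subseteq> fst c" "B \<subseteq> fst d"
  shows "emeasure (chart_measure c) B = emeasure (chart_measure d) B"
proof -
  have im: "transition c d ` snd c ` B = snd d ` B"
    unfolding image_image using B(2) chart_inv_chart[OF c(1)]
    by (intro image_cong) (auto simp: transition_def)
  have sub: "snd c ` B \<subseteq> chart_image c" "snd d ` B \<subseteq> chart_image d"
    using B by (auto simp: chart_image_def)
  have "(\<integral>\<^sup>+y\<in>snd c ` B. ennreal (area_density (in_chart F c) y) \<partial>lborel) =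
        (\<integral>\<^sup>+y\<in>transition c d ` snd c ` B. ennreal (area_density (in_chart F d) y) \<partial>lborel)"
  proof (rule nn_integral_change_of_variables)
    show "snd c ` B \<in> sets borel" by (rule chart_image_borel[OF c(1) B(1,2)])
    show "inj_on (transition c d) (snd c ` B)"
    proof (rule inj_onI)
      fix y z assume "y \<in> snd c ` B" "z \<in> snd c ` B" "transition c d y = transition c d z"
      then obtain a b where ab: "a \<in> B" "b \<in> B" "y = snd c a" "z = snd c b" by blast
      moreover from this have "snd d a = snd d b"
        using \<open>transition c d y = transition c d z\<close> B(2) chart_inv_chart[OF c(1), of a] chart_inv_chart[OF c(1), of b]
          subsetD[OF B(2)] by (simp add: transition_def)
      hence "a = b" using chart_inv_chart[OF c(2)] ab B by (metis subsetD)
      ultimately show "y = z" by simp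
    qed
    show "(transition c d has_derivative frechet_derivative (transition c d) (at y)) (at y within snd c ` B)"
      if "y \<in> snd c ` B" for y
      using that B transition_has_derivative[OF c] by (auto intro: has_derivative_at_withinI)
    show "0 \<le> area_density (in_chart F d) y" if "y \<in> transition c d ` snd c ` B" for y
      using that sub area_density_pos[OF c(2)] unfolding im by (metis less_imp_le subsetD)
    show "area_density (in_chart F c) y = \<bar>det (matrix (frechet_derivative (transition c d) (at y)))\<bar> *
        area_density (in_chart F d) (transition c d y)" if "y \<in> snd c ` B" for y
    proof -
      obtain x where x: "x \<in> B" "y = snd c x" using \<open>y \<in> snd c ` B\<close> by blast
      hence "transition c d y = snd d x" using B chart_inv_chart[OF c(1)] by (auto simp: transition_def)
      thus ?thesis using area_density_transition[OF c, of x] x B by auto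
    qed
    show "(\<lambda>x. indicator (snd c ` B) x * area_density (in_chart F c) x) \<in> borel_measurable borel"
      by (rule indicator_area_density_measurable[OF c(1) chart_image_borel[OF c(1) B(1,2)] sub(1)])
    show "(\<lambda>x. indicator (transition c d ` snd c ` B) x * area_density (in_chart F d) x) \<in> borel_measurable borel"
      unfolding im by (rule indicator_area_density_measurable[OF c(2) chart_image_borel[OF c(2) B(1,3)] sub(2)])
  qed
  thus ?thesis
    unfolding im by (simp add: emeasure_chart_measure[OF c(1) B(1,2)] emeasure_chart_measure[OF c(2) B(1,3)])
qed

lemma finite_chart_cover:
  "\<exists>cs. set cs \<subseteq> \<A> \<and> S \<subseteq> (\<Union>i<length cs. fst (cs ! i))"
proof -
  have "\<forall>U\<in>fst ` \<A>. openin (top_of_set S) U" using chart_openin by blast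
  moreover have "S \<subseteq> \<Union>(fst ` \<A>)" using chart_cover by blast
  ultimately obtain D where D: "D \<subseteq> fst ` \<A>" "finite D" "S \<subseteq> \<Union>D"
    using compact_S unfolding compact_eq_openin_cover by metis
  then obtain C where C: "C \<subseteq> \<A>" "finite C" "D = fst ` C"
    using finite_subset_image by metis
  obtain cs where cs: "set cs = C" using finite_list[OF C(2)] by blast
  have "S \<subseteq> (\<Union>i<length cs. fst (cs ! i))"
  proof
    fix x assume "x \<in> S"
    then obtain c where "c \<in> set cs" "x \<in> fst c" using D C cs by blast
    thus "x \<in> (\<Union>i<length cs. fst (cs ! i))" by (auto simp: in_set_conv_nth)
  qed
  thus ?thesis using cs C by blast
qed

text \<open>Charts overlap, so their measures cannot simply be added. Removing from each member of a
  finite cover the earlier members splits \<open>S\<close> into Borel pieces, each inside one chart;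
  a point lies in the piece of the first chart that contains it.\<close>

lemma disjoint_chart_pieces:
  "\<exists>A (c :: nat \<Rightarrow> 'm chart) N. (\<forall>i<N. c i \<in> \<A> \<and> A i \<in> sets borel_S \<and> A i \<subseteq> fst (c i)) \<and>
     disjoint_family_on A {..<N} \<and> (\<Union>i<N. A i) = S"
proof -
  obtain cs where cs: "set cs \<subseteq> \<A>" "S \<subseteq> (\<Union>i<length cs. fst (cs ! i))"
    using finite_chart_cover by blast
  define A where "A i = fst (cs ! i) - (\<Union>j<i. fst (cs ! j))" for i
  have m: "cs ! i \<in> \<A>" if "i < length cs" for i using cs that by (meson nth_mem subsetD)
  have 1: "cs ! i \<in> \<A> \<and> A i \<in> sets borel_S \<and> A i \<subseteq> fst (cs ! i)" if "i < length cs" for i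
    using m that unfolding A_def by (auto intro!: sets.Diff sets.finite_UN chart_sets)
  have 2: "disjoint_family_on A {..<length cs}"
    unfolding disjoint_family_on_def
  proof (intro ballI impI)
    fix m n :: nat assume "m \<noteq> n"
    thus "A m \<inter> A n = {}" by (cases "m < n") (auto simp: A_def)
  qed
  have 3: "(\<Union>i<length cs. A i) = S"
  proof
    have "A i \<subseteq> S" if "i < length cs" for i
      using 1[OF that] chart_subset[OF m[OF that]] by blast
    thus "(\<Union>i<length cs. A i) \<subseteq> S" by blast
    show "S \<subseteq> (\<Union>i<length cs. A i)"
    proof
      fix x assume "x \<in> S"
      hence ex: "\<exists>i. i < length cs \<and> x \<in> fst (cs ! i)" using cs(2) by auto
      define i where "i = (LEAST i. i < length cs \<and> x \<in> fst (cs ! i))"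
      have i: "i < length cs" "x \<in> fst (cs ! i)" using LeastI_ex[OF ex] unfolding i_def by auto
      have "x \<notin> fst (cs ! j)" if "j < i" for j
        using not_less_Least[of j "\<lambda>i. i < length cs \<and> x \<in> fst (cs ! i)"] that i unfolding i_def by auto
      thus "x \<in> (\<Union>i<length cs. A i)" using i by (auto simp: A_def)
    qed
  qed
  from 1 2 3 show ?thesis
    by (intro exI[of _ A] exI[of _ "\<lambda>i. cs ! i"] exI[of _ "length cs"] conjI allI impI) simp_all
qed

text \<open>\<open>area_measure\<close> is a definite description, so nothing can be said about it
  before existence and uniqueness are established. Existence glues chart measures along the disjoint
  pieces; uniqueness holds because a measure is determined by its values inside the pieces.\<close>

lemma area_measure_properties:
  "sets area = sets borel_S \<and> (\<forall>c\<in>\<A>. \<forall>B\<in>sets area. B \<subseteq> fst c \<longrightarrow>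
     emeasure area B = (\<integral>\<^sup>+y\<in>snd c ` B. ennreal (sqrt (det (first_fund_form (in_chart F c) y))) \<partial>lborel))"
  unfolding area_measure_def
proof (rule theI')
  obtain A and c :: "nat \<Rightarrow> 'm chart" and N :: nat
    where pieces: "\<And>i. i < N \<Longrightarrow> c i \<in> \<A>" "\<And>i. i < N \<Longrightarrow> A i \<in> sets borel_S" "\<And>i. i < N \<Longrightarrow> A i \<subseteq> fst (c i)"
    and disj: "disjoint_family_on A {..<N}" and un: "(\<Union>i<N. A i) = S"
    using disjoint_chart_pieces by blast
  \<comment> \<open>Each piece is measured by its own chart; \<open>M_chart\<close> shows that the
    result agrees with every chart measure, whichever pieces were taken.\<close>
  define mu where "mu B = (\<Sum>i<N. emeasure (chart_measure (c i)) (B \<inter> A i))" for B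
  define M where "M = measure_of S (sets borel_S) mu"
  have sM: "sets M = sets borel_S"
    unfolding M_def using sets.space_closed[of borel_S] sets.sigma_sets_eq[of borel_S]
    by (simp add: sets_measure_of space_borel_S)
  \<comment> \<open>Used for the chart measures when they are compared with \<open>M\<close>, and
    again for a competing measure in the uniqueness part.\<close>
  have split: "emeasure L B = (\<Sum>i<N. emeasure L (B \<inter> A i))" if "sets L = sets borel_S" "B \<in> sets borel_S" for L B
  proof -
    have "(\<Sum>i<N. emeasure L (B \<inter> A i)) = emeasure L (\<Union>i<N. B \<inter> A i)"
    proof (rule sum_emeasure)
      show "disjoint_family_on (\<lambda>i. B \<inter> A i) {..<N}"
        using disj unfolding disjoint_family_on_def by blast
    qed (use that pieces(2) in auto)
    moreover have "(\<Union>i<N. B \<inter> A i) = B"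
      using un sets.sets_into_space[OF that(2)] space_borel_S by blast
    ultimately show ?thesis by simp
  qed
  have eM: "emeasure M B = mu B" if "B \<in> sets borel_S" for B
    unfolding M_def
  proof (rule emeasure_measure_of_sigma)
    show "sigma_algebra S (sets borel_S)" using sets.sigma_algebra_axioms[of borel_S] by (simp only: space_borel_S)
    show "positive (sets borel_S) mu" by (simp add: positive_def mu_def)
    show "countably_additive (sets borel_S) mu"
    proof (rule countably_additiveI)
      fix B :: "nat \<Rightarrow> 'm set"
      assume B: "range B \<subseteq> sets borel_S" "disjoint_family B" "(\<Union>i. B i) \<in> sets borel_S"
      have "(\<Sum>n. mu (B n)) = (\<Sum>i<N. \<Sum>n. emeasure (chart_measure (c i)) (B n \<inter> A i))"
        unfolding mu_def by (rule suminf_sum) (rule summableI)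
      also have "\<dots> = (\<Sum>i<N. emeasure (chart_measure (c i)) (\<Union>n. B n \<inter> A i))"
        by (intro sum.cong refl suminf_emeasure)
           (use B pieces in \<open>auto simp: sets_chart_measure disjoint_family_on_def\<close>)
      also have "\<dots> = mu (\<Union>n. B n)"
        unfolding mu_def by simp
      finally show "(\<Sum>n. mu (B n)) = mu (\<Union>n. B n)" .
    qed
  qed (rule that)
  have M_chart: "emeasure M B = emeasure (chart_measure d) B" if d: "d \<in> \<A>" and B: "B \<in> sets borel_S" "B \<subseteq> fst d" for d B
  proof -
    have "emeasure (chart_measure (c i)) (B \<inter> A i) = emeasure (chart_measure d) (B \<inter> A i)" if "i < N" for i
      using pieces[OF that] B by (intro emeasure_chart_measure_overlap d) auto
    thus ?thesis using split[OF sets_chart_measure B(1), of d] by (simp add: eM[OF B(1)] mu_def)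
  qed
  show "\<exists>!M. sets M = sets borel_S \<and> (\<forall>c\<in>\<A>. \<forall>B\<in>sets M. B \<subseteq> fst c \<longrightarrow>
     emeasure M B = (\<integral>\<^sup>+y\<in>snd c ` B. ennreal (sqrt (det (first_fund_form (in_chart F c) y))) \<partial>lborel))"
  proof (rule ex1I[of _ M])
    show "sets M = sets borel_S \<and> (\<forall>c\<in>\<A>. \<forall>B\<in>sets M. B \<subseteq> fst c \<longrightarrow>
       emeasure M B = (\<integral>\<^sup>+y\<in>snd c ` B. ennreal (sqrt (det (first_fund_form (in_chart F c) y))) \<partial>lborel))"
      using sM M_chart emeasure_chart_measure unfolding area_density_def by auto
  next
    fix L assume L: "sets L = sets borel_S \<and> (\<forall>c\<in>\<A>. \<forall>B\<in>sets L. B \<subseteq> fst c \<longrightarrow>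
     emeasure L B = (\<integral>\<^sup>+y\<in>snd c ` B. ennreal (sqrt (det (first_fund_form (in_chart F c) y))) \<partial>lborel))"
    show "L = M"
    proof (rule measure_eqI)
      show "sets L = sets M" using L sM by simp
      fix B assume "B \<in> sets L"
      hence B: "B \<in> sets borel_S" using L by simp
      have "emeasure L (B \<inter> A i) = emeasure M (B \<inter> A i)" if i: "i < N" for i
      proof -
        have BA: "B \<inter> A i \<in> sets borel_S" "B \<inter> A i \<subseteq> fst (c i)" using pieces[OF i] B by auto
        have "emeasure L (B \<inter> A i) = emeasure (chart_measure (c i)) (B \<inter> A i)"
          using L BA pieces(1)[OF i] emeasure_chart_measure[OF pieces(1)[OF i] BA] by (simp add: area_density_def)
        thus ?thesis using M_chart[OF pieces(1)[OF i] BA] by simp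
      qed
      thus "emeasure L B = emeasure M B" using split[of L B] split[of M B] L sM B by simp
    qed
  qed
qed

lemma sets_area: "sets area = sets borel_S"
  using area_measure_properties by blast

lemma space_area: "space area = S"
  using sets_eq_imp_space_eq[OF sets_area] by (simp add: space_borel_S)

lemma emeasure_area_chart:
  "c \<in> \<A> \<Longrightarrow> B \<in> sets borel_S \<Longrightarrow> B \<subseteq> fst c \<Longrightarrow> emeasure area B = emeasure (chart_measure c) B"
  using area_measure_properties emeasure_chart_measure unfolding area_density_def by simp

lemma measurable_area: "measurable area M = measurable borel_S M"
  by (rule measurable_cong_sets[OF sets_area refl])

text \<open>Area and chart measure coincide on Borel subsets of the chart domain, and
  \<open>h\<close> vanishes on the rest of \<open>S\<close>. Each rewriting of the Bochner integral
  is valid whether or not the integrand is integrable, hence measurability of \<open>h\<close>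
  suffices.\<close>

lemma integral_area_chart:
  fixes h :: "'m \<Rightarrow> real"
  assumes c: "c \<in> \<A>" and h: "h \<in> borel_measurable borel_S" "\<And>x. x \<in> S - fst c \<Longrightarrow> h x = 0"
  shows "(\<integral>x. h x \<partial>area) =
    (\<integral>y. indicator (chart_image c) y * (area_density (in_chart F c) y * h (chart_inv c y)) \<partial>lborel)"
proof -
  have fs: "fst c \<inter> space area \<in> sets area" "fst c \<inter> space (chart_measure c) \<in> sets (chart_measure c)"
    using chart_sets[OF c] chart_subset[OF c]
    by (simp_all add: sets_area sets_chart_measure space_area inf.absorb1 chart_measure_def space_borel_S)
  have eq: "restrict_space area (fst c) = restrict_space (chart_measure c) (fst c)"
  proof (rule measure_eqI)
    show "sets (restrict_space area (fst c)) = sets (restrict_space (chart_measure c) (fst c))"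
      by (rule sets_restrict_space_cong) (simp add: sets_area sets_chart_measure)
    fix B assume "B \<in> sets (restrict_space area (fst c))"
    hence "B \<in> sets borel_S" "B \<subseteq> fst c"
      using fs(1) by (auto simp: sets_restrict_space_iff sets_area)
    thus "emeasure (restrict_space area (fst c)) B = emeasure (restrict_space (chart_measure c) (fst c)) B"
      using fs by (simp add: emeasure_restrict_space emeasure_area_chart[OF c])
  qed
  have "(\<integral>x. h x \<partial>area) = (\<integral>x. indicator (fst c) x *\<^sub>R h x \<partial>area)"
    using h(2) by (intro Bochner_Integration.integral_cong) (auto simp: space_area indicator_def)
  also have "\<dots> = (\<integral>x. h x \<partial>restrict_space area (fst c))" using fs by (simp add: integral_restrict_space)
  also have "\<dots> = (\<integral>x. indicator (fst c) x *\<^sub>R h x \<partial>chart_measure c)" unfolding eq using fs by (simp add: integral_restrict_space)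
  also have "\<dots> = (\<integral>x. h x \<partial>chart_measure c)"
    using h(2) by (intro Bochner_Integration.integral_cong) (auto simp: chart_measure_def space_borel_S indicator_def)
  also have "\<dots> = (\<integral>y. h (chart_inv c y) \<partial>density (restrict_space lborel (chart_image c)) (\<lambda>y. ennreal (area_density (in_chart F c) y)))"
    unfolding chart_measure_def using chart_inv_measurable[OF c] h(1) by (intro integral_distr) simp_all
  also have "\<dots> = (\<integral>y. area_density (in_chart F c) y *\<^sub>R h (chart_inv c y) \<partial>restrict_space lborel (chart_image c))"
  proof (rule integral_density)
    show "(\<lambda>y. h (chart_inv c y)) \<in> borel_measurable (restrict_space lborel (chart_image c))"
      by (rule measurable_compose[OF chart_inv_measurable[OF c] h(1)])
    show "area_density (in_chart F c) \<in> borel_measurable (restrict_space lborel (chart_image c))"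
      by (rule area_density_measurable[OF c])
    show "AE x in restrict_space lborel (chart_image c). 0 \<le> area_density (in_chart F c) x"
      using area_density_pos[OF c] by (intro AE_I2) (auto simp: space_restrict_space intro: less_imp_le)
  qed
  also have "\<dots> = (\<integral>y. indicator (chart_image c) y *\<^sub>R (area_density (in_chart F c) y *\<^sub>R h (chart_inv c y)) \<partial>lborel)"
    using chart_image_sets[OF c] by (intro integral_restrict_space) simp
  finally show ?thesis by simp
qed

text \<open>Every point has a neighbourhood that is a coordinate ball whose closure lies in the
  chart image. The continuous density is bounded on that closed ball, so the neighbourhood has
  finite area, and finitely many of them cover the compact surface.\<close>

lemma finite_area: "emeasure area S < \<infinity>"
proof -
  have loc: "\<exists>V. openin (top_of_set S) V \<and> x \<in> V \<and> emeasure area V < \<infinity>" if x: "x \<in> S" for x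
  proof -
    obtain c where c: "c \<in> \<A>" "x \<in> fst c" using chart_cover[OF x] by blast
    obtain r where r: "r > 0" "cball (snd c x) r \<subseteq> chart_image c"
      using open_chart_image[OF c(1)] in_chart_image[OF c(2)] open_contains_cball by metis
    define V where "V = chart_inv c ` ball (snd c x) r"
    have sub: "ball (snd c x) r \<subseteq> chart_image c" using r(2) ball_subset_cball by blast
    have V: "openin (top_of_set S) V" unfolding V_def by (rule openin_chart_inv_image[OF c(1) open_ball sub])
    have xV: "x \<in> V" unfolding V_def using c r(1) chart_inv_chart[OF c] by (metis centre_in_ball image_eqI)
    have Vc: "V \<subseteq> fst c" unfolding V_def using sub chart_inv_in by blast
    have "(\<lambda>y. snd c (chart_inv c y)) ` ball (snd c x) r = (\<lambda>y. y) ` ball (snd c x) r"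
      by (rule image_cong[OF refl chart_chart_inv]) (rule subsetD[OF sub])
    hence im: "snd c ` V = ball (snd c x) r"
      by (simp add: V_def image_image)
    have "compact (area_density (in_chart F c) ` cball (snd c x) r)"
      by (rule compact_continuous_image[OF continuous_on_subset[OF continuous_on_area_density[OF c(1)] r(2)] compact_cball])
    from compact_imp_bounded[OF this]
    obtain K where K: "\<forall>z\<in>area_density (in_chart F c) ` cball (snd c x) r. norm z \<le> K"
      unfolding bounded_iff by blast
    have "emeasure area V = (\<integral>\<^sup>+y\<in>ball (snd c x) r. ennreal (area_density (in_chart F c) y) \<partial>lborel)"
      using emeasure_area_chart[OF c(1) openin_sets_borel_S[OF V] Vc]
        emeasure_chart_measure[OF c(1) openin_sets_borel_S[OF V] Vc] im by simp
    also have "\<dots> \<le> (\<integral>\<^sup>+y\<in>ball (snd c x) r. ennreal K \<partial>lborel)"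
    proof (intro nn_integral_mono)
      fix y
      have "area_density (in_chart F c) y \<le> K" if "y \<in> ball (snd c x) r"
      proof -
        have "area_density (in_chart F c) y \<in> area_density (in_chart F c) ` cball (snd c x) r"
          using that by (intro imageI) simp
        from bspec[OF K this] show ?thesis by simp
      qed
      thus "ennreal (area_density (in_chart F c) y) * indicator (ball (snd c x) r) y
          \<le> ennreal K * indicator (ball (snd c x) r) y"
        by (simp add: indicator_def ennreal_leI)
    qed
    also have "\<dots> = ennreal K * emeasure lborel (ball (snd c x) r)"
      by (simp add: nn_integral_cmult_indicator)
    also have "\<dots> < \<infinity>" using emeasure_lborel_ball_finite[of "snd c x" r] by (simp add: ennreal_mult_less_top)
    finally show ?thesis using V xV by blast
  qed
  let ?C = "{V. openin (top_of_set S) V \<and> emeasure area V < \<infinity>}"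
  have o: "\<forall>V\<in>?C. openin (top_of_set S) V" by blast
  have cov: "S \<subseteq> \<Union>?C"
  proof
    fix x assume "x \<in> S" thus "x \<in> \<Union>?C" using loc[of x] by blast
  qed
  have "(\<forall>V\<in>?C. openin (top_of_set S) V) \<and> S \<subseteq> \<Union>?C \<longrightarrow> (\<exists>D\<subseteq>?C. finite D \<and> S \<subseteq> \<Union>D)"
    using iffD1[OF compact_eq_openin_cover compact_S] by (rule spec)
  from mp[OF this conjI[OF o cov]]
  obtain D where D: "D \<subseteq> ?C" "finite D" "S \<subseteq> \<Union>D" by (elim exE conjE)
  have Ds: "D \<subseteq> sets area"
  proof
    fix V assume "V \<in> D"
    with D(1) have "openin (top_of_set S) V" by blast
    thus "V \<in> sets area" unfolding sets_area by (rule openin_sets_borel_S)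
  qed
  have fin: "emeasure area V < \<infinity>" if "V \<in> D" for V using D(1) that by blast
  have "emeasure area S \<le> emeasure area (\<Union>D)"
    by (rule emeasure_mono[OF D(3) sets.finite_Union[OF D(2) Ds]])
  also have "\<dots> \<le> (\<Sum>V\<in>D. emeasure area V)"
    using emeasure_subadditive_finite[OF D(2), of "\<lambda>V. V" area] Ds by simp
  also have "\<dots> < \<infinity>"
    unfolding infinity_ennreal_def ennreal_sum_less_top[OF D(2)] using fin by simp
  finally show ?thesis .
qed

lemma finite_measure_area: "finite_measure area"
  by (rule finite_measureI) (use finite_area in \<open>simp add: space_area\<close>)

lemma integrable_area_bounded:
  fixes h :: "'m \<Rightarrow> real"
  assumes "h \<in> borel_measurable borel_S" "\<And>x. x \<in> S \<Longrightarrow> \<bar>h x\<bar> \<le> K"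
  shows "integrable area h"
  by (rule finite_measure.integrable_const_bound[OF finite_measure_area, of _ K])
     (use assms in \<open>auto simp: space_area measurable_area\<close>)

lemma integrable_area_continuous:
  fixes h :: "'m \<Rightarrow> real"
  assumes "continuous_on S h"
  shows "integrable area h"
proof -
  have "compact (h ` S)" by (rule compact_continuous_image[OF assms compact_S])
  from compact_imp_bounded[OF this] obtain K where "\<forall>z\<in>h ` S. norm z \<le> K"
    unfolding bounded_iff by blast
  thus ?thesis
    by (intro integrable_area_bounded[of _ K] borel_measurable_continuous_on_restrict assms) auto
qed

lemma continuous_on_S_chartI:
  fixes h :: "'m \<Rightarrow> 'b::topological_space"
  assumes "\<And>c. c \<in> \<A> \<Longrightarrow> continuous_on (chart_image c) (in_chart h c)"
  shows "continuous_on S h"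
proof -
  have cont: "continuous_on (fst c) h" if c: "c \<in> \<A>" for c
  proof -
    have "continuous_on (fst c) (snd c)" "snd c ` fst c = chart_image c"
      using chart_homeomorphism[OF c] by (auto simp: homeomorphism_def)
    hence "continuous_on (fst c) (in_chart h c \<circ> snd c)"
      using assms[OF c] by (intro continuous_on_compose) auto
    moreover have "(in_chart h c \<circ> snd c) x = h x" if "x \<in> fst c" for x
      using that c by (simp add: in_chart_apply chart_inv_chart)
    ultimately show ?thesis by (simp cong: continuous_on_cong)
  qed
  show ?thesis
    unfolding continuous_on_eq_continuous_within
  proof
    fix x assume x: "x \<in> S"
    obtain c where c: "c \<in> \<A>" "x \<in> fst c" using chart_cover[OF x] by blast
    obtain T where T: "open T" "fst c = S \<inter> T"
      using chart_openin[OF c(1)] openin_open by metis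
    have "at x within S = at x within fst c"
      by (rule at_within_nhd[of _ T]) (use T c in auto)
    moreover have "continuous (at x within fst c) h"
      using cont[OF c(1)] c(2) by (simp add: continuous_on_eq_continuous_within)
    ultimately show "continuous (at x within S) h" by simp
  qed
qed

end

section \<open>Normal projection and mean curvature in a chart\<close>

definition gram_det :: "real \<times> (real^'n) \<Rightarrow> real \<times> (real^'n) \<Rightarrow> real" where
  "gram_det a b = mink a a * mink b b - (mink a b)\<^sup>2"

text \<open>Cramer's rule for the coefficient of \<open>a\<close> in the orthogonal projection of
  \<open>v\<close> to the span of \<open>a\<close> and \<open>b\<close>; exchanging the first two
  arguments gives the coefficient of \<open>b\<close>.\<close>

definition tangent_coeff :: "real \<times> (real^'n) \<Rightarrow> real \<times> (real^'n) \<Rightarrow> real \<times> (real^'n) \<Rightarrow> real" where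
  "tangent_coeff a b v = (mink b b * mink v a - mink a b * mink v b) / gram_det a b"

definition normal_proj :: "real \<times> (real^'n) \<Rightarrow> real \<times> (real^'n) \<Rightarrow> real \<times> (real^'n) \<Rightarrow> real \<times> (real^'n)" where
  "normal_proj a b v = v - tangent_coeff a b v *\<^sub>R a - tangent_coeff b a v *\<^sub>R b"

lemma gram_det_commute: "gram_det b a = gram_det a b"
  by (simp add: gram_det_def mink_commute[of b a])

lemma mink_tangent_coeff:
  assumes "gram_det a b \<noteq> 0"
  shows "mink v a = tangent_coeff a b v * mink a a + tangent_coeff b a v * mink a b"
    and "mink v b = tangent_coeff a b v * mink a b + tangent_coeff b a v * mink b b"
proof -
  have "(mink b b * mink v a - mink a b * mink v b) * mink a a + (mink a a * mink v b - mink a b * mink v a) * mink a b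
      = gram_det a b * mink v a"
    and "(mink b b * mink v a - mink a b * mink v b) * mink a b + (mink a a * mink v b - mink a b * mink v a) * mink b b
      = gram_det a b * mink v b"
    by (simp_all add: gram_det_def power2_eq_square algebra_simps)
  thus "mink v a = tangent_coeff a b v * mink a a + tangent_coeff b a v * mink a b"
    and "mink v b = tangent_coeff a b v * mink a b + tangent_coeff b a v * mink b b"
    using assms unfolding tangent_coeff_def gram_det_commute[of b a] mink_commute[of b a]
      times_divide_eq_left add_divide_distrib[symmetric] by (simp_all add: nonzero_eq_divide_eq mult.commute)
qed

lemma mink_normal_proj:
  assumes "gram_det a b \<noteq> 0"
  shows "mink (normal_proj a b v) a = 0" "mink (normal_proj a b v) b = 0"
  using mink_tangent_coeff[OF assms, of v] by (simp_all add: normal_proj_def mink_linear mink_commute[of b a])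

lemma normal_proj_unique:
  assumes g: "gram_det a b \<noteq> 0" and v: "v - u = s *\<^sub>R a + t *\<^sub>R b" and u: "mink u a = 0" "mink u b = 0"
  shows "u = normal_proj a b v"
proof -
  have e: "v = u + s *\<^sub>R a + t *\<^sub>R b" using v by (simp add: algebra_simps)
  have va: "mink v a = s * mink a a + t * mink a b" "mink v b = s * mink a b + t * mink b b"
    using u by (simp_all add: e mink_linear mink_commute[of b a])
  have "mink b b * mink v a - mink a b * mink v b = s * gram_det a b"
    and "mink a a * mink v b - mink a b * mink v a = t * gram_det a b"
    unfolding va by (simp_all add: gram_det_def power2_eq_square algebra_simps)
  hence "tangent_coeff a b v = s" "tangent_coeff b a v = t"
    using g by (simp_all add: tangent_coeff_def gram_det_commute[of b a] mink_commute[of b a])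
  thus ?thesis by (simp add: normal_proj_def e)
qed

lemma tangent_coeff_add: "tangent_coeff a b (v + v') = tangent_coeff a b v + tangent_coeff a b v'"
  by (simp add: tangent_coeff_def mink_linear algebra_simps add_divide_distrib diff_divide_distrib)

lemma tangent_coeff_scaleR: "tangent_coeff a b (c *\<^sub>R v) = c * tangent_coeff a b v"
  by (simp add: tangent_coeff_def mink_linear algebra_simps)

lemma normal_proj_add: "normal_proj a b (v + v') = normal_proj a b v + normal_proj a b v'"
  by (simp add: normal_proj_def tangent_coeff_add algebra_simps)

lemma normal_proj_scaleR: "normal_proj a b (c *\<^sub>R v) = c *\<^sub>R normal_proj a b v"
  by (simp add: normal_proj_def tangent_coeff_scaleR algebra_simps)

lemma normal_proj_self:
  assumes "gram_det a b \<noteq> 0"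
  shows "normal_proj a b a = 0" "normal_proj a b b = 0"
  using normal_proj_unique[OF assms, of a 0 1 0] normal_proj_unique[OF assms, of b 0 0 1]
  by (simp_all add: mink.zero_left)

lemma mink_normal_proj_normal_proj:
  assumes "gram_det a b \<noteq> 0"
  shows "mink (normal_proj a b v) (normal_proj a b v') = mink (normal_proj a b v) v'"
proof -
  have "mink (normal_proj a b v) (normal_proj a b v') = mink (normal_proj a b v) v'
     - tangent_coeff a b v' * mink (normal_proj a b v) a - tangent_coeff b a v' * mink (normal_proj a b v) b"
    by (simp add: normal_proj_def[of a b v'] mink_linear)
  thus ?thesis using mink_normal_proj[OF assms] by simp
qed

lemma mink_self_normal_proj:
  "mink v v = mink (normal_proj a b v) v + tangent_coeff a b v * mink v a + tangent_coeff b a v * mink v b"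
  by (simp add: normal_proj_def mink_linear mink_commute[of a v] mink_commute[of b v])

text \<open>\<open>mean_curv\<close> is the mean curvature vector read off a single parametrization \<open>f\<close>; the two off-diagonal
  terms are merged, since second partial derivatives commute.\<close>

definition second_ff :: "(real^2 \<Rightarrow> real \<times> (real^'n)) \<Rightarrow> real^2 \<Rightarrow> 2 \<Rightarrow> 2 \<Rightarrow> real \<times> (real^'n)" where
  "second_ff f y i j = normal_proj (partial_deriv 1 f y) (partial_deriv 2 f y)
     (hyp_proj (f y) (partial_deriv i (partial_deriv j f) y))"

definition mean_curv :: "(real^2 \<Rightarrow> real \<times> (real^'n)) \<Rightarrow> real^2 \<Rightarrow> real \<times> (real^'n)" where
  "mean_curv f y = (let a = partial_deriv 1 f y; b = partial_deriv 2 f y in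
     (1 / gram_det a b) *\<^sub>R (mink b b *\<^sub>R second_ff f y 1 1 - (2 * mink a b) *\<^sub>R second_ff f y 1 2
       + mink a a *\<^sub>R second_ff f y 2 2))"

text \<open>\<open>matrix_inv\<close> chooses some two-sided inverse; the adjugate divided by the
  determinant is one, and two-sided inverses are unique.\<close>

lemma matrix_inv_2:
  fixes A :: "real^2^2"
  assumes d: "det A \<noteq> 0"
  shows "matrix_inv A $ 1 $ 1 = A $ 2 $ 2 / det A" "matrix_inv A $ 1 $ 2 = - A $ 1 $ 2 / det A"
    "matrix_inv A $ 2 $ 1 = - A $ 2 $ 1 / det A" "matrix_inv A $ 2 $ 2 = A $ 1 $ 1 / det A"
proof -
  define B :: "real^2^2" where "B = (\<chi> i j. if i = 1 then (if j = 1 then A $ 2 $ 2 / det A else - A $ 1 $ 2 / det A)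
     else (if j = 1 then - A $ 2 $ 1 / det A else A $ 1 $ 1 / det A))"
  have "A ** B = mat 1"
    using d by (simp add: vec_eq_iff matrix_matrix_mult_def sum_2 forall_2 B_def mat_def divide_simps)
       (simp add: det_2 algebra_simps)
  hence B: "B ** A = mat 1" using matrix_left_right_inverse by metis
  have "A ** matrix_inv A = mat 1"
    using someI[of "\<lambda>A'. A ** A' = mat 1 \<and> A' ** A = mat 1" B] \<open>A ** B = mat 1\<close> B
    unfolding matrix_inv_def by simp
  hence "B ** A ** matrix_inv A = B" by (simp add: matrix_mul_assoc[symmetric])
  hence "matrix_inv A = B" using B by simp
  thus "matrix_inv A $ 1 $ 1 = A $ 2 $ 2 / det A" "matrix_inv A $ 1 $ 2 = - A $ 1 $ 2 / det A"
    "matrix_inv A $ 2 $ 1 = - A $ 2 $ 1 / det A" "matrix_inv A $ 2 $ 2 = A $ 1 $ 1 / det A"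
    by (simp_all add: B_def)
qed

lemma det_first_fund_form: "det (first_fund_form f y) = gram_det (partial_deriv 1 f y) (partial_deriv 2 f y)"
  by (simp add: det_2 first_fund_form_def gram_det_def power2_eq_square
      mink_commute[of "partial_deriv 2 f y" "partial_deriv 1 f y"])

context closed_immersed_surface
begin

lemma gram_det_pos:
  "c \<in> \<A> \<Longrightarrow> y \<in> chart_image c \<Longrightarrow>
    0 < gram_det (partial_deriv 1 (in_chart F c) y) (partial_deriv 2 (in_chart F c) y)"
  using det_first_fund_form_pos by (simp add: det_first_fund_form)

lemma chart_at:
  assumes "x \<in> S" shows "chart_at \<A> x \<in> \<A>" "x \<in> fst (chart_at \<A> x)"
proof -
  have "\<exists>c. c \<in> \<A> \<and> x \<in> fst c" using chart_cover[OF assms] by blast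
  from someI_ex[OF this] show "chart_at \<A> x \<in> \<A>" "x \<in> fst (chart_at \<A> x)"
    by (simp_all add: chart_at_def)
qed

lemma range_frechet_in_chart:
  assumes c: "c \<in> \<A>" "d \<in> \<A>" "x \<in> fst c" "x \<in> fst d"
  shows "range (frechet_derivative (in_chart F c) (at (snd c x))) \<subseteq> range (frechet_derivative (in_chart F d) (at (snd d x)))"
proof -
  have "in_chart F d differentiable (at (snd d x))"
    by (rule in_chart_F_differentiable[OF c(2) in_chart_image[OF c(4)]])
  note e = frechet_derivative_at[OF in_chart_transition_has_derivative[OF c this]]
  show ?thesis
  proof (rule image_subsetI)
    fix v
    show "frechet_derivative (in_chart F c) (at (snd c x)) v \<in> range (frechet_derivative (in_chart F d) (at (snd d x)))"
      unfolding fun_cong[OF e, of v, symmetric] by (rule rangeI)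
  qed
qed

text \<open>\<open>surf_tangent\<close> refers to the chart picked by \<open>chart_at\<close>. The
  chain rule for the transition maps in both directions shows that all charts around the point give
  the same plane, so any chart may replace the picked one.\<close>

lemma surf_tangent_chart:
  assumes c: "c \<in> \<A>" "x \<in> fst c"
  shows "surf_tangent \<A> F x = {s *\<^sub>R partial_deriv 1 (in_chart F c) (snd c x) + t *\<^sub>R partial_deriv 2 (in_chart F c) (snd c x) | s t. True}"
proof -
  have x: "x \<in> S" using chart_subset[OF c(1)] c(2) by blast
  have "surf_tangent \<A> F x = range (frechet_derivative (in_chart F c) (at (snd c x)))"
    unfolding surf_tangent_def Let_def
    using range_frechet_in_chart[OF chart_at(1)[OF x] c(1) chart_at(2)[OF x] c(2)]
      range_frechet_in_chart[OF c(1) chart_at(1)[OF x] c(2) chart_at(2)[OF x]] by (rule equalityI)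
  also have "\<dots> = {s *\<^sub>R partial_deriv 1 (in_chart F c) (snd c x) + t *\<^sub>R partial_deriv 2 (in_chart F c) (snd c x) | s t. True}"
  proof (intro equalityI subsetI)
    fix v assume "v \<in> range (frechet_derivative (in_chart F c) (at (snd c x)))"
    then obtain h where "v = frechet_derivative (in_chart F c) (at (snd c x)) h" by blast
    thus "v \<in> {s *\<^sub>R partial_deriv 1 (in_chart F c) (snd c x) + t *\<^sub>R partial_deriv 2 (in_chart F c) (snd c x) | s t. True}"
      using frechet_derivative_apply_partial[OF in_chart_F_differentiable[OF c(1) in_chart_image[OF c(2)]]] by blast
  next
    fix v assume "v \<in> {s *\<^sub>R partial_deriv 1 (in_chart F c) (snd c x) + t *\<^sub>R partial_deriv 2 (in_chart F c) (snd c x) | s t. True}"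
    then obtain s t where "v = s *\<^sub>R partial_deriv 1 (in_chart F c) (snd c x) + t *\<^sub>R partial_deriv 2 (in_chart F c) (snd c x)" by blast
    hence "v = frechet_derivative (in_chart F c) (at (snd c x)) (vector [s, t])"
      using frechet_derivative_apply_partial[OF in_chart_F_differentiable[OF c(1) in_chart_image[OF c(2)]], of "vector [s, t]"]
      by simp
    thus "v \<in> range (frechet_derivative (in_chart F c) (at (snd c x)))" by blast
  qed
  finally show ?thesis .
qed

lemma normal_part_chart:
  assumes c: "c \<in> \<A>" "x \<in> fst c"
  shows "normal_part \<A> F x v = normal_proj (partial_deriv 1 (in_chart F c) (snd c x)) (partial_deriv 2 (in_chart F c) (snd c x)) v"
proof -
  let ?a = "partial_deriv 1 (in_chart F c) (snd c x)" and ?b = "partial_deriv 2 (in_chart F c) (snd c x)"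
  have g: "gram_det ?a ?b \<noteq> 0" using gram_det_pos[OF c(1) in_chart_image[OF c(2)]] by simp
  show ?thesis
    unfolding normal_part_def surf_tangent_chart[OF c]
  proof (rule the_equality, intro conjI ballI)
    show "v - normal_proj ?a ?b v \<in> {s *\<^sub>R ?a + t *\<^sub>R ?b |s t. True}"
      by (rule CollectI, rule exI[of _ "tangent_coeff ?a ?b v"], rule exI[of _ "tangent_coeff ?b ?a v"])
         (simp add: normal_proj_def)
    fix z assume "z \<in> {s *\<^sub>R ?a + t *\<^sub>R ?b |s t. True}"
    thus "mink (normal_proj ?a ?b v) z = 0"
      using mink_normal_proj[OF g, of v] by (auto simp: mink_linear)
  next
    fix u assume u: "v - u \<in> {s *\<^sub>R ?a + t *\<^sub>R ?b |s t. True} \<and> (\<forall>z\<in>{s *\<^sub>R ?a + t *\<^sub>R ?b |s t. True}. mink u z = 0)"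
    then obtain s t where st: "v - u = s *\<^sub>R ?a + t *\<^sub>R ?b" by blast
    have "?a \<in> {s *\<^sub>R ?a + t *\<^sub>R ?b |s t. True}" by (rule CollectI, rule exI[of _ 1], rule exI[of _ 0]) simp
    moreover have "?b \<in> {s *\<^sub>R ?a + t *\<^sub>R ?b |s t. True}" by (rule CollectI, rule exI[of _ 0], rule exI[of _ 1]) simp
    ultimately show "u = normal_proj ?a ?b v"
      using normal_proj_unique[OF g st] u by blast
  qed
qed

lemma mean_curvature_chart_at:
  assumes x: "x \<in> S"
  shows "mean_curvature \<A> F x = mean_curv (in_chart F (chart_at \<A> x)) (snd (chart_at \<A> x) x)"
proof -
  define c where "c = chart_at \<A> x"
  define f where "f = in_chart F c"
  define y where "y = snd c x"
  have c: "c \<in> \<A>" "x \<in> fst c" using chart_at[OF x] by (simp_all add: c_def)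
  have y: "y \<in> chart_image c" using in_chart_image[OF c(2)] by (simp add: y_def)
  have Fx: "F x = f y" using c by (simp add: f_def y_def in_chart_apply chart_inv_chart)
  have sf: "second_fund_form \<A> F x i j = second_ff f y i j" for i j
    unfolding second_fund_form_def second_ff_def Let_def c_def[symmetric] normal_part_chart[OF c] Fx
    by (simp add: f_def y_def)
  have sym: "second_ff f y 2 1 = second_ff f y 1 2"
    unfolding second_ff_def f_def
    by (simp add: smooth_on_partial_deriv_commute[OF open_chart_image[OF c(1)] y smooth_in_chart_F[OF c(1)], of 2 1])
  have ff: "first_fund_form f y $ i $ j = mink (partial_deriv i f y) (partial_deriv j f y)" for i j
    by (simp add: first_fund_form_def)
  have d: "det (first_fund_form f y) \<noteq> 0" using det_first_fund_form_pos[OF c(1) y] by (simp add: f_def)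
  show ?thesis
    unfolding mean_curvature_def Let_def c_def[symmetric] f_def[symmetric] y_def[symmetric] mean_curv_def
    by (simp add: sum_2 matrix_inv_2[OF d] sf sym det_first_fund_form ff
        mink_commute[of "partial_deriv 2 f y" "partial_deriv 1 f y"] algebra_simps)
       (simp flip: scaleR_left.add)
qed

end

section \<open>Calculus of C^1 maps on open sets\<close>

lemma Ck1_iff: "Ck_on 1 U f \<longleftrightarrow> (\<forall>x\<in>U. f differentiable (at x)) \<and>
    (\<forall>v. continuous_on U (\<lambda>x. frechet_derivative f (at x) v))"
  unfolding One_nat_def Ck_on.simps by (rule refl)

lemma Ck1_I:
  assumes "\<And>x. x \<in> U \<Longrightarrow> (f has_derivative f' x) (at x)" and "\<And>v. continuous_on U (\<lambda>x. f' x v)"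
  shows "Ck_on 1 U f"
  unfolding Ck1_iff
proof (intro conjI ballI allI)
  fix x assume "x \<in> U" thus "f differentiable (at x)" using assms(1) differentiableI by blast
next
  fix v
  have "f' x v = frechet_derivative f (at x) v" if "x \<in> U" for x
    using frechet_derivative_at[OF assms(1)[OF that]] by simp
  with assms(2)[of v] show "continuous_on U (\<lambda>x. frechet_derivative f (at x) v)"
    by (rule continuous_on_eq)
qed

lemma Ck1_has_derivative: "Ck_on 1 U f \<Longrightarrow> x \<in> U \<Longrightarrow> (f has_derivative frechet_derivative f (at x)) (at x)"
  unfolding Ck1_iff frechet_derivative_works[symmetric] by blast

lemma Ck1_differentiable: "Ck_on 1 U f \<Longrightarrow> x \<in> U \<Longrightarrow> f differentiable (at x)"
  unfolding Ck1_iff by blast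

lemma Ck1_continuous_frechet: "Ck_on 1 U f \<Longrightarrow> continuous_on U (\<lambda>x. frechet_derivative f (at x) v)"
  unfolding Ck1_iff by blast

lemma Ck1_continuous_partial: "Ck_on 1 U f \<Longrightarrow> continuous_on U (partial_deriv i f)"
  using Ck1_continuous_frechet unfolding partial_deriv_def[abs_def] by blast

lemma Ck1_continuous: "Ck_on 1 U f \<Longrightarrow> continuous_on U f"
  by (rule has_derivative_continuous_on) (rule has_derivative_at_withinI[OF Ck1_has_derivative])

lemma smooth_on_Ck1: "smooth_on U f \<Longrightarrow> Ck_on 1 U f"
  unfolding smooth_on_def by (rule spec)

lemma Ck1_const: "Ck_on 1 U (\<lambda>_. c)"
  by (rule Ck1_I[of _ _ "\<lambda>_ _. 0"]) auto

lemma Ck1_add: "Ck_on 1 U f \<Longrightarrow> Ck_on 1 U g \<Longrightarrow> Ck_on 1 U (\<lambda>x. f x + g x)"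
  by (rule Ck1_I, rule has_derivative_add, (erule (1) Ck1_has_derivative)+)
     (intro continuous_on_add Ck1_continuous_frechet)

lemma Ck1_diff: "Ck_on 1 U f \<Longrightarrow> Ck_on 1 U g \<Longrightarrow> Ck_on 1 U (\<lambda>x. f x - g x)"
  by (rule Ck1_I, rule has_derivative_diff, (erule (1) Ck1_has_derivative)+)
     (intro continuous_on_diff Ck1_continuous_frechet)

lemma Ck1_bilinear:
  assumes "bounded_bilinear B" and f: "Ck_on 1 U f" and g: "Ck_on 1 U g"
  shows "Ck_on 1 U (\<lambda>x. B (f x) (g x))"
  by (rule Ck1_I, rule bounded_bilinear.FDERIV[OF assms(1)],
      erule Ck1_has_derivative[OF f], erule Ck1_has_derivative[OF g])
     (intro continuous_on_add bounded_bilinear.continuous_on[OF assms(1)] Ck1_continuous_frechet Ck1_continuous f g)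

lemmas Ck1_mult = Ck1_bilinear[OF bounded_bilinear_mult]
lemmas Ck1_mink = Ck1_bilinear[OF bounded_bilinear_mink]

lemma Ck1_compose_real:
  fixes f :: "'a::real_normed_vector \<Rightarrow> real" and k :: "real \<Rightarrow> real"
  assumes f: "Ck_on 1 U f" and k: "\<And>x. x \<in> U \<Longrightarrow> (k has_real_derivative k' (f x)) (at (f x))"
    and c: "continuous_on U (\<lambda>x. k' (f x))"
  shows "Ck_on 1 U (\<lambda>x. k (f x))"
proof (rule Ck1_I)
  fix x assume x: "x \<in> U"
  have "(k has_derivative (*) (k' (f x))) (at (f x))"
    using k[OF x] by (simp add: has_field_derivative_def)
  from has_derivative_compose[OF Ck1_has_derivative[OF f x] this]
  show "((\<lambda>x. k (f x)) has_derivative (\<lambda>h. k' (f x) * frechet_derivative f (at x) h)) (at x)" .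
qed (intro continuous_on_mult c Ck1_continuous_frechet f)

lemma Ck1_inverse:
  fixes f :: "'a::real_normed_vector \<Rightarrow> real"
  assumes f: "Ck_on 1 U f" and nz: "\<And>x. x \<in> U \<Longrightarrow> f x \<noteq> 0"
  shows "Ck_on 1 U (\<lambda>x. inverse (f x))"
proof (rule Ck1_compose_real[OF f])
  show "(inverse has_real_derivative - (inverse (f x) ^ Suc (Suc 0))) (at (f x))" if "x \<in> U" for x
    by (rule DERIV_inverse[OF nz[OF that]])
  show "continuous_on U (\<lambda>x. - (inverse (f x) ^ Suc (Suc 0)))"
    by (intro continuous_on_minus continuous_on_power continuous_on_inverse Ck1_continuous[OF f] ballI nz)
qed

lemma Ck1_divide:
  fixes f g :: "'a::real_normed_vector \<Rightarrow> real"
  assumes "Ck_on 1 U f" "Ck_on 1 U g" "\<And>x. x \<in> U \<Longrightarrow> g x \<noteq> 0"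
  shows "Ck_on 1 U (\<lambda>x. f x / g x)"
  unfolding divide_inverse by (intro Ck1_mult Ck1_inverse assms)

lemma Ck1_sqrt:
  fixes f :: "'a::real_normed_vector \<Rightarrow> real"
  assumes f: "Ck_on 1 U f" and pos: "\<And>x. x \<in> U \<Longrightarrow> 0 < f x"
  shows "Ck_on 1 U (\<lambda>x. sqrt (f x))"
proof (rule Ck1_compose_real[OF f])
  show "(sqrt has_real_derivative inverse (sqrt (f x)) / 2) (at (f x))" if "x \<in> U" for x
    by (rule DERIV_real_sqrt[OF pos[OF that]])
  show "continuous_on U (\<lambda>x. inverse (sqrt (f x)) / 2)"
  proof (intro continuous_on_divide continuous_on_inverse continuous_on_real_sqrt Ck1_continuous[OF f] ballI continuous_on_const)
    fix x assume "x \<in> U" thus "sqrt (f x) \<noteq> 0" using pos[of x] by simp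
  qed simp
qed

lemma partial_deriv_along:
  assumes "f differentiable (at y)"
  shows "((\<lambda>t. f (y + t *\<^sub>R axis i 1)) has_vector_derivative partial_deriv i f y) (at 0)"
  using has_derivative_imp_directional[of f "frechet_derivative f (at y)" y "axis i 1"] assms
  unfolding frechet_derivative_works partial_deriv_def .

text \<open>Separates the two tasks: differentiability is obtained abstractly from class C^1, and
  the value is then computed by the rules for functions of one real variable.\<close>

lemma partial_deriv_real_eqI:
  fixes f :: "real^2 \<Rightarrow> real"
  assumes "f differentiable (at y)" and "((\<lambda>t. f (y + t *\<^sub>R axis i 1)) has_real_derivative d) (at 0)"
  shows "partial_deriv i f y = d"
  using partial_deriv_along[OF assms(1), of i] assms(2)
  unfolding has_real_derivative_iff_has_vector_derivative by (rule vector_derivative_unique_at)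

text \<open>The trace of a symmetric bilinear form with respect to a metric does not depend on the
  basis. Numerator and Gram determinant both acquire the square of the determinant \<open>D\<close>
  of the change of basis, which cancels.\<close>

lemma mean_curv_algebra:
  fixes a b :: "real \<times> (real^'n)"
  assumes a': "a' = p *\<^sub>R a + q *\<^sub>R b" and b': "b' = r *\<^sub>R a + s *\<^sub>R b" and g: "gram_det a' b' \<noteq> 0"
    and h: "h11' = (p * p) *\<^sub>R h11 + (p * q + q * p) *\<^sub>R h12 + (q * q) *\<^sub>R h22"
      "h12' = (r * p) *\<^sub>R h11 + (r * q + s * p) *\<^sub>R h12 + (s * q) *\<^sub>R h22"
      "h22' = (r * r) *\<^sub>R h11 + (r * s + s * r) *\<^sub>R h12 + (s * s) *\<^sub>R (h22 :: real \<times> (real^'n))"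
  shows "(1 / gram_det a' b') *\<^sub>R (mink b' b' *\<^sub>R h11' - (2 * mink a' b') *\<^sub>R h12' + mink a' a' *\<^sub>R h22')
    = (1 / gram_det a b) *\<^sub>R (mink b b *\<^sub>R h11 - (2 * mink a b) *\<^sub>R h12 + mink a a *\<^sub>R h22)"
proof -
  define E K G where "E = mink a a" and "K = mink a b" and "G = mink b b"
  define D where "D = p * s - q * r"
  have E': "mink a' a' = p * p * E + 2 * p * q * K + q * q * G"
    and K': "mink a' b' = p * r * E + (p * s + q * r) * K + q * s * G"
    and G': "mink b' b' = r * r * E + 2 * r * s * K + s * s * G"
    by (simp_all add: a' b' mink_linear mink_commute[of b a] E_def K_def G_def algebra_simps)
  have gd: "gram_det a' b' = D\<^sup>2 * gram_det a b"
    unfolding gram_det_def E' K' G' by (simp add: E_def K_def G_def D_def power2_eq_square algebra_simps)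
  have c: "mink b' b' * (p * p) - 2 * mink a' b' * (r * p) + mink a' a' * (r * r) = D\<^sup>2 * G"
    "mink b' b' * (p * q + q * p) - 2 * mink a' b' * (r * q + s * p) + mink a' a' * (r * s + s * r) = - (D\<^sup>2 * (2 * K))"
    "mink b' b' * (q * q) - 2 * mink a' b' * (s * q) + mink a' a' * (s * s) = D\<^sup>2 * E"
    unfolding E' K' G' by (simp_all add: D_def power2_eq_square algebra_simps)
  have "mink b' b' *\<^sub>R h11' - (2 * mink a' b') *\<^sub>R h12' + mink a' a' *\<^sub>R h22'
    = (mink b' b' * (p * p) - 2 * mink a' b' * (r * p) + mink a' a' * (r * r)) *\<^sub>R h11
    + (mink b' b' * (p * q + q * p) - 2 * mink a' b' * (r * q + s * p) + mink a' a' * (r * s + s * r)) *\<^sub>R h12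
    + (mink b' b' * (q * q) - 2 * mink a' b' * (s * q) + mink a' a' * (s * s)) *\<^sub>R h22"
    unfolding h by (simp add: algebra_simps)
  also have "\<dots> = D\<^sup>2 *\<^sub>R (G *\<^sub>R h11 - (2 * K) *\<^sub>R h12 + E *\<^sub>R h22)"
    unfolding c by (simp add: algebra_simps)
  finally show ?thesis using g unfolding gd E_def[symmetric] K_def[symmetric] G_def[symmetric] by simp
qed

text \<open>In the intended application \<open>E, K, G\<close> is the first fundamental form, \<open>\<xi>\<close> the coefficients of the
  tangential part of \<open>X\<close>, \<open>A\<^sub>k, B\<^sub>k, C\<^sub>k\<close> are the products of the second derivatives with the tangent
  vectors (Christoffel symbols of the first kind), and \<open>n\<close> are their products with the normal part of \<open>X\<close>.\<close>

lemma divergence_algebra: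
  fixes E K G W :: real
  assumes W: "W \<noteq> 0" "W\<^sup>2 = E * G - K\<^sup>2"
    and u: "u1 = x1 * E + x2 * K" "u2 = x1 * K + x2 * G"
    and U: "U11 = n11 + x1 * A1 + x2 * A2 + s * E" "U12 = n12 + x1 * B1 + x2 * B2 + s * K"
      "U22 = n22 + x1 * C1 + x2 * C2 + s * G"
    and W1: "W1 = (2 * A1 * G + E * (2 * B2) - 2 * K * (A2 + B1)) / (2 * W)"
    and W2: "W2 = (2 * B1 * G + E * (2 * C2) - 2 * K * (B2 + C1)) / (2 * W)"
  shows "((2 * B2 * u1 + G * U11 - (A2 + B1) * u2 - K * U12) * W - (G * u1 - K * u2) * W1) / W\<^sup>2
      + ((2 * B1 * u2 + E * U22 - (B2 + C1) * u1 - K * U12) * W - (E * u2 - K * u1) * W2) / W\<^sup>2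
    = W * (2 * s + (G * n11 - 2 * K * n12 + E * n22) / W\<^sup>2)"
proof -
  define P1 where "P1 = A1 * G + E * B2 - K * (A2 + B1)"
  define P2 where "P2 = B1 * G + E * C2 - K * (B2 + C1)"
  have W': "W1 = P1 / W" "W2 = P2 / W" using W(1) unfolding W1 W2 P1_def P2_def by (simp_all add: field_simps)
  \<comment> \<open>Solving the linear system \<open>u\<close> by Cramer's rule: the cofactors of
    the metric recover the coefficients \<open>x1\<close> and \<open>x2\<close>, up to the
    determinant.\<close>
  have m: "G * u1 - K * u2 = x1 * W\<^sup>2" "E * u2 - K * u1 = x2 * W\<^sup>2"
    unfolding W(2) u by (simp_all add: power2_eq_square algebra_simps)
  \<comment> \<open>All Christoffel terms cancel here: those from the derivatives of the metric and
    of \<open>W\<close> compensate those inside \<open>U11\<close>, \<open>U12\<close> and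
    \<open>U22\<close>.\<close>
  have key: "(2 * B2 * u1 + G * U11 - (A2 + B1) * u2 - K * U12) + (2 * B1 * u2 + E * U22 - (B2 + C1) * u1 - K * U12)
     - x1 * P1 - x2 * P2 = 2 * s * W\<^sup>2 + (G * n11 - 2 * K * n12 + E * n22)"
    unfolding W(2) U u P1_def P2_def by (simp add: power2_eq_square algebra_simps)
  have "((2 * B2 * u1 + G * U11 - (A2 + B1) * u2 - K * U12) * W - (G * u1 - K * u2) * W1) / W\<^sup>2
      + ((2 * B1 * u2 + E * U22 - (B2 + C1) * u1 - K * U12) * W - (E * u2 - K * u1) * W2) / W\<^sup>2
    = ((2 * B2 * u1 + G * U11 - (A2 + B1) * u2 - K * U12) + (2 * B1 * u2 + E * U22 - (B2 + C1) * u1 - K * U12)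
     - x1 * P1 - x2 * P2) / W"
    unfolding m W' using W(1) by (simp add: field_simps power2_eq_square)
  also have "\<dots> = W * (2 * s + (G * n11 - 2 * K * n12 + E * n22) / W\<^sup>2)"
    unfolding key using W(1) by (simp add: field_simps power2_eq_square)
  finally show ?thesis .
qed

context closed_immersed_surface
begin

section \<open>Chart independence of the mean curvature vector\<close>

lemma second_ff_eq_normal_part:
  assumes c: "c \<in> \<A>" "x \<in> fst c"
  shows "second_ff (in_chart F c) (snd c x) i j =
    normal_part \<A> F x (hyp_proj (F x) (partial_deriv i (partial_deriv j (in_chart F c)) (snd c x)))"
  unfolding second_ff_def normal_part_chart[OF c] by (simp add: in_chart_apply chart_inv_chart[OF c])

lemma second_ff_sym:
  assumes c: "c \<in> \<A>" "y \<in> chart_image c"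
  shows "second_ff (in_chart F c) y 2 1 = second_ff (in_chart F c) y 1 2"
  unfolding second_ff_def
  by (simp add: smooth_on_partial_deriv_commute[OF open_chart_image[OF c(1)] c(2) smooth_in_chart_F[OF c(1)], of 2 1])

lemma partial_deriv_transition:
  assumes c: "c \<in> \<A>" "d \<in> \<A>" "x \<in> fst c" "x \<in> fst d"
  shows "partial_deriv j (in_chart F c) (snd c x) =
    (partial_deriv j (transition c d) (snd c x) $ 1) *\<^sub>R partial_deriv 1 (in_chart F d) (snd d x) +
    (partial_deriv j (transition c d) (snd c x) $ 2) *\<^sub>R partial_deriv 2 (in_chart F d) (snd d x)"
proof -
  have d: "in_chart F d differentiable (at (snd d x))"
    by (rule in_chart_F_differentiable[OF c(2) in_chart_image[OF c(4)]])
  show ?thesis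
    unfolding partial_deriv_eqI[OF in_chart_transition_has_derivative[OF c d]] frechet_derivative_apply_partial[OF d]
    by (simp add: partial_deriv_def)
qed

text \<open>The second fundamental form is a tensor. By the chain rule the second derivatives of
  \<open>F\<close> change tensorially up to terms with second derivatives of the transition map;
  these terms multiply tangent vectors of the surface and are removed by the normal
  projection.\<close>

lemma second_ff_transition:
  assumes c: "c \<in> \<A>" "d \<in> \<A>" "x \<in> fst c" "x \<in> fst d"
  defines "t \<equiv> \<lambda>i. partial_deriv i (transition c d) (snd c x)"
  defines "h \<equiv> second_ff (in_chart F d) (snd d x)"
  shows "second_ff (in_chart F c) (snd c x) i j =
    (t j $ 1 * t i $ 1) *\<^sub>R h 1 1 + (t j $ 1 * t i $ 2 + t j $ 2 * t i $ 1) *\<^sub>R h 1 2 + (t j $ 2 * t i $ 2) *\<^sub>R h 2 2"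
proof -
  let ?f = "in_chart F c" and ?g = "in_chart F d" and ?T = "transition c d" and ?y = "snd c x" and ?z = "snd d x"
  let ?P = "snd c ` (fst c \<inter> fst d)"
  have oP: "open ?P" by (rule open_chart_overlap[OF c(1) chart_openin[OF c(2)]])
  have yP: "?y \<in> ?P" using c(3,4) by blast
  have z: "?z \<in> chart_image d" by (rule in_chart_image[OF c(4)])
  have Ty: "?T ?y = ?z" using c by (simp add: transition_def chart_inv_chart)
  have eq: "partial_deriv j ?f v = (partial_deriv j ?T v $ 1) *\<^sub>R partial_deriv 1 ?g (?T v) +
      (partial_deriv j ?T v $ 2) *\<^sub>R partial_deriv 2 ?g (?T v)" if v: "v \<in> ?P" for v
  proof -
    obtain x' where x': "x' \<in> fst c" "x' \<in> fst d" "v = snd c x'" using v by blast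
    have "?T v = snd d x'" using c x' by (simp add: transition_def chart_inv_chart)
    thus ?thesis using partial_deriv_transition[OF c(1,2) x'(1,2), of j] x'(3) by simp
  qed
  have dT: "(?T has_derivative frechet_derivative ?T (at ?y)) (at ?y)"
    by (rule transition_has_derivative[OF c])
  have dg: "(partial_deriv a ?g has_derivative frechet_derivative (partial_deriv a ?g) (at ?z)) (at (?T ?y))" for a
    using smooth_on_imp_differentiable[OF smooth_on_partial_deriv[OF smooth_in_chart_F[OF c(2)]] z]
    unfolding frechet_derivative_works Ty .
  have dgT: "((\<lambda>v. partial_deriv a ?g (?T v)) has_derivative
      (\<lambda>k. frechet_derivative (partial_deriv a ?g) (at ?z) (frechet_derivative ?T (at ?y) k))) (at ?y)" for a
    by (rule has_derivative_compose[OF dT dg])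
  have "(partial_deriv j ?T has_derivative frechet_derivative (partial_deriv j ?T) (at ?y)) (at ?y)"
    using smooth_on_imp_differentiable[OF smooth_on_partial_deriv[OF smooth_transition[OF c(1,2)]] yP]
    unfolding frechet_derivative_works .
  hence dt: "((\<lambda>v. partial_deriv j ?T v $ a) has_derivative
      (\<lambda>k. frechet_derivative (partial_deriv j ?T) (at ?y) k $ a)) (at ?y)" for a
    by (rule bounded_linear.has_derivative[OF bounded_linear_vec_nth])
  \<comment> \<open>The second derivatives of the transition map, whose terms are to
    disappear.\<close>
  define s where "s a = frechet_derivative (partial_deriv j ?T) (at ?y) (axis i 1) $ a" for a
  have "((\<lambda>v. (partial_deriv j ?T v $ 1) *\<^sub>R partial_deriv 1 ?g (?T v) + (partial_deriv j ?T v $ 2) *\<^sub>R partial_deriv 2 ?g (?T v))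
     has_derivative (\<lambda>k. ((partial_deriv j ?T ?y $ 1) *\<^sub>R frechet_derivative (partial_deriv 1 ?g) (at ?z) (frechet_derivative ?T (at ?y) k)
        + (frechet_derivative (partial_deriv j ?T) (at ?y) k $ 1) *\<^sub>R partial_deriv 1 ?g (?T ?y))
       + ((partial_deriv j ?T ?y $ 2) *\<^sub>R frechet_derivative (partial_deriv 2 ?g) (at ?z) (frechet_derivative ?T (at ?y) k)
        + (frechet_derivative (partial_deriv j ?T) (at ?y) k $ 2) *\<^sub>R partial_deriv 2 ?g (?T ?y)))) (at ?y)"
    by (rule has_derivative_add[OF has_derivative_scaleR[OF dt dgT] has_derivative_scaleR[OF dt dgT]])
  from has_derivative_transform_within_open[OF this oP yP eq[symmetric]]
  have "partial_deriv i (partial_deriv j ?f) ?y =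
       ((t j $ 1) *\<^sub>R frechet_derivative (partial_deriv 1 ?g) (at ?z) (t i) + s 1 *\<^sub>R partial_deriv 1 ?g ?z)
       + ((t j $ 2) *\<^sub>R frechet_derivative (partial_deriv 2 ?g) (at ?z) (t i) + s 2 *\<^sub>R partial_deriv 2 ?g ?z)"
    unfolding Ty by (subst partial_deriv_eqI) (assumption, simp only: s_def t_def partial_deriv_def)
  also have "\<dots> = ((t j $ 1) *\<^sub>R ((t i $ 1) *\<^sub>R partial_deriv 1 (partial_deriv 1 ?g) ?z + (t i $ 2) *\<^sub>R partial_deriv 2 (partial_deriv 1 ?g) ?z)
          + s 1 *\<^sub>R partial_deriv 1 ?g ?z)
       + ((t j $ 2) *\<^sub>R ((t i $ 1) *\<^sub>R partial_deriv 1 (partial_deriv 2 ?g) ?z + (t i $ 2) *\<^sub>R partial_deriv 2 (partial_deriv 2 ?g) ?z)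
          + s 2 *\<^sub>R partial_deriv 2 ?g ?z)"
    by (simp only: frechet_derivative_apply_partial[OF smooth_on_imp_differentiable[OF smooth_on_partial_deriv[OF smooth_in_chart_F[OF c(2)]] z]])
  finally have e: "partial_deriv i (partial_deriv j ?f) ?y = \<dots>" .
  define N where "N v = normal_part \<A> F x (hyp_proj (F x) v)" for v
  have g: "gram_det (partial_deriv 1 ?g ?z) (partial_deriv 2 ?g ?z) \<noteq> 0" using gram_det_pos[OF c(2) z] by simp
  have Nadd: "N (v + v') = N v + N v'" and Nscale: "N (k *\<^sub>R v) = k *\<^sub>R N v" for v v' k
  proof -
    have "hyp_proj (F x) (v + v') = hyp_proj (F x) v + hyp_proj (F x) v'" "hyp_proj (F x) (k *\<^sub>R v) = k *\<^sub>R hyp_proj (F x) v"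
      by (simp_all add: hyp_proj_def mink_linear algebra_simps)
    thus "N (v + v') = N v + N v'" "N (k *\<^sub>R v) = k *\<^sub>R N v"
      by (simp_all only: N_def normal_part_chart[OF c(2,4)] normal_proj_add normal_proj_scaleR)
  qed
  have Fx: "?g ?z = F x" by (simp add: in_chart_apply chart_inv_chart[OF c(2,4)])
  have "hyp_proj (F x) (partial_deriv a ?g ?z) = partial_deriv a ?g ?z" for a
    using mink_F_partial[OF c(2) z, of a] by (simp add: hyp_proj_def Fx mink_commute)
  hence N0: "N (partial_deriv 1 ?g ?z) = 0" "N (partial_deriv 2 ?g ?z) = 0"
    by (simp_all only: N_def normal_part_chart[OF c(2,4)] normal_proj_self[OF g])
  have hN: "N (partial_deriv a (partial_deriv b ?g) ?z) = h a b" for a b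
    unfolding N_def h_def second_ff_eq_normal_part[OF c(2,4)] ..
  have h21: "h 2 1 = h 1 2" unfolding h_def by (rule second_ff_sym[OF c(2) z])
  have "second_ff ?f ?y i j = N (partial_deriv i (partial_deriv j ?f) ?y)"
    unfolding N_def second_ff_eq_normal_part[OF c(1,3)] ..
  thus ?thesis unfolding e by (simp add: Nadd Nscale N0 hN h21 algebra_simps)
qed

lemma mean_curv_transition:
  assumes c: "c \<in> \<A>" "d \<in> \<A>" "x \<in> fst c" "x \<in> fst d"
  shows "mean_curv (in_chart F c) (snd c x) = mean_curv (in_chart F d) (snd d x)"
proof -
  have g: "gram_det (partial_deriv 1 (in_chart F c) (snd c x)) (partial_deriv 2 (in_chart F c) (snd c x)) \<noteq> 0"
    using gram_det_pos[OF c(1) in_chart_image[OF c(3)]] by simp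
  show ?thesis
    unfolding mean_curv_def Let_def
    by (rule mean_curv_algebra[OF partial_deriv_transition[OF c] partial_deriv_transition[OF c] g
        second_ff_transition[OF c] _ second_ff_transition[OF c]])
       (simp only: second_ff_transition[OF c])
qed

lemma mean_curvature_chart:
  assumes c: "c \<in> \<A>" "x \<in> fst c"
  shows "mean_curvature \<A> F x = mean_curv (in_chart F c) (snd c x)"
proof -
  have x: "x \<in> S" using chart_subset[OF c(1)] c(2) by blast
  show ?thesis
    unfolding mean_curvature_chart_at[OF x] by (rule mean_curv_transition[OF chart_at(1)[OF x] c(1) chart_at(2)[OF x] c(2)])
qed

end

section \<open>The divergence of the regularized gradient field\<close>

context closed_immersed_surface
begin

definition height :: "real \<times> (real^'n) \<Rightarrow> 'm \<Rightarrow> real" where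
  "height p x = - mink p (F x) - 1"

definition X_normal :: "real \<times> (real^'n) \<Rightarrow> 'm \<Rightarrow> real \<times> (real^'n)" where
  "X_normal p x = normal_part \<A> F x (hyp_proj (F x) (- p))"

text \<open>The target formula in terms free of charts; that it is the divergence of the regularized
  gradient is established in \<open>divergence_chart\<close>.\<close>

definition divergence :: "real \<times> (real^'n) \<Rightarrow> real \<Rightarrow> 'm \<Rightarrow> real" where
  "divergence p e x = 1 + (2 * e - e\<^sup>2) / (height p x + e)\<^sup>2
     + hyp_normsq ((1 / (height p x + e)) *\<^sub>R X_normal p x + (1/2) *\<^sub>R mean_curvature \<A> F x)
     - 1/4 * hyp_normsq (mean_curvature \<A> F x)"

text \<open>The components, in a chart, of the gradient of \<open>ln (height p + e)\<close> on the surface.\<close>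

definition grad_coeff :: "real \<times> (real^'n) \<Rightarrow> real \<Rightarrow> 'm chart \<Rightarrow> 2 \<Rightarrow> real^2 \<Rightarrow> real" where
  "grad_coeff p e c i y =
     (let a = partial_deriv 1 (in_chart F c) y; b = partial_deriv 2 (in_chart F c) y in
      (if i = 1 then tangent_coeff a b (hyp_proj (in_chart F c y) (- p))
       else tangent_coeff b a (hyp_proj (in_chart F c y) (- p))) / (height p (chart_inv c y) + e))"

lemma height_nonneg: "p \<in> hyp_space \<Longrightarrow> x \<in> S \<Longrightarrow> 0 \<le> height p x"
  using mink_hyp_space_le(1)[OF _ F_hyp, of p x] by (simp add: height_def)

lemma height_eq_0_iff: "p \<in> hyp_space \<Longrightarrow> x \<in> S \<Longrightarrow> height p x = 0 \<longleftrightarrow> F x = p"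
  using mink_hyp_space_le(2)[OF _ F_hyp, of p x] by (auto simp: height_def)

lemma area_density_eq_gram:
  "area_density f y = sqrt (gram_det (partial_deriv 1 f y) (partial_deriv 2 f y))"
  by (simp add: area_density_def det_first_fund_form)

lemma mink_hyp_proj_partial:
  assumes c: "c \<in> \<A>" "y \<in> chart_image c"
  shows "mink (hyp_proj (in_chart F c y) v) (partial_deriv i (in_chart F c) y) = mink v (partial_deriv i (in_chart F c) y)"
  using mink_F_partial[OF c, of i] by (simp add: hyp_proj_def mink_linear)

lemma grad_coeff_times_density:
  assumes c: "c \<in> \<A>" "y \<in> chart_image c"
  defines "f \<equiv> in_chart F c"
  defines "a \<equiv> partial_deriv 1 f y" and "b \<equiv> partial_deriv 2 f y"
  shows "area_density f y * grad_coeff p e c 1 y =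
      ((mink b b * (- mink p a) - mink a b * (- mink p b)) / area_density f y) / (- mink p (f y) - 1 + e)"
    and "area_density f y * grad_coeff p e c 2 y =
      ((mink a a * (- mink p b) - mink a b * (- mink p a)) / area_density f y) / (- mink p (f y) - 1 + e)"
proof -
  have g: "gram_det a b > 0" using gram_det_pos[OF c] by (simp add: a_def b_def f_def)
  have W: "area_density f y = sqrt (gram_det a b)" by (simp add: area_density_eq_gram a_def b_def)
  have X: "mink (hyp_proj (f y) (- p)) a = - mink p a" "mink (hyp_proj (f y) (- p)) b = - mink p b"
    using mink_hyp_proj_partial[OF c, of "- p"] by (simp_all add: a_def b_def f_def mink_linear)
  have ht: "height p (chart_inv c y) = - mink p (f y) - 1"
    by (simp add: height_def f_def in_chart_apply)
  have q: "sqrt (gram_det a b) * (z / gram_det a b / d) = z / sqrt (gram_det a b) / d" for z d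
  proof -
    have "sqrt (gram_det a b) * (z / gram_det a b) = z / sqrt (gram_det a b)"
      using g real_sqrt_pow2[of "gram_det a b"] by (simp add: field_simps power2_eq_square)
    thus ?thesis by (simp only: times_divide_eq_right)
  qed
  have g1: "grad_coeff p e c 1 y = tangent_coeff a b (hyp_proj (f y) (- p)) / (- mink p (f y) - 1 + e)"
    and g2: "grad_coeff p e c 2 y = tangent_coeff b a (hyp_proj (f y) (- p)) / (- mink p (f y) - 1 + e)"
    by (simp_all add: grad_coeff_def Let_def a_def b_def ht f_def)
  show "area_density f y * grad_coeff p e c 1 y =
      ((mink b b * (- mink p a) - mink a b * (- mink p b)) / area_density f y) / (- mink p (f y) - 1 + e)"
    unfolding g1 tangent_coeff_def X W by (rule q)
  show "area_density f y * grad_coeff p e c 2 y =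
      ((mink a a * (- mink p b) - mink a b * (- mink p a)) / area_density f y) / (- mink p (f y) - 1 + e)"
    unfolding g2 tangent_coeff_def X W gram_det_commute[of b a] mink_commute[of b a]
    by (rule q)
qed

lemma Ck1_partial_F: "c \<in> \<A> \<Longrightarrow> Ck_on 1 (chart_image c) (partial_deriv i (in_chart F c))"
  by (intro smooth_on_Ck1 smooth_on_partial_deriv smooth_in_chart_F)

lemma Ck1_F: "c \<in> \<A> \<Longrightarrow> Ck_on 1 (chart_image c) (in_chart F c)"
  by (intro smooth_on_Ck1 smooth_in_chart_F)

lemma Ck1_gram:
  "c \<in> \<A> \<Longrightarrow> Ck_on 1 (chart_image c) (\<lambda>y. mink (partial_deriv i (in_chart F c) y) (partial_deriv j (in_chart F c) y))"
  by (intro Ck1_mink Ck1_partial_F)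

lemma Ck1_area_density: "c \<in> \<A> \<Longrightarrow> Ck_on 1 (chart_image c) (area_density (in_chart F c))"
proof -
  assume c: "c \<in> \<A>"
  have "Ck_on 1 (chart_image c) (\<lambda>y. gram_det (partial_deriv 1 (in_chart F c) y) (partial_deriv 2 (in_chart F c) y))"
    unfolding gram_det_def power2_eq_square by (intro Ck1_diff Ck1_mult Ck1_gram c)
  from Ck1_sqrt[OF this gram_det_pos[OF c]] show ?thesis
    unfolding area_density_eq_gram[abs_def] .
qed

lemma Ck1_minus_mink: "Ck_on 1 U f \<Longrightarrow> Ck_on 1 U (\<lambda>y. - mink p (f y))"
  using Ck1_diff[OF Ck1_const[of U 0] Ck1_mink[OF Ck1_const[of U p]], of f] by simp

lemma Ck1_cong:
  assumes "open U" "\<And>y. y \<in> U \<Longrightarrow> f y = g y" "Ck_on 1 U f"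
  shows "Ck_on 1 U g"
proof (rule Ck1_I)
  fix y assume y: "y \<in> U"
  show "(g has_derivative frechet_derivative f (at y)) (at y)"
    by (rule has_derivative_transform_within_open[OF Ck1_has_derivative[OF assms(3) y] assms(1) y assms(2)])
qed (rule Ck1_continuous_frechet[OF assms(3)])

lemma height_plus_pos: "p \<in> hyp_space \<Longrightarrow> 0 < e \<Longrightarrow> x \<in> S \<Longrightarrow> 0 < height p x + e"
  using height_nonneg[of p x] by linarith

lemma Ck1_grad_coeff:
  assumes c: "c \<in> \<A>" and p: "p \<in> hyp_space" and e: "0 < e"
  shows "Ck_on 1 (chart_image c) (\<lambda>y. area_density (in_chart F c) y * grad_coeff p e c i y)"
proof -
  let ?f = "in_chart F c"
  have den: "- mink p (?f y) - 1 + e \<noteq> 0" if "y \<in> chart_image c" for y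
    using height_plus_pos[OF p e chart_inv_in_S[OF c that]] by (simp add: height_def in_chart_apply)
  have W: "area_density ?f y \<noteq> 0" if "y \<in> chart_image c" for y
    using area_density_pos[OF c that] by simp
  have d: "Ck_on 1 (chart_image c) (\<lambda>y. - mink p (?f y) - 1 + e)"
    by (intro Ck1_add Ck1_diff Ck1_const Ck1_minus_mink Ck1_F c)
  have "Ck_on 1 (chart_image c) (\<lambda>y. area_density ?f y * grad_coeff p e c 1 y)"
    by (rule Ck1_cong[OF open_chart_image[OF c] grad_coeff_times_density(1)[OF c, symmetric]])
       (assumption, intro Ck1_divide[OF _ d den] Ck1_divide[OF _ Ck1_area_density[OF c] W] Ck1_diff Ck1_mult Ck1_gram c
          Ck1_minus_mink Ck1_partial_F)
  moreover have "Ck_on 1 (chart_image c) (\<lambda>y. area_density ?f y * grad_coeff p e c 2 y)"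
    by (rule Ck1_cong[OF open_chart_image[OF c] grad_coeff_times_density(2)[OF c, symmetric]])
       (assumption, intro Ck1_divide[OF _ d den] Ck1_divide[OF _ Ck1_area_density[OF c] W] Ck1_diff Ck1_mult Ck1_gram c
          Ck1_minus_mink Ck1_partial_F)
  ultimately show ?thesis using exhaust_2[of i] by metis
qed

text \<open>Obtained by differentiating the tangency \<open>mink_F_partial\<close> once more. It
  describes how the hyperboloid curves in Minkowski space and is the origin of the term
  \<open>(1 + u)\<close> times the metric in the Hessian of \<open>u\<close>.\<close>

lemma mink_F_second_partial:
  assumes c: "c \<in> \<A>" "y \<in> chart_image c"
  shows "mink (in_chart F c y) (partial_deriv i (partial_deriv j (in_chart F c)) y) =
    - mink (partial_deriv i (in_chart F c) y) (partial_deriv j (in_chart F c) y)"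
proof -
  let ?f = "in_chart F c"
  have 1: "((\<lambda>z. mink (?f z) (partial_deriv j ?f z)) has_derivative
      (\<lambda>h. mink (?f y) (frechet_derivative (partial_deriv j ?f) (at y) h) + mink (frechet_derivative ?f (at y) h) (partial_deriv j ?f y))) (at y)"
    by (rule mink.FDERIV[OF Ck1_has_derivative[OF Ck1_F[OF c(1)] c(2)] Ck1_has_derivative[OF Ck1_partial_F[OF c(1)] c(2)]])
  have 2: "((\<lambda>z. mink (?f z) (partial_deriv j ?f z)) has_derivative (\<lambda>h. 0)) (at y)"
    by (rule has_derivative_transform_within_open[OF has_derivative_const[of 0] open_chart_image[OF c(1)] c(2)])
       (rule mink_F_partial[OF c(1), symmetric])
  from fun_cong[OF has_derivative_unique[OF 1 2], of "axis i 1"] show ?thesis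
    by (simp add: partial_deriv_def)
qed

text \<open>Everything is read off from the orthogonal decomposition of \<open>- p\<close> into the
  normal part of \<open>X\<close>, a tangent vector of the surface, and a multiple of the position
  vector \<open>f y\<close>.\<close>

lemma mink_X_normal:
  fixes p :: "real \<times> (real^'n)"
  assumes c: "c \<in> \<A>" "y \<in> chart_image c"
  defines "f \<equiv> in_chart F c"
  defines "a \<equiv> partial_deriv 1 f y" and "b \<equiv> partial_deriv 2 f y"
  defines "X \<equiv> hyp_proj (f y) (- p)"
  shows "X_normal p (chart_inv c y) = normal_proj a b X"
    and "mink (normal_proj a b X) (f y) = 0"
    and "- mink p v = mink (normal_proj a b X) v + tangent_coeff a b X * mink v a + tangent_coeff b a X * mink v b
        + mink p (f y) * mink (f y) v"
proof -
  have x: "chart_inv c y \<in> fst c" "snd c (chart_inv c y) = y" using chart_inv_in chart_chart_inv c(2) by blast+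
  show N: "X_normal p (chart_inv c y) = normal_proj a b X"
    unfolding X_normal_def normal_part_chart[OF c(1) x(1)] x(2) by (simp add: a_def b_def X_def f_def in_chart_apply)
  have fa: "mink a (f y) = 0" "mink b (f y) = 0"
    using mink_F_partial[OF c] by (simp_all add: a_def b_def f_def mink_commute)
  have "mink X (f y) = 0"
    using mink_hyp_proj(1)[OF in_chart_F_hyp[OF c]] by (simp add: X_def f_def mink_commute)
  thus "mink (normal_proj a b X) (f y) = 0" by (simp add: normal_proj_def mink_linear fa)
  have "normal_proj a b X = - p - mink p (f y) *\<^sub>R f y - tangent_coeff a b X *\<^sub>R a - tangent_coeff b a X *\<^sub>R b"
    by (simp add: normal_proj_def) (simp add: X_def hyp_proj_def mink_linear)
  thus "- mink p v = mink (normal_proj a b X) v + tangent_coeff a b X * mink v a + tangent_coeff b a X * mink v b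
        + mink p (f y) * mink (f y) v"
    by (simp add: mink_linear mink_commute[of v a] mink_commute[of v b])
qed

text \<open>The left side is the coordinate divergence before division by the density. All
  ingredients are differentiated along the coordinate axes; the metric terms are then handled by
  \<open>divergence_algebra\<close>, and the rest is the geometry of \<open>X\<close>.\<close>

lemma divergence_chart:
  assumes c: "c \<in> \<A>" "y \<in> chart_image c" and p: "p \<in> hyp_space" and e: "0 < e"
  shows "partial_deriv 1 (\<lambda>y. area_density (in_chart F c) y * grad_coeff p e c 1 y) y
      + partial_deriv 2 (\<lambda>y. area_density (in_chart F c) y * grad_coeff p e c 2 y) y
    = area_density (in_chart F c) y * divergence p e (chart_inv c y)"
proof -
  define f where "f = in_chart F c"
  define f1 where "f1 = partial_deriv 1 f"
  define f2 where "f2 = partial_deriv 2 f"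
  define f11 where "f11 = partial_deriv 1 f1 y"
  define f12 where "f12 = partial_deriv 1 f2 y"
  define f22 where "f22 = partial_deriv 2 f2 y"
  have f21: "partial_deriv 2 f1 y = f12"
    unfolding f12_def f1_def f2_def f_def
    by (rule smooth_on_partial_deriv_commute[OF open_chart_image[OF c(1)] c(2) smooth_in_chart_F[OF c(1)]])
  define E where "E z = mink (f1 z) (f1 z)" for z
  define K where "K z = mink (f1 z) (f2 z)" for z
  define G where "G z = mink (f2 z) (f2 z)" for z
  define W where "W z = sqrt (E z * G z - (K z)\<^sup>2)" for z
  define u1 where "u1 z = - mink p (f1 z)" for z
  define u2 where "u2 z = - mink p (f2 z)" for z
  define u where "u z = - mink p (f z) - 1" for z
  have Wd: "area_density f z = W z" for z
    by (simp add: area_density_eq_gram gram_det_def W_def E_def G_def K_def f1_def f2_def)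
  have W0: "W y > 0" using area_density_pos[OF c] unfolding f_def[symmetric] Wd .
  hence gpos: "0 < E y * G y - (K y)\<^sup>2" by (simp add: W_def)
  hence W2: "(W y)\<^sup>2 = E y * G y - (K y)\<^sup>2" by (simp add: W_def)
  have ue: "u y + e > 0"
    using height_plus_pos[OF p e chart_inv_in_S[OF c]] by (simp add: height_def u_def f_def in_chart_apply)
  \<comment> \<open>Density times the components of the tangential part of \<open>X\<close>, still
    without the denominator \<open>u + e\<close>.\<close>
  define M1 where "M1 z = (G z * u1 z - K z * u2 z) / W z" for z
  define M2 where "M2 z = (E z * u2 z - K z * u1 z) / W z" for z
  have diff: "f differentiable (at y)" "f1 differentiable (at y)" "f2 differentiable (at y)"
    unfolding f_def f1_def f2_def
    by (intro Ck1_differentiable[OF Ck1_F[OF c(1)] c(2)] Ck1_differentiable[OF Ck1_partial_F[OF c(1)] c(2)])+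
  have al: "((\<lambda>t. f (y + t *\<^sub>R axis 1 1)) has_vector_derivative f1 y) (at 0)"
    "((\<lambda>t. f (y + t *\<^sub>R axis 2 1)) has_vector_derivative f2 y) (at 0)"
    "((\<lambda>t. f1 (y + t *\<^sub>R axis 1 1)) has_vector_derivative f11) (at 0)"
    "((\<lambda>t. f1 (y + t *\<^sub>R axis 2 1)) has_vector_derivative f12) (at 0)"
    "((\<lambda>t. f2 (y + t *\<^sub>R axis 1 1)) has_vector_derivative f12) (at 0)"
    "((\<lambda>t. f2 (y + t *\<^sub>R axis 2 1)) has_vector_derivative f22) (at 0)"
    using partial_deriv_along[OF diff(1), of 1] partial_deriv_along[OF diff(1), of 2]
      partial_deriv_along[OF diff(2), of 1] partial_deriv_along[OF diff(2), of 2]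
      partial_deriv_along[OF diff(3), of 1] partial_deriv_along[OF diff(3), of 2]
    unfolding f21 f1_def[symmetric] f2_def[symmetric] f11_def[symmetric] f12_def[symmetric] f22_def[symmetric] .
  have mk: "((\<lambda>t. mink (k (y + t *\<^sub>R v)) (l (y + t *\<^sub>R v))) has_real_derivative (mink k' (l y) + mink (k y) l')) (at 0)"
    if "((\<lambda>t. k (y + t *\<^sub>R v)) has_vector_derivative k') (at 0)" "((\<lambda>t. l (y + t *\<^sub>R v)) has_vector_derivative l') (at 0)"
    for k l :: "real^2 \<Rightarrow> real \<times> (real^'n)" and v k' l'
    using mink.has_vector_derivative[OF that]
    by (simp add: has_real_derivative_iff_has_vector_derivative add.commute)
  have mp: "((\<lambda>t. - mink p (k (y + t *\<^sub>R v))) has_real_derivative - mink p k') (at 0)"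
    if "((\<lambda>t. k (y + t *\<^sub>R v)) has_vector_derivative k') (at 0)" for k :: "real^2 \<Rightarrow> real \<times> (real^'n)" and v k'
    using has_vector_derivative_minus[OF bounded_linear.has_vector_derivative[OF mink.bounded_linear_right that, of p]]
    by (simp add: has_real_derivative_iff_has_vector_derivative)
  note base = mk[OF al(3) al(3)] mk[OF al(3) al(5)] mk[OF al(5) al(5)] mk[OF al(4) al(4)] mk[OF al(4) al(6)] mk[OF al(6) al(6)]
    mp[OF al(3)] mp[OF al(5)] mp[OF al(4)] mp[OF al(6)] mp[OF al(1)] mp[OF al(2)]
  define A1 A2 B1 B2 C1 C2 where "A1 = mink f11 (f1 y)" and "A2 = mink f11 (f2 y)" and "B1 = mink f12 (f1 y)"
    and "B2 = mink f12 (f2 y)" and "C1 = mink f22 (f1 y)" and "C2 = mink f22 (f2 y)"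
  note abc = A1_def A2_def B1_def B2_def C1_def C2_def
  define U11 U12 U22 where "U11 = - mink p f11" and "U12 = - mink p f12" and "U22 = - mink p f22"
  have dE: "((\<lambda>t. E (y + t *\<^sub>R axis 1 1)) has_real_derivative 2 * A1) (at 0)" "((\<lambda>t. E (y + t *\<^sub>R axis 2 1)) has_real_derivative 2 * B1) (at 0)"
    using base(1,4) by (simp_all add: E_def[abs_def] abc mink_commute[of "f1 y"])
  have dK: "((\<lambda>t. K (y + t *\<^sub>R axis 1 1)) has_real_derivative A2 + B1) (at 0)" "((\<lambda>t. K (y + t *\<^sub>R axis 2 1)) has_real_derivative B2 + C1) (at 0)"
    using base(2,5) by (simp_all add: K_def[abs_def] abc mink_commute[of "f1 y"])
  have dG: "((\<lambda>t. G (y + t *\<^sub>R axis 1 1)) has_real_derivative 2 * B2) (at 0)" "((\<lambda>t. G (y + t *\<^sub>R axis 2 1)) has_real_derivative 2 * C2) (at 0)"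
    using base(3,6) by (simp_all add: G_def[abs_def] abc mink_commute[of "f2 y"])
  have du1: "((\<lambda>t. u1 (y + t *\<^sub>R axis 1 1)) has_real_derivative U11) (at 0)" "((\<lambda>t. u1 (y + t *\<^sub>R axis 2 1)) has_real_derivative U12) (at 0)"
    and du2: "((\<lambda>t. u2 (y + t *\<^sub>R axis 1 1)) has_real_derivative U12) (at 0)" "((\<lambda>t. u2 (y + t *\<^sub>R axis 2 1)) has_real_derivative U22) (at 0)"
    using base(7,8,9,10) by (simp_all add: u1_def[abs_def] u2_def[abs_def] U11_def U12_def U22_def)
  have du: "((\<lambda>t. u (y + t *\<^sub>R axis 1 1)) has_real_derivative u1 y) (at 0)" "((\<lambda>t. u (y + t *\<^sub>R axis 2 1)) has_real_derivative u2 y) (at 0)"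
    using DERIV_diff[OF base(11) DERIV_const[of 1]] DERIV_diff[OF base(12) DERIV_const[of 1]]
    by (simp_all add: u_def[abs_def] u1_def u2_def)
  define W1 where "W1 = (2 * A1 * G y + E y * (2 * B2) - 2 * K y * (A2 + B1)) / (2 * W y)"
  define W2' where "W2' = (2 * B1 * G y + E y * (2 * C2) - 2 * K y * (B2 + C1)) / (2 * W y)"
  have dW: "((\<lambda>t. W (y + t *\<^sub>R v)) has_real_derivative (E' * G y + E y * G' - 2 * K y * K') / (2 * W y)) (at 0)"
    if "((\<lambda>t. E (y + t *\<^sub>R v)) has_real_derivative E') (at 0)" "((\<lambda>t. K (y + t *\<^sub>R v)) has_real_derivative K') (at 0)"
      "((\<lambda>t. G (y + t *\<^sub>R v)) has_real_derivative G') (at 0)" for v E' K' G'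
  proof -
    have "((\<lambda>t. E (y + t *\<^sub>R v) * G (y + t *\<^sub>R v) - (K (y + t *\<^sub>R v))\<^sup>2) has_real_derivative
       E' * G y + E y * G' - 2 * K y * K') (at 0)"
      by (rule derivative_eq_intros that refl)+ (simp add: algebra_simps)
    moreover have "(sqrt has_real_derivative inverse (W y) / 2) (at (E (y + 0 *\<^sub>R v) * G (y + 0 *\<^sub>R v) - (K (y + 0 *\<^sub>R v))\<^sup>2))"
      using DERIV_real_sqrt[OF gpos] by (simp add: W_def)
    ultimately have "((\<lambda>t. W (y + t *\<^sub>R v)) has_real_derivative inverse (W y) / 2 * (E' * G y + E y * G' - 2 * K y * K')) (at 0)"
      unfolding W_def by (rule DERIV_chain2[rotated])
    thus ?thesis by (simp add: field_simps)
  qed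
  have dW1: "((\<lambda>t. W (y + t *\<^sub>R axis 1 1)) has_real_derivative W1) (at 0)"
    unfolding W1_def by (rule dW[OF dE(1) dK(1) dG(1)])
  have dW2: "((\<lambda>t. W (y + t *\<^sub>R axis 2 1)) has_real_derivative W2') (at 0)"
    unfolding W2'_def by (rule dW[OF dE(2) dK(2) dG(2)])
  define D1 where "D1 = ((2 * B2 * u1 y + G y * U11 - (A2 + B1) * u2 y - K y * U12) * W y - (G y * u1 y - K y * u2 y) * W1) / (W y)\<^sup>2"
  define D2 where "D2 = ((2 * B1 * u2 y + E y * U22 - (B2 + C1) * u1 y - K y * U12) * W y - (E y * u2 y - K y * u1 y) * W2') / (W y)\<^sup>2"
  have dM1: "((\<lambda>t. M1 (y + t *\<^sub>R axis 1 1)) has_real_derivative D1) (at 0)"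
    unfolding M1_def D1_def
    by (rule derivative_eq_intros dG(1) dK(1) du1(1) du2(1) dW1 refl)+
       (use W0 in \<open>simp_all add: power2_eq_square algebra_simps\<close>)
  have dM2: "((\<lambda>t. M2 (y + t *\<^sub>R axis 2 1)) has_real_derivative D2) (at 0)"
    unfolding M2_def D2_def
    by (rule derivative_eq_intros dE(2) dK(2) du1(2) du2(2) dW2 refl)+
       (use W0 in \<open>simp_all add: power2_eq_square algebra_simps\<close>)
  have dQ: "((\<lambda>t. M (y + t *\<^sub>R v) / (u (y + t *\<^sub>R v) + e)) has_real_derivative D / (u y + e) - M y * u' / (u y + e)\<^sup>2) (at 0)"
    if "((\<lambda>t. M (y + t *\<^sub>R v)) has_real_derivative D) (at 0)" "((\<lambda>t. u (y + t *\<^sub>R v)) has_real_derivative u') (at 0)" for M D v u'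
  proof -
    have "((\<lambda>t. M (y + t *\<^sub>R v) / (u (y + t *\<^sub>R v) + e)) has_real_derivative
        (D * (u y + e) - M y * u') / ((u y + e) * (u y + e))) (at 0)"
      using DERIV_divide[OF that(1) DERIV_add[OF that(2) DERIV_const[of e]]] ue by simp
    moreover have "(D * (u y + e) - M y * u') / ((u y + e) * (u y + e)) = D / (u y + e) - M y * u' / (u y + e)\<^sup>2"
      using ue by (simp add: diff_divide_distrib power2_eq_square)
    ultimately show ?thesis by simp
  qed
  have V: "area_density f z * grad_coeff p e c 1 z = M1 z / (u z + e)" "area_density f z * grad_coeff p e c 2 z = M2 z / (u z + e)"
    if "z \<in> chart_image c" for z
    using grad_coeff_times_density[OF c(1) that, of p e, folded f_def]
    unfolding Wd M1_def M2_def u1_def u2_def u_def E_def G_def K_def f1_def f2_def by simp_all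
  \<comment> \<open>The simplified expression \<open>k\<close> agrees with the original one only
    inside the chart image, so the derivative is carried over along a short piece of the axis that
    stays in this open set.\<close>
  have pV: "partial_deriv i (\<lambda>y. area_density f y * grad_coeff p e c i y) y = d"
    if eq: "\<And>z. z \<in> chart_image c \<Longrightarrow> area_density f z * grad_coeff p e c i z = k z"
      and d: "((\<lambda>t. k (y + t *\<^sub>R axis i 1)) has_real_derivative d) (at 0)" for i k d
  proof (rule partial_deriv_real_eqI)
    show "(\<lambda>y. area_density f y * grad_coeff p e c i y) differentiable (at y)"
      unfolding f_def by (rule Ck1_differentiable[OF Ck1_grad_coeff[OF c(1) p e] c(2)])
    have "open ((\<lambda>t::real. y + t *\<^sub>R axis i 1) -` chart_image c)"
      by (intro open_vimage open_chart_image[OF c(1)] continuous_intros)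
    hence "eventually (\<lambda>t. t \<in> (\<lambda>t::real. y + t *\<^sub>R axis i 1) -` chart_image c) (nhds 0)"
      using c(2) by (intro eventually_nhds_in_open) simp_all
    hence "eventually (\<lambda>t. y + t *\<^sub>R axis i 1 \<in> chart_image c) (nhds (0::real))" by simp
    hence "eventually (\<lambda>t. area_density f (y + t *\<^sub>R axis i 1) * grad_coeff p e c i (y + t *\<^sub>R axis i 1) = k (y + t *\<^sub>R axis i 1)) (nhds 0)"
      by (rule eventually_mono) (rule eq)
    thus "((\<lambda>t. area_density f (y + t *\<^sub>R axis i 1) * grad_coeff p e c i (y + t *\<^sub>R axis i 1)) has_real_derivative d) (at 0)"
      using d by (subst DERIV_cong_ev[OF refl _ refl])
  qed
  \<comment> \<open>The quotient rule separates the divergence of the tangential part of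
    \<open>X\<close> from its product with the gradient of \<open>u\<close>, that is from its
    squared length.\<close>
  have lhs: "partial_deriv 1 (\<lambda>y. area_density f y * grad_coeff p e c 1 y) y
      + partial_deriv 2 (\<lambda>y. area_density f y * grad_coeff p e c 2 y) y
    = (D1 + D2) / (u y + e) - (M1 y * u1 y + M2 y * u2 y) / (u y + e)\<^sup>2"
  proof -
    have "partial_deriv 1 (\<lambda>y. area_density f y * grad_coeff p e c 1 y) y = D1 / (u y + e) - M1 y * u1 y / (u y + e)\<^sup>2"
      by (rule pV[where k = "\<lambda>z. M1 z / (u z + e)"], erule V(1), rule dQ[where M = M1, OF dM1 du(1)])
    moreover have "partial_deriv 2 (\<lambda>y. area_density f y * grad_coeff p e c 2 y) y = D2 / (u y + e) - M2 y * u2 y / (u y + e)\<^sup>2"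
      by (rule pV[where k = "\<lambda>z. M2 z / (u z + e)"], erule V(2), rule dQ[where M = M2, OF dM2 du(2)])
    ultimately show ?thesis by (simp add: add_divide_distrib)
  qed
  define a where "a = f1 y"
  define b where "b = f2 y"
  define X where "X = hyp_proj (f y) (- p)"
  define N where "N = normal_proj a b X"
  define x1 where "x1 = tangent_coeff a b X"
  define x2 where "x2 = tangent_coeff b a X"
  note Xn = mink_X_normal[OF c, of p, folded f_def, folded f1_def f2_def, folded a_def b_def, folded X_def, folded N_def x1_def x2_def]
  have gd: "gram_det a b = (W y)\<^sup>2" "gram_det a b \<noteq> 0"
    using gpos unfolding W2 by (simp_all add: gram_det_def a_def b_def E_def K_def G_def)
  have Xa: "u1 y = mink X a" "u2 y = mink X b"
    using mink_hyp_proj_partial[OF c, of "- p"]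
    by (simp_all add: u1_def u2_def X_def a_def b_def f1_def f2_def f_def mink_linear)
  have uu: "u1 y = x1 * E y + x2 * K y" "u2 y = x1 * K y + x2 * G y"
    unfolding Xa using mink_tangent_coeff[OF gd(2), of X] by (simp_all add: x1_def x2_def E_def K_def G_def a_def b_def)
  have ff: "mink (f y) f11 = - E y" "mink (f y) f12 = - K y" "mink (f y) f22 = - G y"
    using mink_F_second_partial[OF c] by (simp_all add: f11_def f12_def f22_def E_def K_def G_def f1_def f2_def f_def)
  have U: "U11 = mink N f11 + x1 * A1 + x2 * A2 + (1 + u y) * E y"
    "U12 = mink N f12 + x1 * B1 + x2 * B2 + (1 + u y) * K y"
    "U22 = mink N f22 + x1 * C1 + x2 * C2 + (1 + u y) * G y"
    unfolding U11_def U12_def U22_def Xn(3) ff by (simp_all add: abc a_def b_def u_def)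
  \<comment> \<open>Twice \<open>1 + u\<close> is the trace of the Hessian of \<open>u\<close> on
    the tangent plane; the fraction is identified in \<open>NH\<close> as the product of the normal
    part of \<open>X\<close> with the mean curvature vector.\<close>
  have div: "D1 + D2 = W y * (2 * (1 + u y) + (G y * mink N f11 - 2 * K y * mink N f12 + E y * mink N f22) / (W y)\<^sup>2)"
    unfolding D1_def D2_def by (rule divergence_algebra[OF _ W2 uu U W1_def W2'_def]) (use W0 in simp)
  have x: "chart_inv c y \<in> fst c" "snd c (chart_inv c y) = y" using chart_inv_in chart_chart_inv c(2) by blast+
  define H where "H = mean_curvature \<A> F (chart_inv c y)"
  have H: "H = mean_curv f y" unfolding H_def mean_curvature_chart[OF c(1) x(1)] x(2) f_def ..
  have NS: "mink N (second_ff f y i j) = mink N (partial_deriv i (partial_deriv j f) y)" for i j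
  proof -
    have "mink N (second_ff f y i j) = mink N (hyp_proj (f y) (partial_deriv i (partial_deriv j f) y))"
      unfolding second_ff_def f1_def[symmetric] f2_def[symmetric] a_def[symmetric] b_def[symmetric] N_def
      by (rule mink_normal_proj_normal_proj[OF gd(2)])
    thus ?thesis using Xn(2) by (simp add: hyp_proj_def mink_linear)
  qed
  have NH: "mink N H = (G y * mink N f11 - 2 * K y * mink N f12 + E y * mink N f22) / (W y)\<^sup>2"
    unfolding H mean_curv_def Let_def f1_def[symmetric] f2_def[symmetric] a_def[symmetric] b_def[symmetric] gd(1)
    by (simp add: mink_linear NS f11_def f12_def f22_def E_def G_def K_def a_def b_def f1_def f2_def)
  have q: "f y \<in> hyp_space" unfolding f_def by (rule in_chart_F_hyp[OF c])
  \<comment> \<open>With \<open>1 + u\<close> = cosh r this is sinh^2 r. Subtracting the square of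
    the normal part leaves in \<open>XN\<close> the square of the tangential part, the numerator of
    the second fraction in \<open>lhs\<close>.\<close>
  have XX: "mink X X = u y * (u y + 2)"
    unfolding X_def mink_hyp_proj(2)[OF q] using hyp_space_mink[OF p]
    by (simp add: mink_linear u_def power2_eq_square algebra_simps)
  have "mink N X = mink N N" unfolding N_def by (rule mink_normal_proj_normal_proj[OF gd(2), symmetric])
  hence XN: "x1 * u1 y + x2 * u2 y = u y * (u y + 2) - mink N N"
    using mink_self_normal_proj[of X a b] XX unfolding N_def[symmetric] x1_def[symmetric] x2_def[symmetric] Xa by simp
  have "G y * u1 y - K y * u2 y = x1 * (W y)\<^sup>2" "E y * u2 y - K y * u1 y = x2 * (W y)\<^sup>2"
    unfolding uu W2 by (simp_all add: power2_eq_square algebra_simps)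
  hence "M1 y = W y * x1" "M2 y = W y * x2"
    using W0 unfolding M1_def M2_def by (simp_all add: power2_eq_square)
  hence M: "M1 y * u1 y + M2 y * u2 y = W y * (u y * (u y + 2) - mink N N)"
    unfolding XN[symmetric] by (simp add: algebra_simps)
  have ht: "height p (chart_inv c y) = u y" by (simp add: height_def u_def f_def in_chart_apply)
  \<comment> \<open>Two expansions are checked at once: 2 (1 + u) (u + e) - u (u + 2) = (u + e)^2 +
    2 e - e^2, and the completion of the square in \<open>N\<close> / (u + e) and \<open>H\<close> /
    2.\<close>
  have "divergence p e (chart_inv c y) = (2 * (1 + u y) + mink N H) / (u y + e) - (u y * (u y + 2) - mink N N) / (u y + e)\<^sup>2"
    unfolding divergence_def ht Xn(1) H_def[symmetric] hyp_normsq_def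
    using ue by (simp add: mink_linear mink_commute[of H N] divide_simps power2_eq_square) (simp add: algebra_simps)
  thus ?thesis
    unfolding f_def[symmetric] lhs unfolding div NH[symmetric] M Wd
    by (simp add: right_diff_distrib)
qed

end

section \<open>The divergence theorem on the surface\<close>

lemma Ck1_Un: "open U \<Longrightarrow> open V \<Longrightarrow> Ck_on 1 U f \<Longrightarrow> Ck_on 1 V f \<Longrightarrow> Ck_on 1 (U \<union> V) f"
  unfolding Ck1_iff ball_Un by (simp add: continuous_on_open_Un)

lemma Ck1_sum: "(\<And>i. i \<in> I \<Longrightarrow> Ck_on 1 U (f i)) \<Longrightarrow> Ck_on 1 U (\<lambda>x. \<Sum>i\<in>I. f i x)"
  by (induction I rule: infinite_finite_induct) (simp_all add: Ck1_const Ck1_add del: One_nat_def)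

text \<open>Squaring removes the corner of the positive part, so cutoff functions built from it are
  of class C^1, which is all that partial integration requires.\<close>

lemma DERIV_max_0_square: "((\<lambda>t::real. (max 0 t)\<^sup>2) has_real_derivative 2 * max 0 t) (at t)"
proof -
  consider "t > 0" | "t < 0" | "t = 0" by linarith
  thus ?thesis
  proof cases
    case 1
    have "((\<lambda>t::real. t\<^sup>2) has_real_derivative 2 * max 0 t) (at t)"
      using 1 by (auto intro!: derivative_eq_intros)
    thus ?thesis
      by (rule has_field_derivative_transform_within_open[of _ _ _ "{0<..}"]) (use 1 in simp_all)
  next
    case 2
    have "((\<lambda>t::real. 0) has_real_derivative 2 * max 0 t) (at t)" using 2 by simp
    thus ?thesis
      by (rule has_field_derivative_transform_within_open[of _ _ _ "{..<0}"]) (use 2 in simp_all)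
  next
    case 3
    have "((\<lambda>h::real. max 0 h) \<longlongrightarrow> max 0 0) (at 0)" by (intro tendsto_intros)
    hence "((\<lambda>h::real. max 0 h) \<longlongrightarrow> 0) (at 0)" by simp
    hence "((\<lambda>h::real. ((max 0 (0 + h))\<^sup>2 - (max 0 0)\<^sup>2) / h) \<longlongrightarrow> 0) (at 0)"
      by (rule filterlim_mono_eventually[OF _ order_refl order_refl])
         (auto simp: eventually_at_filter max_def power2_eq_square intro!: always_eventually)
    thus ?thesis unfolding 3 DERIV_def by simp
  qed
qed

context closed_immersed_surface
begin

definition surf_C1 :: "('m \<Rightarrow> real) \<Rightarrow> bool" where
  "surf_C1 h \<longleftrightarrow> (\<forall>c\<in>\<A>. Ck_on 1 (chart_image c) (in_chart h c))"

text \<open>The derivative of \<open>h\<close> in the direction of the gradient of \<open>ln (height p + e)\<close>.\<close>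

definition chart_pairing :: "real \<times> (real^'n) \<Rightarrow> real \<Rightarrow> ('m \<Rightarrow> real) \<Rightarrow> 'm chart \<Rightarrow> real^2 \<Rightarrow> real" where
  "chart_pairing p e h c y = grad_coeff p e c 1 y * partial_deriv 1 (in_chart h c) y
     + grad_coeff p e c 2 y * partial_deriv 2 (in_chart h c) y"

definition grad_pairing :: "real \<times> (real^'n) \<Rightarrow> real \<Rightarrow> ('m \<Rightarrow> real) \<Rightarrow> 'm \<Rightarrow> real" where
  "grad_pairing p e h x = chart_pairing p e h (chart_at \<A> x) (snd (chart_at \<A> x) x)"

lemma surf_C1_D: "surf_C1 h \<Longrightarrow> c \<in> \<A> \<Longrightarrow> Ck_on 1 (chart_image c) (in_chart h c)"
  unfolding surf_C1_def by (rule bspec)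

lemma surf_C1_continuous: "surf_C1 h \<Longrightarrow> continuous_on S h"
  by (rule continuous_on_S_chartI) (rule Ck1_continuous[OF surf_C1_D])

text \<open>The right side mentions no chart: the components represent one ambient vector. Since the
  differentials of \<open>F\<close> are injective, components in two charts must be related by the
  derivative of the transition map, which makes \<open>grad_pairing\<close> independent of the
  chart.\<close>

lemma frechet_F_grad_coeff:
  assumes c: "c \<in> \<A>" "x \<in> fst c"
  shows "frechet_derivative (in_chart F c) (at (snd c x)) (vector [grad_coeff p e c 1 (snd c x), grad_coeff p e c 2 (snd c x)])
    = (1 / (height p x + e)) *\<^sub>R (hyp_proj (F x) (- p) - X_normal p x)"
proof -
  have y: "snd c x \<in> chart_image c" by (rule in_chart_image[OF c(2)])
  have x: "chart_inv c (snd c x) = x" by (rule chart_inv_chart[OF c])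
  show ?thesis
    unfolding frechet_derivative_apply_partial[OF in_chart_F_differentiable[OF c(1) y]]
      mink_X_normal(1)[OF c(1) y, of p, unfolded x] normal_proj_def
    by (simp add: grad_coeff_def Let_def x in_chart_apply algebra_simps)
qed

lemma frechet_apply_grad_coeff:
  assumes "in_chart h c differentiable (at y)"
  shows "chart_pairing p e h c y = frechet_derivative (in_chart h c) (at y) (vector [grad_coeff p e c 1 y, grad_coeff p e c 2 y])"
  unfolding chart_pairing_def frechet_derivative_apply_partial[OF assms] by simp

lemma chart_pairing_transition:
  assumes c: "c \<in> \<A>" "d \<in> \<A>" "x \<in> fst c" "x \<in> fst d" and h: "surf_C1 h"
  shows "chart_pairing p e h c (snd c x) = chart_pairing p e h d (snd d x)"
proof -
  let ?v = "vector [grad_coeff p e c 1 (snd c x), grad_coeff p e c 2 (snd c x)] :: real^2"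
  let ?v' = "vector [grad_coeff p e d 1 (snd d x), grad_coeff p e d 2 (snd d x)] :: real^2"
  let ?T = "frechet_derivative (transition c d) (at (snd c x))"
  have dh: "in_chart h c differentiable (at (snd c x))" "in_chart h d differentiable (at (snd d x))"
    using Ck1_differentiable[OF surf_C1_D[OF h c(1)] in_chart_image[OF c(3)]]
      Ck1_differentiable[OF surf_C1_D[OF h c(2)] in_chart_image[OF c(4)]] .
  have dF: "in_chart F d differentiable (at (snd d x))"
    by (rule in_chart_F_differentiable[OF c(2) in_chart_image[OF c(4)]])
  have "frechet_derivative (in_chart F d) (at (snd d x)) (?T ?v) = frechet_derivative (in_chart F c) (at (snd c x)) ?v"
    by (rule fun_cong[OF frechet_derivative_at[OF in_chart_transition_has_derivative[OF c dF]]])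
  also have "\<dots> = frechet_derivative (in_chart F d) (at (snd d x)) ?v'"
    unfolding frechet_F_grad_coeff[OF c(1,3)] frechet_F_grad_coeff[OF c(2,4)] ..
  finally have "?T ?v = ?v'"
    by (rule injD[OF inj_frechet_in_chart_F[OF c(2) in_chart_image[OF c(4)]]])
  moreover have "frechet_derivative (in_chart h d) (at (snd d x)) (?T ?v) = frechet_derivative (in_chart h c) (at (snd c x)) ?v"
    by (rule fun_cong[OF frechet_derivative_at[OF in_chart_transition_has_derivative[OF c dh(2)]]])
  ultimately show ?thesis
    unfolding frechet_apply_grad_coeff[OF dh(1)] frechet_apply_grad_coeff[OF dh(2)] by simp
qed

lemma grad_pairing_chart:
  assumes c: "c \<in> \<A>" "x \<in> fst c" and h: "surf_C1 h"
  shows "grad_pairing p e h x = chart_pairing p e h c (snd c x)"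
proof -
  have x: "x \<in> S" using chart_subset[OF c(1)] c(2) by blast
  show ?thesis unfolding grad_pairing_def
    by (rule chart_pairing_transition[OF chart_at(1)[OF x] c(1) chart_at(2)[OF x] c(2) h])
qed

lemma continuous_on_grad_pairing:
  assumes h: "surf_C1 h" and p: "p \<in> hyp_space" and e: "0 < e"
  shows "continuous_on S (grad_pairing p e h)"
proof (rule continuous_on_S_chartI)
  fix c assume c: "c \<in> \<A>"
  have W: "area_density (in_chart F c) y \<noteq> 0" if "y \<in> chart_image c" for y
    using area_density_pos[OF c that] by simp
  have "continuous_on (chart_image c) (\<lambda>y.
      ((area_density (in_chart F c) y * grad_coeff p e c 1 y) * partial_deriv 1 (in_chart h c) y
     + (area_density (in_chart F c) y * grad_coeff p e c 2 y) * partial_deriv 2 (in_chart h c) y) / area_density (in_chart F c) y)"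
    by (intro continuous_on_divide continuous_on_add continuous_on_mult Ck1_continuous[OF Ck1_grad_coeff[OF c p e]]
         Ck1_continuous_partial[OF surf_C1_D[OF h c]] continuous_on_area_density[OF c] ballI W)
  thus "continuous_on (chart_image c) (in_chart (grad_pairing p e h) c)"
  proof (rule continuous_on_eq)
    fix y assume y: "y \<in> chart_image c"
    have "in_chart (grad_pairing p e h) c y = chart_pairing p e h c y"
      unfolding in_chart_apply grad_pairing_chart[OF c chart_inv_in[OF y] h] chart_chart_inv[OF y] ..
    thus "((area_density (in_chart F c) y * grad_coeff p e c 1 y) * partial_deriv 1 (in_chart h c) y
     + (area_density (in_chart F c) y * grad_coeff p e c 2 y) * partial_deriv 2 (in_chart h c) y) / area_density (in_chart F c) y
     = in_chart (grad_pairing p e h) c y"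
      using W[OF y] by (simp add: chart_pairing_def field_simps)
  qed
qed

text \<open>Continuity is read off from \<open>divergence_chart\<close>, as a quotient of continuous
  partial derivatives by the positive density, rather than from the geometric terms of the
  definition.\<close>

lemma continuous_on_divergence:
  assumes p: "p \<in> hyp_space" and e: "0 < e"
  shows "continuous_on S (divergence p e)"
proof (rule continuous_on_S_chartI)
  fix c assume c: "c \<in> \<A>"
  have W: "area_density (in_chart F c) y \<noteq> 0" if "y \<in> chart_image c" for y
    using area_density_pos[OF c that] by simp
  have "continuous_on (chart_image c) (\<lambda>y.
      (partial_deriv 1 (\<lambda>y. area_density (in_chart F c) y * grad_coeff p e c 1 y) y
      + partial_deriv 2 (\<lambda>y. area_density (in_chart F c) y * grad_coeff p e c 2 y) y) / area_density (in_chart F c) y)"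
    by (intro continuous_on_divide continuous_on_add Ck1_continuous_partial[OF Ck1_grad_coeff[OF c p e]]
         continuous_on_area_density[OF c] ballI W)
  thus "continuous_on (chart_image c) (in_chart (divergence p e) c)"
  proof (rule continuous_on_eq)
    fix y assume y: "y \<in> chart_image c"
    show "(partial_deriv 1 (\<lambda>y. area_density (in_chart F c) y * grad_coeff p e c 1 y) y
      + partial_deriv 2 (\<lambda>y. area_density (in_chart F c) y * grad_coeff p e c 2 y) y) / area_density (in_chart F c) y
      = in_chart (divergence p e) c y"
      unfolding divergence_chart[OF c y p e] in_chart_apply[of "divergence p e"] using W[OF y] by simp
  qed
qed

lemma compact_chart_inv_image:
  assumes c: "c \<in> \<A>" and K: "compact K" "K \<subseteq> chart_image c"
  shows "compact (chart_inv c ` K)" "openin (top_of_set S) (S - chart_inv c ` K)"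
proof -
  have "continuous_on (chart_image c) (chart_inv c)"
    using chart_homeomorphism[OF c] by (simp add: homeomorphism_def)
  thus k: "compact (chart_inv c ` K)"
    by (intro compact_continuous_image[OF continuous_on_subset[OF _ K(2)] K(1)])
  hence "open (- (chart_inv c ` K))" by (simp add: compact_imp_closed open_Compl)
  moreover have "S - chart_inv c ` K = S \<inter> - (chart_inv c ` K)" by blast
  ultimately show "openin (top_of_set S) (S - chart_inv c ` K)" by (simp add: openin_open_Int)
qed

lemma partial_deriv_const_on_open:
  fixes f :: "real^2 \<Rightarrow> real"
  assumes "open U" "y \<in> U" "\<And>z. z \<in> U \<Longrightarrow> f z = k"
  shows "partial_deriv i f y = 0"
proof -
  have "(f has_derivative (\<lambda>_. 0)) (at y)"
    by (rule has_derivative_transform_within_open[OF has_derivative_const[of k] assms(1,2)]) (simp add: assms(3))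
  thus ?thesis by (rule partial_deriv_eqI)
qed

text \<open>The integrand is the divergence of \<open>h\<close> times the regularized field. With
  \<open>h\<close> supported inside one chart the integral becomes that of partial derivatives of
  compactly supported functions in the plane.\<close>

lemma integral_product_rule:
  assumes c: "c \<in> \<A>" and K: "compact K" "K \<subseteq> chart_image c" and p: "p \<in> hyp_space" and e: "0 < e"
    and h: "surf_C1 h" and h0: "\<And>x. x \<in> S - chart_inv c ` K \<Longrightarrow> h x = 0"
  shows "(\<integral>x. h x * divergence p e x + grad_pairing p e h x \<partial>area) = 0"
proof -
  let ?O = "chart_image c" and ?W = "area_density (in_chart F c)" and ?h = "in_chart h c"
  define V where "V i y = ?W y * grad_coeff p e c i y" for i y
  have V1: "Ck_on 1 ?O (V i)" for i
    unfolding V_def by (rule Ck1_grad_coeff[OF c p e])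
  have h1: "Ck_on 1 ?O ?h" by (rule surf_C1_D[OF h c])
  have hV: "Ck_on 1 ?O (\<lambda>y. ?h y * V i y)" for i by (rule Ck1_mult[OF h1 V1])
  have z: "?h y * V i y = 0" if "y \<in> ?O - K" for i y
  proof -
    have "chart_inv c y \<notin> chart_inv c ` K"
    proof
      assume "chart_inv c y \<in> chart_inv c ` K"
      then obtain z where "z \<in> K" "chart_inv c y = chart_inv c z" by blast
      hence "y = z" using chart_chart_inv[of y c] chart_chart_inv[of z c] that K(2) by auto
      thus False using \<open>z \<in> K\<close> that by simp
    qed
    thus ?thesis using h0 chart_inv_in_S[OF c] that by (simp add: in_chart_apply)
  qed
  note I = integral_partial_deriv_eq_0[OF open_chart_image[OF c] hV K z]
  have pd: "partial_deriv i (\<lambda>y. ?h y * V i y) y = ?h y * partial_deriv i (V i) y + partial_deriv i ?h y * V i y"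
    if "y \<in> ?O" for i y
    using partial_deriv_eqI[OF has_derivative_mult[OF Ck1_has_derivative[OF h1 that] Ck1_has_derivative[OF V1 that]]]
    by (simp add: partial_deriv_def)
  \<comment> \<open>Outside the domain of \<open>c\<close> the pairing is evaluated in the chart
    picked by \<open>chart_at\<close>. There \<open>h\<close> vanishes on a whole neighbourhood,
    since the support is compact and hence closed, so its partial derivatives vanish too.\<close>
  have out: "h x * divergence p e x + grad_pairing p e h x = 0" if x: "x \<in> S - fst c" for x
  proof -
    have x': "x \<in> S - chart_inv c ` K" using x K(2) chart_inv_in by blast
    let ?d = "chart_at \<A> x"
    have d: "?d \<in> \<A>" "x \<in> fst ?d" using chart_at x by auto
    have "partial_deriv i (in_chart h ?d) (snd ?d x) = 0" for i
    proof (rule partial_deriv_const_on_open)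
      show "open (snd ?d ` (fst ?d \<inter> (S - chart_inv c ` K)))"
        by (rule open_chart_overlap[OF d(1) compact_chart_inv_image(2)[OF c K]])
      show "snd ?d x \<in> snd ?d ` (fst ?d \<inter> (S - chart_inv c ` K))" using d(2) x' by blast
      fix z assume "z \<in> snd ?d ` (fst ?d \<inter> (S - chart_inv c ` K))"
      thus "in_chart h ?d z = 0" using h0 chart_inv_chart[OF d(1)] by (auto simp: in_chart_apply)
    qed
    thus ?thesis using h0[OF x'] by (simp add: grad_pairing_def chart_pairing_def)
  qed
  have cont: "continuous_on S (\<lambda>x. h x * divergence p e x + grad_pairing p e h x)"
    by (intro continuous_on_add continuous_on_mult surf_C1_continuous h continuous_on_divergence[OF p e]
         continuous_on_grad_pairing[OF h p e])
  have "(\<integral>x. h x * divergence p e x + grad_pairing p e h x \<partial>area) =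
    (\<integral>y. indicator ?O y * (?W y * (h (chart_inv c y) * divergence p e (chart_inv c y) + grad_pairing p e h (chart_inv c y))) \<partial>lborel)"
    by (rule integral_area_chart[OF c borel_measurable_continuous_on_restrict[OF cont] out])
  also have "\<dots> = (\<integral>y. indicator ?O y * partial_deriv 1 (\<lambda>y. ?h y * V 1 y) y
      + indicator ?O y * partial_deriv 2 (\<lambda>y. ?h y * V 2 y) y \<partial>lborel)"
  proof (rule Bochner_Integration.integral_cong[OF refl])
    fix y
    show "indicator ?O y * (?W y * (h (chart_inv c y) * divergence p e (chart_inv c y) + grad_pairing p e h (chart_inv c y)))
      = indicator ?O y * partial_deriv 1 (\<lambda>y. ?h y * V 1 y) y + indicator ?O y * partial_deriv 2 (\<lambda>y. ?h y * V 2 y) y"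
    proof (cases "y \<in> ?O")
      case y: True
      have g: "grad_pairing p e h (chart_inv c y) = chart_pairing p e h c y"
        unfolding grad_pairing_chart[OF c chart_inv_in[OF y] h] chart_chart_inv[OF y] ..
      have dv: "partial_deriv 1 (V 1) y + partial_deriv 2 (V 2) y = ?W y * divergence p e (chart_inv c y)"
        using divergence_chart[OF c y p e] unfolding V_def[abs_def] .
      have "?W y * (h (chart_inv c y) * divergence p e (chart_inv c y)) = ?h y * (partial_deriv 1 (V 1) y + partial_deriv 2 (V 2) y)"
        unfolding dv in_chart_apply by (simp only: mult.left_commute)
      thus ?thesis using y unfolding pd[OF y] g chart_pairing_def V_def[of 1 y] V_def[of 2 y]
        by (simp add: algebra_simps)
    qed simp
  qed
  also have "\<dots> = 0" using I by simp
  finally show ?thesis .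
qed

section \<open>A C^1 partition of unity supported in charts\<close>

definition bump :: "'m chart \<Rightarrow> real^2 \<Rightarrow> real \<Rightarrow> 'm \<Rightarrow> real" where
  "bump c y0 r x = (if x \<in> fst c then (max 0 (r\<^sup>2 - (snd c x - y0) \<bullet> (snd c x - y0)))\<^sup>2 else 0)"

lemma bump_nonneg: "0 \<le> bump c y0 r x"
  by (simp add: bump_def)

lemma bump_eq_0:
  assumes c: "c \<in> \<A>" and r: "0 < r" and x: "x \<in> S - chart_inv c ` cball y0 r"
  shows "bump c y0 r x = 0"
proof (cases "x \<in> fst c")
  case True
  have "snd c x \<notin> cball y0 r"
  proof
    assume "snd c x \<in> cball y0 r"
    hence "chart_inv c (snd c x) \<in> chart_inv c ` cball y0 r" by (rule imageI)
    thus False using x chart_inv_chart[OF c True] by simp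
  qed
  hence "r < norm (snd c x - y0)" by (simp add: dist_norm norm_minus_commute)
  hence "r\<^sup>2 \<le> (norm (snd c x - y0))\<^sup>2" using r by (intro power_mono) auto
  thus ?thesis by (simp add: bump_def power2_norm_eq_inner max_def)
qed (simp add: bump_def)

lemma bump_pos:
  assumes c: "c \<in> \<A>" and y: "y \<in> ball y0 r" "ball y0 r \<subseteq> chart_image c"
  shows "0 < bump c y0 r (chart_inv c y)"
proof -
  have yc: "y \<in> chart_image c" using y by blast
  have "norm (y - y0) < r" using y(1) by (simp add: dist_norm norm_minus_commute)
  hence "(norm (y - y0))\<^sup>2 < r\<^sup>2" by (intro power_strict_mono) auto
  thus ?thesis by (simp add: bump_def chart_inv_in[OF yc] chart_chart_inv[OF yc] power2_norm_eq_inner max_def)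
qed

text \<open>Any other chart image is the union of two open sets: the overlap with \<open>c\<close>,
  where the transition map gives class C^1, and the complement of the compact support, where the
  function is 0. Closedness of the support uses that the surface is Hausdorff.\<close>

lemma surf_C1_bump:
  assumes c: "c \<in> \<A>" and r: "0 < r" "cball y0 r \<subseteq> chart_image c"
  shows "surf_C1 (bump c y0 r)"
  unfolding surf_C1_def
proof
  fix d assume d: "d \<in> \<A>"
  let ?P = "snd d ` (fst d \<inter> fst c)" and ?Q = "snd d ` (fst d \<inter> (S - chart_inv c ` cball y0 r))"
  have oP: "open ?P" by (rule open_chart_overlap[OF d chart_openin[OF c]])
  have oQ: "open ?Q" by (rule open_chart_overlap[OF d compact_chart_inv_image(2)[OF c compact_cball r(2)]])
  have T: "Ck_on 1 ?P (\<lambda>y. transition d c y - y0)"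
    by (rule Ck1_diff[OF smooth_on_Ck1[OF smooth_transition[OF d c]] Ck1_const])
  have "Ck_on 1 ?P (\<lambda>y. r\<^sup>2 - (transition d c y - y0) \<bullet> (transition d c y - y0))"
    by (intro Ck1_diff Ck1_const Ck1_bilinear[OF bounded_bilinear_inner] T)
  hence 1: "Ck_on 1 ?P (\<lambda>y. (max 0 (r\<^sup>2 - (transition d c y - y0) \<bullet> (transition d c y - y0)))\<^sup>2)"
  proof (rule Ck1_compose_real)
    show "continuous_on ?P (\<lambda>y. 2 * max 0 (r\<^sup>2 - (transition d c y - y0) \<bullet> (transition d c y - y0)))"
      by (intro continuous_on_mult continuous_on_const continuous_on_max continuous_on_diff continuous_on_inner Ck1_continuous[OF T]
          Ck1_continuous[OF smooth_on_Ck1[OF smooth_transition[OF d c]]])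
  qed (rule DERIV_max_0_square)
  have "Ck_on 1 ?P (in_chart (bump c y0 r) d)"
    by (rule Ck1_cong[OF oP _ 1]) (auto simp: in_chart_apply chart_inv_chart[OF d] bump_def transition_def)
  moreover have "Ck_on 1 ?Q (in_chart (bump c y0 r) d)"
    by (rule Ck1_cong[OF oQ _ Ck1_const[of _ 0]])
       (auto simp: in_chart_apply chart_inv_chart[OF d] bump_eq_0[OF c r(1)])
  ultimately have "Ck_on 1 (?P \<union> ?Q) (in_chart (bump c y0 r) d)" by (rule Ck1_Un[OF oP oQ])
  moreover have "?P \<union> ?Q = chart_image d"
  proof -
    have "fst d = (fst d \<inter> fst c) \<union> (fst d \<inter> (S - chart_inv c ` cball y0 r))"
      using chart_subset[OF d] r(2) chart_inv_in by blast
    thus ?thesis unfolding chart_image_def image_Un[symmetric] by simp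
  qed
  ultimately show "Ck_on 1 (chart_image d) (in_chart (bump c y0 r) d)" by simp
qed

text \<open>Each point gets a bump around it in its own chart. By compactness finitely many of them
  have a positive sum, and dividing by this sum normalizes. The index set \<open>I\<close> consists
  of the chosen centres, hence its type.\<close>

lemma partition_of_unity:
  "\<exists>I :: 'm set. \<exists>h c K. finite I \<and> (\<forall>i\<in>I. surf_C1 (h i) \<and> c i \<in> \<A> \<and> compact (K i) \<and> K i \<subseteq> chart_image (c i) \<and>
      (\<forall>x\<in>S - chart_inv (c i) ` K i. h i x = 0)) \<and> (\<forall>x\<in>S. (\<Sum>i\<in>I. h i x) = 1)"
proof -
  have "\<exists>r>0. cball (snd (chart_at \<A> x) x) r \<subseteq> chart_image (chart_at \<A> x)" if "x \<in> S" for x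
    using open_chart_image[OF chart_at(1)[OF that]] in_chart_image[OF chart_at(2)[OF that]]
    unfolding open_contains_cball by (rule bspec)
  then obtain r where r: "\<And>x. x \<in> S \<Longrightarrow> 0 < r x"
    "\<And>x. x \<in> S \<Longrightarrow> cball (snd (chart_at \<A> x) x) (r x) \<subseteq> chart_image (chart_at \<A> x)" by metis
  define c where "c x = chart_at \<A> x" for x
  define y0 where "y0 x = snd (c x) x" for x
  have c: "c x \<in> \<A>" "x \<in> fst (c x)" if "x \<in> S" for x using chart_at[OF that] by (simp_all add: c_def)
  have rc: "cball (y0 x) (r x) \<subseteq> chart_image (c x)" if "x \<in> S" for x using r(2)[OF that] by (simp add: c_def y0_def)
  have rb: "ball (y0 x) (r x) \<subseteq> chart_image (c x)" if "x \<in> S" for x using rc[OF that] ball_subset_cball by blast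
  define U where "U x = chart_inv (c x) ` ball (y0 x) (r x)" for x
  have oU: "openin (top_of_set S) (U x)" if "x \<in> S" for x
    unfolding U_def by (rule openin_chart_inv_image[OF c(1)[OF that] open_ball rb[OF that]])
  have xU: "x \<in> U x" if "x \<in> S" for x
    unfolding U_def using chart_inv_chart[OF c[OF that]] r(1)[OF that] y0_def by (metis centre_in_ball image_eqI)
  have o: "\<forall>V\<in>U ` S. openin (top_of_set S) V" using oU by blast
  have cov: "S \<subseteq> \<Union>(U ` S)" using xU by blast
  have "(\<forall>V\<in>U ` S. openin (top_of_set S) V) \<and> S \<subseteq> \<Union>(U ` S) \<longrightarrow> (\<exists>D\<subseteq>U ` S. finite D \<and> S \<subseteq> \<Union>D)"
    using iffD1[OF compact_eq_openin_cover compact_S] by (rule spec)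
  from mp[OF this conjI[OF o cov]]
  obtain D where D: "D \<subseteq> U ` S" "finite D" "S \<subseteq> \<Union>D" by (elim exE conjE)
  obtain I where I: "I \<subseteq> S" "finite I" "D = U ` I" using finite_subset_image[OF D(2,1)] by (elim exE conjE)
  define b where "b i = bump (c i) (y0 i) (r i)" for i
  define B where "B x = (\<Sum>i\<in>I. b i x)" for x
  have Bpos: "0 < B x" if x: "x \<in> S" for x
  proof -
    obtain i where i: "i \<in> I" "x \<in> U i" using D(3) I(3) x by blast
    have iS: "i \<in> S" using i I by blast
    obtain y where y: "y \<in> ball (y0 i) (r i)" "x = chart_inv (c i) y" using i(2) unfolding U_def by blast
    have "0 < b i x" unfolding b_def y(2) by (rule bump_pos[OF c(1)[OF iS] y(1) rb[OF iS]])
    thus ?thesis unfolding B_def using i(1) I(2) bump_nonneg by (intro sum_pos2[of _ i]) (auto simp: b_def)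
  qed
  have bC: "surf_C1 (b i)" if "i \<in> I" for i
    unfolding b_def using that I(1) by (intro surf_C1_bump c r rc) auto
  have hC: "surf_C1 (\<lambda>x. b i x / B x)" if i: "i \<in> I" for i
    unfolding surf_C1_def
  proof
    fix d assume d: "d \<in> \<A>"
    have "Ck_on 1 (chart_image d) (\<lambda>y. \<Sum>i\<in>I. in_chart (b i) d y)"
      by (rule Ck1_sum) (rule surf_C1_D[OF bC d])
    hence "Ck_on 1 (chart_image d) (\<lambda>y. in_chart (b i) d y / (\<Sum>i\<in>I. in_chart (b i) d y))"
    proof (rule Ck1_divide[OF surf_C1_D[OF bC[OF i] d]])
      fix y assume "y \<in> chart_image d"
      thus "(\<Sum>i\<in>I. in_chart (b i) d y) \<noteq> 0"
        using Bpos[OF chart_inv_in_S[OF d, of y]] by (simp add: B_def in_chart_apply)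
    qed
    moreover have "(\<lambda>y. in_chart (b i) d y / (\<Sum>i\<in>I. in_chart (b i) d y)) = in_chart (\<lambda>x. b i x / B x) d"
      by (simp add: fun_eq_iff in_chart_apply B_def)
    ultimately show "Ck_on 1 (chart_image d) (in_chart (\<lambda>x. b i x / B x) d)" by simp
  qed
  have "(\<Sum>i\<in>I. b i x / B x) = 1" if "x \<in> S" for x
    using Bpos[OF that] unfolding sum_divide_distrib[symmetric] B_def[symmetric] by simp
  moreover have "b i x / B x = 0" if "i \<in> I" "x \<in> S - chart_inv (c i) ` cball (y0 i) (r i)" for i x
    using bump_eq_0[OF c(1) r(1) that(2)] that(1) I(1) by (auto simp: b_def)
  ultimately show ?thesis using I hC c(1) rc
    by (intro exI[of _ I] exI[of _ "\<lambda>i x. b i x / B x"] exI[of _ c] exI[of _ "\<lambda>i. cball (y0 i) (r i)"])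
       (simp add: subset_iff)
qed

text \<open>The product rule is summed over the partition of unity. The derivatives of the cutoff
  functions cancel because their sum is constant, which leaves the divergence alone.\<close>

theorem integral_divergence_eq_0:
  assumes p: "p \<in> hyp_space" and e: "0 < e"
  shows "(\<integral>x. divergence p e x \<partial>area) = 0"
proof -
  from partition_of_unity obtain I :: "'m set" and h c K where I: "finite I"
    and hcK: "\<forall>i\<in>I. surf_C1 (h i) \<and> c i \<in> \<A> \<and> compact (K i) \<and> K i \<subseteq> chart_image (c i) \<and>
      (\<forall>x\<in>S - chart_inv (c i) ` K i. h i x = 0)"
    and sum1: "\<forall>x\<in>S. (\<Sum>i\<in>I. h i x) = 1" by (elim exE conjE)
  have h: "surf_C1 (h i)" and c: "c i \<in> \<A>" and K: "compact (K i)" "K i \<subseteq> chart_image (c i)" if "i \<in> I" for i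
    using bspec[OF hcK that] by simp_all
  have z: "h i x = 0" if "i \<in> I" "x \<in> S - chart_inv (c i) ` K i" for i x
    using bspec[OF hcK that(1)] that(2) by simp
  have one: "(\<Sum>i\<in>I. h i x) = 1" if "x \<in> S" for x using sum1 that by simp
  have g0: "(\<Sum>i\<in>I. grad_pairing p e (h i) x) = 0" if x: "x \<in> S" for x
  proof -
    let ?d = "chart_at \<A> x"
    have d: "?d \<in> \<A>" "x \<in> fst ?d" using chart_at[OF x] .
    have y: "snd ?d x \<in> chart_image ?d" by (rule in_chart_image[OF d(2)])
    have s: "(\<Sum>i\<in>I. partial_deriv j (in_chart (h i) ?d) (snd ?d x)) = 0" for j
    proof -
      have "((\<lambda>y. \<Sum>i\<in>I. in_chart (h i) ?d y) has_derivative
          (\<lambda>v. \<Sum>i\<in>I. frechet_derivative (in_chart (h i) ?d) (at (snd ?d x)) v)) (at (snd ?d x))"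
        by (rule has_derivative_sum) (rule Ck1_has_derivative[OF surf_C1_D[OF h d(1)] y])
      from partial_deriv_eqI[OF this, of j]
      have "(\<Sum>i\<in>I. partial_deriv j (in_chart (h i) ?d) (snd ?d x)) = partial_deriv j (\<lambda>y. \<Sum>i\<in>I. in_chart (h i) ?d y) (snd ?d x)"
        by (simp add: partial_deriv_def)
      also have "\<dots> = 0"
        by (rule partial_deriv_const_on_open[OF open_chart_image[OF d(1)] y, of _ 1])
           (simp add: in_chart_apply one chart_inv_in_S[OF d(1)])
      finally show ?thesis .
    qed
    show ?thesis
      unfolding grad_pairing_def chart_pairing_def sum.distrib sum_distrib_left[symmetric] s by simp
  qed
  have int: "integrable area (\<lambda>x. h i x * divergence p e x + grad_pairing p e (h i) x)" if i: "i \<in> I" for i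
    by (intro integrable_area_continuous continuous_on_add continuous_on_mult surf_C1_continuous h[OF i]
        continuous_on_divergence[OF p e] continuous_on_grad_pairing[OF h[OF i] p e])
  have "(\<integral>x. divergence p e x \<partial>area) = (\<integral>x. (\<Sum>i\<in>I. h i x * divergence p e x + grad_pairing p e (h i) x) \<partial>area)"
  proof (rule Bochner_Integration.integral_cong[OF refl])
    fix x assume "x \<in> space area"
    hence "x \<in> S" by (simp add: space_area)
    thus "divergence p e x = (\<Sum>i\<in>I. h i x * divergence p e x + grad_pairing p e (h i) x)"
      by (simp add: sum.distrib g0 one flip: sum_distrib_right)
  qed
  also have "\<dots> = (\<Sum>i\<in>I. \<integral>x. h i x * divergence p e x + grad_pairing p e (h i) x \<partial>area)"
    by (rule Bochner_Integration.integral_sum) (rule int)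
  also have "\<dots> = 0"
    by (rule sum.neutral, rule ballI, rule integral_product_rule[OF c K p e h z])
  finally show ?thesis .
qed

end

section \<open>Concentration at the preimages of \<open>p\<close>\<close>

lemma onorm_frechet_le_partials:
  fixes g :: "real^2 \<Rightarrow> 'b::real_normed_vector"
  assumes "norm (a1 :: 'b) \<le> B1" "norm a2 \<le> B2"
  shows "norm ((h $ 1) *\<^sub>R a1 + (h $ 2) *\<^sub>R a2) \<le> (B1 + B2) * norm (h :: real^2)"
proof -
  have "norm ((h $ 1) *\<^sub>R a1 + (h $ 2) *\<^sub>R a2) \<le> \<bar>h $ 1\<bar> * norm a1 + \<bar>h $ 2\<bar> * norm a2"
    by (rule order_trans[OF norm_triangle_ineq]) simp
  also have "\<dots> \<le> norm h * B1 + norm h * B2"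
    using assms component_le_norm_cart[of h] by (intro add_mono mult_mono) auto
  finally show ?thesis by (simp add: algebra_simps)
qed

lemma smooth_on_lipschitz:
  fixes g :: "real^2 \<Rightarrow> 'b::real_normed_vector"
  assumes g: "smooth_on U g" and r: "cball y0 r \<subseteq> U"
  shows "\<exists>L\<ge>0. \<forall>y\<in>cball y0 r. \<forall>z\<in>cball y0 r. norm (g y - g z) \<le> L * norm (y - z)"
proof -
  have "\<exists>B. \<forall>y\<in>cball y0 r. norm (partial_deriv i g y) \<le> B" for i
  proof -
    have "compact (partial_deriv i g ` cball y0 r)"
      by (rule compact_continuous_image[OF continuous_on_subset[OF smooth_on_imp_continuous_on[OF smooth_on_partial_deriv[OF g]] r] compact_cball])
    from compact_imp_bounded[OF this] show ?thesis unfolding bounded_iff by blast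
  qed
  then obtain B where B: "\<And>i y. y \<in> cball y0 r \<Longrightarrow> norm (partial_deriv i g y) \<le> B i" by metis
  define L where "L = \<bar>B 1 + B 2\<bar>"
  have "norm (g y - g z) \<le> L * norm (y - z)" if "y \<in> cball y0 r" "z \<in> cball y0 r" for y z
  proof (rule differentiable_bound[OF convex_cball[of y0 r] _ _ that])
    fix x assume x: "x \<in> cball y0 r"
    have d: "g differentiable (at x)" using smooth_on_imp_differentiable[OF g] x r by blast
    thus "(g has_derivative frechet_derivative g (at x)) (at x within cball y0 r)"
      unfolding frechet_derivative_works by (rule has_derivative_at_withinI)
    show "onorm (frechet_derivative g (at x)) \<le> L"
    proof (rule onorm_le)
      fix h :: "real^2"
      have "norm (frechet_derivative g (at x) h) \<le> (B 1 + B 2) * norm h"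
        unfolding frechet_derivative_apply_partial[OF d] by (rule onorm_frechet_le_partials[OF B[OF x] B[OF x]])
      also have "\<dots> \<le> L * norm h" unfolding L_def by (rule mult_right_mono) auto
      finally show "norm (frechet_derivative g (at x) h) \<le> L * norm h" .
    qed
  qed
  moreover have "L \<ge> 0" by (simp add: L_def)
  ultimately show ?thesis by blast
qed

text \<open>The function minus its linear part at \<open>y\<close> has a derivative of size O(|z -
  y|) on the segment from \<open>y\<close> to \<open>z\<close>, since the partial derivatives are
  Lipschitz. The base point \<open>y\<close> is left free: the expansion is used both at a preimage
  and from nearby points back to it.\<close>

lemma smooth_on_taylor:
  fixes g :: "real^2 \<Rightarrow> 'b::real_normed_vector"
  assumes g: "smooth_on U g" and r: "cball y0 r \<subseteq> U"
  shows "\<exists>C\<ge>0. \<forall>y\<in>cball y0 r. \<forall>z\<in>cball y0 r.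
    norm (g z - g y - frechet_derivative g (at y) (z - y)) \<le> C * (norm (z - y))\<^sup>2"
proof -
  have "\<exists>L\<ge>0. \<forall>y\<in>cball y0 r. \<forall>z\<in>cball y0 r. norm (partial_deriv i g y - partial_deriv i g z) \<le> L * norm (y - z)" for i
    by (rule smooth_on_lipschitz[OF smooth_on_partial_deriv[OF g] r])
  then obtain L where L: "\<And>i. 0 \<le> L i" "\<And>i y z. y \<in> cball y0 r \<Longrightarrow> z \<in> cball y0 r \<Longrightarrow>
      norm (partial_deriv i g y - partial_deriv i g z) \<le> L i * norm (y - z)" by metis
  define C where "C = L 1 + L 2"
  have C0: "C \<ge> 0" using L(1) by (simp add: C_def)
  have d: "g differentiable (at x)" if "x \<in> cball y0 r" for x
    using smooth_on_imp_differentiable[OF g] that r by blast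
  have "norm (g z - g y - frechet_derivative g (at y) (z - y)) \<le> C * (norm (z - y))\<^sup>2"
    if y: "y \<in> cball y0 r" and z: "z \<in> cball y0 r" for y z
  proof -
    define k where "k v = g v - frechet_derivative g (at y) v" for v
    have lin: "linear (frechet_derivative g (at y))"
      using d[OF y] unfolding frechet_derivative_works by (rule has_derivative_linear)
    have bl: "bounded_linear (frechet_derivative g (at y))"
      using d[OF y] unfolding frechet_derivative_works by (rule has_derivative_bounded_linear)
    have seg: "closed_segment y z \<subseteq> cball y0 r"
      by (rule closed_segment_subset[OF y z convex_cball])
    have "norm (k z - k y) \<le> (C * norm (z - y)) * norm (z - y)"
    proof (rule differentiable_bound[OF convex_closed_segment[of y z]])
      fix x assume x: "x \<in> closed_segment y z"
      hence xr: "x \<in> cball y0 r" using seg by blast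
      have "(g has_derivative frechet_derivative g (at x)) (at x within closed_segment y z)"
        using d[OF xr] unfolding frechet_derivative_works by (rule has_derivative_at_withinI)
      thus "(k has_derivative (\<lambda>h. frechet_derivative g (at x) h - frechet_derivative g (at y) h)) (at x within closed_segment y z)"
        unfolding k_def by (intro has_derivative_diff bounded_linear_imp_has_derivative bl)
      show "onorm (\<lambda>h. frechet_derivative g (at x) h - frechet_derivative g (at y) h) \<le> C * norm (z - y)"
      proof (rule onorm_le)
        fix h :: "real^2"
        have "frechet_derivative g (at x) h - frechet_derivative g (at y) h
          = (h $ 1) *\<^sub>R (partial_deriv 1 g x - partial_deriv 1 g y) + (h $ 2) *\<^sub>R (partial_deriv 2 g x - partial_deriv 2 g y)"
          unfolding frechet_derivative_apply_partial[OF d[OF xr]] frechet_derivative_apply_partial[OF d[OF y]]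
          by (simp add: algebra_simps)
        hence "norm (frechet_derivative g (at x) h - frechet_derivative g (at y) h) \<le> (L 1 * norm (x - y) + L 2 * norm (x - y)) * norm h"
          using onorm_frechet_le_partials[OF L(2)[OF xr y, of 1] L(2)[OF xr y, of 2], of h] by simp
        also have "\<dots> = (C * norm (x - y)) * norm h" by (simp add: C_def algebra_simps)
        also have "\<dots> \<le> (C * norm (z - y)) * norm h"
          using segment_bound(1)[OF x] C0 by (intro mult_right_mono mult_left_mono) (auto simp: norm_minus_commute)
        finally show "norm (frechet_derivative g (at x) h - frechet_derivative g (at y) h) \<le> C * norm (z - y) * norm h" .
      qed
    qed auto
    thus ?thesis by (simp add: k_def linear_diff[OF lin] power2_eq_square algebra_simps)
  qed
  with C0 show ?thesis by blast
qed

section \<open>The model integral in the plane\<close>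

lemma measure_linear_sublevel:
  fixes A :: "real^2 \<Rightarrow> real^2"
  assumes A: "linear A" "det (matrix A) \<noteq> 0" and t: "0 \<le> t"
  shows "emeasure lborel {z. norm (A z) \<le> t} = ennreal (pi * t\<^sup>2 / \<bar>det (matrix A)\<bar>)"
proof -
  let ?Z = "{z. norm (A z) \<le> t}"
  have inj: "inj A" using A by (simp add: det_nz_iff_inj)
  have surj: "surj A" using linear_injective_imp_surjective[OF A(1) inj] by simp
  have cA: "continuous_on UNIV A" using A(1) by (simp add: linear_continuous_on linear_linear)
  have closed: "closed ?Z"
    using continuous_closed_vimage[of "cball 0 t" A] cA
    by (simp add: vimage_def continuous_on_eq_continuous_at)
  obtain B where B: "B > 0" "\<And>x. B * norm x \<le> norm (A x)"
    using linear_inj_bounded_below_pos[OF A(1) inj] by blast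
  have "norm z \<le> t / B" if "z \<in> ?Z" for z
    using B(1) order_trans[OF B(2)[of z], of t] that by (simp add: pos_le_divide_eq mult.commute)
  hence "bounded ?Z" unfolding bounded_iff by blast
  hence comp: "compact ?Z" using closed by (simp add: compact_eq_bounded_closed)
  have im: "A ` ?Z = cball 0 t"
  proof (intro equalityI subsetI)
    fix v :: "real^2" assume "v \<in> cball 0 t"
    moreover obtain z where "v = A z" using surj by blast
    ultimately show "v \<in> A ` ?Z" by simp
  qed auto
  have lm: "?Z \<in> lmeasurable" using comp by (rule lmeasurable_compact)
  have "\<bar>det (matrix A)\<bar> * measure lebesgue ?Z = measure lebesgue (cball 0 t :: (real^2) set)"
    using measure_linear_image[OF A(1) lm] unfolding im by simp
  also have "\<dots> = pi * t\<^sup>2" using content_cball[OF t, of "0::real^2"] by (simp add: unit_ball_vol_2)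
  finally have m: "measure lebesgue ?Z = pi * t\<^sup>2 / \<bar>det (matrix A)\<bar>" using A(2) by (simp add: field_simps)
  have "emeasure lborel ?Z = ennreal (measure lborel ?Z)"
    by (rule emeasure_eq_ennreal_measure) (use emeasure_compact_finite[OF comp] in auto)
  thus ?thesis using m closed by simp
qed

text \<open>Layer-cake formula: the sublevel sets of the quadratic form are ellipses of known area.\<close>

lemma nn_integral_inverse_square_quadratic:
  fixes A :: "real^2 \<Rightarrow> real^2"
  assumes A: "linear A" "det (matrix A) \<noteq> 0"
  shows "(\<integral>\<^sup>+z. ennreal (1 / (1 + (norm (A z))\<^sup>2 / 2)\<^sup>2) \<partial>lborel) = ennreal (2 * pi / \<bar>det (matrix A)\<bar>)"
proof -
  have tail: "((\<lambda>x::real. - (inverse (1 + x))\<^sup>2) \<longlongrightarrow> 0) at_top"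
  proof -
    have "((\<lambda>x::real. inverse (1 + x)) \<longlongrightarrow> 0) at_top"
      by (intro tendsto_inverse_0_at_top filterlim_tendsto_add_at_top[OF tendsto_const] filterlim_ident)
    from tendsto_minus[OF tendsto_power[OF this, of 2]] show ?thesis by simp
  qed
  \<comment> \<open>The weight \<open>2 / (1 + t) ^ 3\<close> is minus the derivative of 1 / (1 +
    t)^2, so its integral over \<open>t\<close> \<ge> \<open>s\<close> is the value at
    \<open>s\<close>. Exchanging integrals then leaves only areas of sublevel sets.\<close>
  have layer: "ennreal (1 / (1 + s)\<^sup>2) = (\<integral>\<^sup>+t. ennreal (2 / (1 + t) ^ 3) * indicator {s..} t \<partial>lborel)" if s: "0 \<le> s" for s :: real
  proof -
    have "(\<integral>\<^sup>+t. ennreal (2 / (1 + t) ^ 3) * indicator {s..} t \<partial>lborel) = ennreal (0 - (- (inverse (1 + s))\<^sup>2))"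
    proof (rule nn_integral_FTC_atLeast)
      show "((\<lambda>x::real. - (inverse (1 + x))\<^sup>2) has_real_derivative 2 / (1 + x) ^ 3) (at x)" if "s \<le> x" for x
      proof -
        have x1: "1 + x \<noteq> 0" using s that by simp
        have "((\<lambda>x. inverse (1 + x)) has_real_derivative - (inverse (1 + x) * (0 + 1) * inverse (1 + x))) (at x)"
          by (rule DERIV_inverse'[OF DERIV_add[OF DERIV_const DERIV_ident] x1])
        from DERIV_minus[OF DERIV_power[OF this, of 2]]
        show ?thesis by (rule DERIV_cong) (simp add: power3_eq_cube divide_inverse)
      qed
    qed (use s tail in auto)
    thus ?thesis by (simp add: inverse_eq_divide power_divide)
  qed
  have cA: "continuous_on UNIV A" using A(1) by (simp add: linear_continuous_on linear_linear)
  have mA [measurable]: "A \<in> borel_measurable borel" by (rule borel_measurable_continuous_onI[OF cA])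
  have "(\<integral>\<^sup>+z. ennreal (1 / (1 + (norm (A z))\<^sup>2 / 2)\<^sup>2) \<partial>lborel)
    = (\<integral>\<^sup>+z. (\<integral>\<^sup>+t. ennreal (2 / (1 + t) ^ 3) * indicator {(norm (A z))\<^sup>2 / 2..} t \<partial>lborel) \<partial>lborel)"
    by (intro nn_integral_cong layer) simp
  also have "\<dots> = (\<integral>\<^sup>+t. (\<integral>\<^sup>+z. ennreal (2 / (1 + t) ^ 3) * indicator {(norm (A z))\<^sup>2 / 2..} t \<partial>lborel) \<partial>lborel)"
  proof (rule lborel_pair.Fubini')
    have m: "(\<lambda>x. ennreal (2 / (1 + fst x) ^ 3) * indicator {x :: real \<times> (real^2). (norm (A (snd x)))\<^sup>2 / 2 \<le> fst x} x)
      \<in> borel_measurable (lborel \<Otimes>\<^sub>M lborel)"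
      by measurable
    have eq: "(\<lambda>x. ennreal (2 / (1 + fst x) ^ 3) * indicator {x :: real \<times> (real^2). (norm (A (snd x)))\<^sup>2 / 2 \<le> fst x} x)
      = (\<lambda>(t, z). ennreal (2 / (1 + t) ^ 3) * indicator {(norm (A z))\<^sup>2 / 2..} t)"
      by (auto simp: fun_eq_iff indicator_def)
    show "(\<lambda>(t, z). ennreal (2 / (1 + t) ^ 3) * indicator {(norm (A z))\<^sup>2 / 2..} t)
      \<in> borel_measurable (lborel \<Otimes>\<^sub>M lborel)" using m unfolding eq .
  qed
  also have "\<dots> = (\<integral>\<^sup>+t. ennreal (4 * pi / \<bar>det (matrix A)\<bar> * (t / (1 + t) ^ 3)) * indicator {0..} t \<partial>lborel)"
  proof (rule nn_integral_cong)
    fix t :: real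
    let ?Z = "{z. norm (A z) \<le> sqrt (2 * t)}"
    show "(\<integral>\<^sup>+z. ennreal (2 / (1 + t) ^ 3) * indicator {(norm (A z))\<^sup>2 / 2..} t \<partial>lborel)
      = ennreal (4 * pi / \<bar>det (matrix A)\<bar> * (t / (1 + t) ^ 3)) * indicator {0..} t"
    proof (cases "0 \<le> t")
      case True
      have "(norm (A z))\<^sup>2 / 2 \<le> t \<longleftrightarrow> z \<in> ?Z" for z
        using real_le_rsqrt[of "norm (A z)" "2 * t"] real_sqrt_le_iff[of "(norm (A z))\<^sup>2" "2 * t"] by auto
      hence "(\<integral>\<^sup>+z. ennreal (2 / (1 + t) ^ 3) * indicator {(norm (A z))\<^sup>2 / 2..} t \<partial>lborel)
        = (\<integral>\<^sup>+z. ennreal (2 / (1 + t) ^ 3) * indicator ?Z z \<partial>lborel)"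
        by (intro nn_integral_cong) (simp add: indicator_def)
      also have "\<dots> = ennreal (2 / (1 + t) ^ 3) * emeasure lborel ?Z"
        by (rule nn_integral_cmult_indicator) measurable
      also have "\<dots> = ennreal (2 / (1 + t) ^ 3 * (pi * (2 * t) / \<bar>det (matrix A)\<bar>))"
        using True by (simp add: measure_linear_sublevel[OF A] ennreal_mult[symmetric])
      finally show ?thesis using True by (simp add: mult_ac)
    next
      case False
      moreover have "\<not> (norm (A z))\<^sup>2 / 2 \<le> t" for z using False by (smt (verit) zero_le_power2 divide_nonneg_pos)
      ultimately show ?thesis by (simp add: indicator_def)
    qed
  qed
  also have "\<dots> = ennreal (2 * pi / \<bar>det (matrix A)\<bar> - 0)"
  \<comment> \<open>The ellipse at level \<open>t\<close> has area 2 pi t / |det A|; the resulting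
    integrand is a multiple of 2 t / (1 + t)^3, the derivative of (t / (1 + t))^2, which runs from 0
    to 1.\<close>
  proof (rule nn_integral_FTC_atLeast[where a = 0 and F = "\<lambda>t. 2 * pi / \<bar>det (matrix A)\<bar> * (t / (1 + t))\<^sup>2", THEN trans])
    show "((\<lambda>t. 2 * pi / \<bar>det (matrix A)\<bar> * (t / (1 + t))\<^sup>2) has_real_derivative 4 * pi / \<bar>det (matrix A)\<bar> * (x / (1 + x) ^ 3)) (at x)"
      if "0 \<le> x" for x
    proof -
      have x1: "1 + x \<noteq> 0" using that by simp
      have "((\<lambda>t. t / (1 + t)) has_real_derivative (1 * (1 + x) - x * (0 + 1)) / ((1 + x) * (1 + x))) (at x)"
        by (rule DERIV_divide[OF DERIV_ident DERIV_add[OF DERIV_const DERIV_ident] x1])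
      hence "((\<lambda>t. t / (1 + t)) has_real_derivative 1 / ((1 + x) * (1 + x))) (at x)" by simp
      from DERIV_cmult[OF DERIV_power[OF this, of 2], of "2 * pi / \<bar>det (matrix A)\<bar>"]
      show ?thesis by (rule DERIV_cong) (simp add: power3_eq_cube power2_eq_square)
    qed
    have "((\<lambda>t::real. 1 - 1 / (1 + t)) \<longlongrightarrow> 1 - 0) at_top"
      by (intro tendsto_diff tendsto_const real_tendsto_divide_at_top[OF tendsto_const]
          filterlim_tendsto_add_at_top[OF tendsto_const] filterlim_ident)
    moreover have "eventually (\<lambda>t::real. 1 - 1 / (1 + t) = t / (1 + t)) at_top"
      using eventually_ge_at_top[of 0] by eventually_elim (simp add: field_simps)
    ultimately have "((\<lambda>t::real. t / (1 + t)) \<longlongrightarrow> 1) at_top" by (simp add: tendsto_cong)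
    from tendsto_mult[OF tendsto_const tendsto_power[OF this, of 2], of "2 * pi / \<bar>det (matrix A)\<bar>"]
    show "((\<lambda>t. 2 * pi / \<bar>det (matrix A)\<bar> * (t / (1 + t))\<^sup>2) \<longlongrightarrow> 2 * pi / \<bar>det (matrix A)\<bar>) at_top"
      unfolding power_one mult_1_right .
  qed auto
  finally show ?thesis by simp
qed

lemma
  fixes A :: "real^2 \<Rightarrow> real^2"
  assumes A: "linear A" "det (matrix A) \<noteq> 0"
  shows integrable_inverse_square_quadratic: "integrable lborel (\<lambda>z. 1 / (1 + (norm (A z))\<^sup>2 / 2)\<^sup>2)"
    and integral_inverse_square_quadratic:
      "(\<integral>z. 1 / (1 + (norm (A z))\<^sup>2 / 2)\<^sup>2 \<partial>lborel) = 2 * pi / \<bar>det (matrix A)\<bar>"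
proof -
  have cA: "continuous_on UNIV A" using A(1) by (simp add: linear_continuous_on linear_linear)
  have mA [measurable]: "A \<in> borel_measurable borel" by (rule borel_measurable_continuous_onI[OF cA])
  have "has_bochner_integral lborel (\<lambda>z. 1 / (1 + (norm (A z))\<^sup>2 / 2)\<^sup>2) (2 * pi / \<bar>det (matrix A)\<bar>)"
    by (rule has_bochner_integral_nn_integral) (auto simp: nn_integral_inverse_square_quadratic[OF A])
  thus "integrable lborel (\<lambda>z. 1 / (1 + (norm (A z))\<^sup>2 / 2)\<^sup>2)"
    "(\<integral>z. 1 / (1 + (norm (A z))\<^sup>2 / 2)\<^sup>2 \<partial>lborel) = 2 * pi / \<bar>det (matrix A)\<bar>"
    by (auto simp: has_bochner_integral_iff)
qed

text \<open>\<open>A\<close> is the triangular Cholesky factor of the Gram matrix of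
  \<open>a\<close> and \<open>b\<close>, so its determinant is the root of the Gram determinant,
  that is the area density.\<close>

lemma positive_form_eq_norm_square:
  fixes a b :: "real \<times> (real^'n)"
  assumes E: "0 < mink a a" and g: "0 < gram_det a b"
  shows "\<exists>A :: real^2 \<Rightarrow> real^2. linear A \<and> \<bar>det (matrix A)\<bar> = sqrt (gram_det a b) \<and>
    (\<forall>z. (norm (A z))\<^sup>2 = mink ((z $ 1) *\<^sub>R a + (z $ 2) *\<^sub>R b) ((z $ 1) *\<^sub>R a + (z $ 2) *\<^sub>R b))"
proof -
  define e where "e = sqrt (mink a a)"
  define d where "d = sqrt (gram_det a b)"
  have e: "e > 0" "mink a a = e * e" using E by (simp_all add: e_def)
  have d: "d > 0" "gram_det a b = d * d" using g by (simp_all add: d_def)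
  define A where "A z = (vector [e * z $ 1 + mink a b / e * z $ 2, d / e * z $ 2] :: real^2)" for z :: "real^2"
  have "linear A"
    by (rule linearI) (simp_all add: A_def vec_eq_iff forall_2 algebra_simps)
  moreover have "\<bar>det (matrix A)\<bar> = sqrt (gram_det a b)"
  proof -
    have "det (matrix A) = d" using e by (simp add: det_2 matrix_def A_def axis_def)
    thus ?thesis using d(1) by (simp add: d_def)
  qed
  moreover have "(norm (A z))\<^sup>2 = mink ((z $ 1) *\<^sub>R a + (z $ 2) *\<^sub>R b) ((z $ 1) *\<^sub>R a + (z $ 2) *\<^sub>R b)" for z
  proof -
    have "d * d = e * e * mink b b - mink a b * mink a b"
      using d(2) e(2) by (simp add: gram_det_def power2_eq_square)
    hence bb: "mink b b = (d * d + mink a b * mink a b) / (e * e)" using e(1) by (simp add: field_simps)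
    have "(norm (A z))\<^sup>2 = (e * z $ 1 + mink a b / e * z $ 2) * (e * z $ 1 + mink a b / e * z $ 2) + (d / e * z $ 2) * (d / e * z $ 2)"
      by (simp add: power2_norm_eq_inner inner_vec_def sum_2 A_def)
    also have "\<dots> = e * e * (z $ 1 * z $ 1) + 2 * mink a b * (z $ 1 * z $ 2) + (d * d + mink a b * mink a b) / (e * e) * (z $ 2 * z $ 2)"
      using e(1) by (simp add: field_simps)
    also have "\<dots> = mink ((z $ 1) *\<^sub>R a + (z $ 2) *\<^sub>R b) ((z $ 1) *\<^sub>R a + (z $ 2) *\<^sub>R b)"
      by (simp add: mink_linear mink_commute[of b a] e(2) bb[symmetric]) (simp add: algebra_simps)
    finally show ?thesis .
  qed
  ultimately show ?thesis by blast
qed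

lemma integral_lborel_scale:
  fixes g :: "real^2 \<Rightarrow> real"
  assumes s: "0 < s" and g: "g \<in> borel_measurable borel"
  shows "(\<integral>y. g y \<partial>lborel) = (\<integral>z. s\<^sup>2 * g (y0 + s *\<^sub>R z) \<partial>lborel)"
proof -
  have "(\<integral>y. g y \<partial>lborel) = (\<integral>y. g y \<partial>density (distr lborel borel (\<lambda>x. y0 + s *\<^sub>R x)) (\<lambda>_. ennreal (s\<^sup>2)))"
    using lborel_affine[of s y0] s by simp
  also have "\<dots> = (\<integral>y. s\<^sup>2 *\<^sub>R g y \<partial>distr lborel borel (\<lambda>x. y0 + s *\<^sub>R x))"
    by (rule integral_density) (use g in auto)
  also have "\<dots> = (\<integral>z. s\<^sup>2 *\<^sub>R g (y0 + s *\<^sub>R z) \<partial>lborel)"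
    by (rule integral_distr) (use g in auto)
  finally show ?thesis by simp
qed

lemma finite_separation:
  fixes P :: "'a::t2_space set"
  assumes "finite P"
  shows "\<exists>W. (\<forall>x\<in>P. open (W x) \<and> x \<in> W x) \<and> (\<forall>x\<in>P. \<forall>y\<in>P. x \<noteq> y \<longrightarrow> W x \<inter> W y = {})"
  using assms
proof induction
  case (insert a P)
  from insert.IH obtain W where W: "\<forall>x\<in>P. open (W x) \<and> x \<in> W x" "\<forall>x\<in>P. \<forall>y\<in>P. x \<noteq> y \<longrightarrow> W x \<inter> W y = {}"
    by (elim exE conjE)
  have "\<forall>x\<in>P. \<exists>q. open (fst q) \<and> open (snd q) \<and> a \<in> fst q \<and> x \<in> snd q \<and> fst q \<inter> snd q = {}"
  proof
    fix x assume "x \<in> P"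
    hence "a \<noteq> x" using insert.hyps(2) by blast
    from hausdorff[OF this] obtain U V where "open U" "open V" "a \<in> U" "x \<in> V" "U \<inter> V = {}" by (elim exE conjE)
    thus "\<exists>q. open (fst q) \<and> open (snd q) \<and> a \<in> fst q \<and> x \<in> snd q \<and> fst q \<inter> snd q = {}"
      by (intro exI[of _ "(U, V)"]) simp
  qed
  from bchoice[OF this] obtain q where q: "\<forall>x\<in>P. open (fst (q x)) \<and> open (snd (q x)) \<and> a \<in> fst (q x) \<and> x \<in> snd (q x) \<and> fst (q x) \<inter> snd (q x) = {}"
    by (elim exE)
  define U where "U x = fst (q x)" for x
  define V where "V x = snd (q x)" for x
  have UV: "open (U x) \<and> open (V x) \<and> a \<in> U x \<and> x \<in> V x \<and> U x \<inter> V x = {}" if "x \<in> P" for x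
    using bspec[OF q that] by (simp add: U_def V_def)
  define W' where "W' x = (if x = a then (\<Inter>x\<in>P. U x) else W x \<inter> V x)" for x
  have 1: "\<forall>x\<in>insert a P. open (W' x) \<and> x \<in> W' x"
    using UV W(1) insert.hyps(1) by (simp add: W'_def open_INT open_Int)
  have 2: "W' a \<inter> W' x = {}" if "x \<in> P" for x
    using UV[OF that] that insert.hyps(2) by (auto simp: W'_def)
  have 3: "W' x \<inter> W' y = {}" if "x \<in> P" "y \<in> P" "x \<noteq> y" for x y
    using W(2) that insert.hyps(2) by (auto simp: W'_def)
  have "\<forall>x\<in>insert a P. \<forall>y\<in>insert a P. x \<noteq> y \<longrightarrow> W' x \<inter> W' y = {}"
    by (metis 2 3 Int_commute insertE)
  with 1 show ?case by (intro exI[of _ W'] conjI)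
qed simp

lemma has_vector_derivative_imp_quotient_tendsto:
  assumes "(f has_vector_derivative d) (at (0::real))"
  shows "((\<lambda>t. (1 / t) *\<^sub>R (f t - f 0)) \<longlongrightarrow> d) (at 0)"
proof -
  have 1: "((\<lambda>t. norm (f t - f 0 - (t - 0) *\<^sub>R d) / norm (t - 0)) \<longlongrightarrow> 0) (at 0)"
    by (rule conjunct2[OF assms[unfolded has_vector_derivative_def has_derivative_iff_norm]])
  have 2: "norm (f t - f 0 - (t - 0) *\<^sub>R d) / norm (t - 0) = norm ((1 / t) *\<^sub>R (f t - f 0) - d)" if "t \<noteq> 0" for t
  proof -
    have "(1 / t) *\<^sub>R (f t - f 0) - d = (1 / t) *\<^sub>R (f t - f 0 - (t - 0) *\<^sub>R d)"
      using that by (simp add: scaleR_diff_right)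
    hence "norm ((1 / t) *\<^sub>R (f t - f 0) - d) = \<bar>1 / t\<bar> * norm (f t - f 0 - (t - 0) *\<^sub>R d)"
      by (simp only: norm_scaleR)
    thus ?thesis by (simp only: real_norm_def diff_0_right abs_divide abs_one times_divide_eq_left mult_1)
  qed
  have "((\<lambda>t. norm ((1 / t) *\<^sub>R (f t - f 0) - d)) \<longlongrightarrow> 0) (at 0)"
    using 1 by (rule iffD1[OF filterlim_cong[OF refl refl], rotated]) (unfold eventually_at_filter, rule always_eventually, intro allI impI, rule 2)
  thus ?thesis by (rule LIM_zero_cancel[OF tendsto_norm_zero_cancel])
qed

context closed_immersed_surface
begin

section \<open>Height and normal part near a preimage\<close>

lemma height_chart: "height p (chart_inv c y) = - mink p (in_chart F c y) - 1"
  by (simp add: height_def in_chart_apply)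

text \<open>Both points have Minkowski square -1, so the square of their difference is -2 - 2
  \<open>mink p (F x)\<close>. This exhibits the quadratic vanishing of the height at preimages and
  the factor 1/2 in the model integral.\<close>

lemma height_eq_half_square:
  assumes "c \<in> \<A>" "y \<in> chart_image c" "p \<in> hyp_space"
  shows "height p (chart_inv c y) = mink (in_chart F c y - p) (in_chart F c y - p) / 2"
  using hyp_space_mink[OF in_chart_F_hyp[OF assms(1,2)]] hyp_space_mink[OF assms(3)]
  by (simp add: height_chart mink_linear mink_commute[of "in_chart F c y" p])

text \<open>By Pythagoras, adding a tangent vector of the surface to \<open>X\<close> cannot produce
  anything shorter than the normal part. The coefficients \<open>s\<close> and \<open>t\<close> are
  free, so that a tangent vector can be chosen which nearly cancels \<open>X\<close>.\<close>

lemma X_normal_normsq_le: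
  fixes p :: "real \<times> (real^'n)" and s t :: real
  assumes c: "c \<in> \<A>" "y \<in> chart_image c"
  defines "f \<equiv> in_chart F c"
  defines "v \<equiv> hyp_proj (f y) (- p) + s *\<^sub>R partial_deriv 1 f y + t *\<^sub>R partial_deriv 2 f y"
  shows "hyp_normsq (X_normal p (chart_inv c y)) \<le> mink v v" and "0 \<le> hyp_normsq (X_normal p (chart_inv c y))"
proof -
  let ?a = "partial_deriv 1 f y" and ?b = "partial_deriv 2 f y" and ?X = "hyp_proj (f y) (- p)"
  have g: "gram_det ?a ?b \<noteq> 0" using gram_det_pos[OF c] by (simp add: f_def)
  have q: "f y \<in> hyp_space" unfolding f_def by (rule in_chart_F_hyp[OF c])
  have ab: "mink (f y) ?a = 0" "mink (f y) ?b = 0" using mink_F_partial[OF c] by (simp_all add: f_def)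
  define N where "N = normal_proj ?a ?b ?X"
  have XN: "X_normal p (chart_inv c y) = N" "mink N (f y) = 0"
    using mink_X_normal(1,2)[OF c, of p] by (simp_all add: N_def f_def)
  define u where "u = (tangent_coeff ?a ?b ?X + s) *\<^sub>R ?a + (tangent_coeff ?b ?a ?X + t) *\<^sub>R ?b"
  have v: "v = N + u" by (simp add: v_def u_def N_def normal_proj_def algebra_simps)
  have "mink N u = 0" using mink_normal_proj[OF g, of ?X] by (simp add: u_def N_def mink_linear)
  hence "mink v v = mink N N + mink u u" by (simp add: v mink_linear mink_commute[of u N])
  moreover have "0 \<le> mink u u"
    by (rule mink_nonneg_tangent[OF q]) (simp add: u_def mink_linear ab)
  ultimately show "hyp_normsq (X_normal p (chart_inv c y)) \<le> mink v v" by (simp add: XN hyp_normsq_def)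
  show "0 \<le> hyp_normsq (X_normal p (chart_inv c y))"
    unfolding XN hyp_normsq_def by (rule mink_nonneg_tangent[OF q]) (simp add: mink_commute XN(2))
qed

lemma X_normal_global_bound:
  assumes x: "x \<in> S" and p: "p \<in> hyp_space"
  shows "hyp_normsq (X_normal p x) \<le> height p x * (height p x + 2)"
proof -
  obtain c where c: "c \<in> \<A>" "x \<in> fst c" using chart_cover[OF x] by (elim bexE)
  have y: "snd c x \<in> chart_image c" by (rule in_chart_image[OF c(2)])
  have Fx: "in_chart F c (snd c x) = F x" by (simp add: in_chart_apply chart_inv_chart[OF c])
  have "hyp_normsq (X_normal p x) \<le> mink (hyp_proj (F x) (- p)) (hyp_proj (F x) (- p))"
    using X_normal_normsq_le(1)[OF c(1) y, of p 0 0] by (simp add: chart_inv_chart[OF c] Fx)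
  also have "\<dots> = height p x * (height p x + 2)"
    using mink_hyp_proj(2)[OF F_hyp[OF x], of "- p"] hyp_space_mink[OF p]
    by (simp add: mink_linear height_def power2_eq_square algebra_simps)
  finally show ?thesis .
qed

text \<open>Seen from the preimage \<open>y0\<close>, the difference \<open>f y - p\<close> is
  linear up to a quadratic error, and the linear part is positive for the form; this bounds the
  height below by |y - y0|^2. Seen from \<open>y\<close>, the vector leading back to
  \<open>p\<close> is tangent to the surface up to a quadratic error, hence up to a multiple of the
  height, and this bounds the normal part of \<open>X\<close>.\<close>

lemma local_bounds:
  assumes c: "c \<in> \<A>" "y0 \<in> chart_image c" and p: "p \<in> hyp_space" and y0: "in_chart F c y0 = p"
  shows "\<exists>r>0. \<exists>C1>0. \<exists>C2. cball y0 r \<subseteq> chart_image c \<and> (\<forall>y\<in>cball y0 r.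
     C1 * (norm (y - y0))\<^sup>2 \<le> height p (chart_inv c y) \<and>
     hyp_normsq (X_normal p (chart_inv c y)) \<le> C2 * (height p (chart_inv c y))\<^sup>2)"
proof -
  define f where "f = in_chart F c"
  let ?a = "partial_deriv 1 f y0" and ?b = "partial_deriv 2 f y0"
  obtain r1 where r1: "r1 > 0" "cball y0 r1 \<subseteq> chart_image c"
    using open_chart_image[OF c(1)] c(2) unfolding open_contains_cball by (elim ballE) auto
  obtain C where C: "C \<ge> 0" "\<forall>y\<in>cball y0 r1. \<forall>z\<in>cball y0 r1.
      norm (f z - f y - frechet_derivative f (at y) (z - y)) \<le> C * (norm (z - y))\<^sup>2"
    using smooth_on_taylor[OF smooth_in_chart_F[OF c(1)] r1(2)] unfolding f_def by (elim exE conjE)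
  obtain K where K: "K > 0" "\<And>(v :: real \<times> (real^'n)) v'. norm (mink v v') \<le> norm v * norm v' * K"
    using mink.pos_bounded by (elim exE conjE) blast
  have d: "f differentiable (at y)" if "y \<in> chart_image c" for y
    unfolding f_def by (rule in_chart_F_differentiable[OF c(1) that])
  define M where "M = norm ?a + norm ?b"
  have M: "norm (frechet_derivative f (at y0) h) \<le> M * norm h" for h
    unfolding frechet_derivative_apply_partial[OF d[OF c(2)]] M_def by (rule onorm_frechet_le_partials) auto
  obtain A :: "real^2 \<Rightarrow> real^2" where A: "linear A" "\<bar>det (matrix A)\<bar> = sqrt (gram_det ?a ?b)"
      "\<forall>z. (norm (A z))\<^sup>2 = mink ((z $ 1) *\<^sub>R ?a + (z $ 2) *\<^sub>R ?b) ((z $ 1) *\<^sub>R ?a + (z $ 2) *\<^sub>R ?b)"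
    using positive_form_eq_norm_square[OF first_fund_form_pos[OF c] gram_det_pos[OF c]] unfolding f_def by (elim exE conjE)
  have "det (matrix A) \<noteq> 0" using A(2) gram_det_pos[OF c] by (auto simp: f_def)
  hence "inj A" using A(1) by (simp add: det_nz_iff_inj)
  then obtain B where B: "B > 0" "\<And>x. B * norm x \<le> norm (A x)"
    using linear_inj_bounded_below_pos[OF A(1)] by blast
  have q: "B\<^sup>2 * (norm h)\<^sup>2 \<le> mink (frechet_derivative f (at y0) h) (frechet_derivative f (at y0) h)" for h
  proof -
    have "(B * norm h)\<^sup>2 \<le> (norm (A h))\<^sup>2" using B by (intro power_mono) auto
    thus ?thesis using A(3) by (simp add: frechet_derivative_apply_partial[OF d[OF c(2)]] power_mult_distrib)
  qed
  \<comment> \<open>For |h| \<le> 1 the Taylor error in the square of \<open>f y - p\<close> is at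
    most |h|^3 times this constant; the added 1 makes it positive. The choice of \<open>r\<close>
    lets the error consume at most half of the quadratic part.\<close>
  define T where "T = 2 * K * M * C + K * C\<^sup>2 + 1"
  have M0: "M \<ge> 0" by (simp add: M_def)
  have T: "T > 0" "T \<ge> 2 * K * M * C + K * C\<^sup>2" using K(1) C(1) M0 by (auto simp: T_def intro!: add_nonneg_pos)
  define r where "r = min r1 (min 1 (B\<^sup>2 / (2 * T)))"
  have r: "r > 0" "r \<le> r1" "r \<le> 1" "r * T \<le> B\<^sup>2 / 2"
  proof -
    have "r \<le> B\<^sup>2 / (2 * T)" by (simp add: r_def)
    thus "r * T \<le> B\<^sup>2 / 2" using T(1) by (simp add: pos_le_divide_eq algebra_simps)
  qed (use r1 B T in \<open>auto simp: r_def\<close>)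
  \<comment> \<open>One factor 1/2 pays for the Taylor error, the other is the one in
    \<open>height_eq_half_square\<close>.\<close>
  define C1 where "C1 = B\<^sup>2 / 4"
  have C1: "C1 > 0" using B by (simp add: C1_def)
  have sub: "cball y0 r \<subseteq> chart_image c" using r(2) r1(2) by (meson order_trans subset_cball)
  have main: "C1 * (norm (y - y0))\<^sup>2 \<le> height p (chart_inv c y) \<and>
     hyp_normsq (X_normal p (chart_inv c y)) \<le> ((C / C1)\<^sup>2 + 1) * (height p (chart_inv c y))\<^sup>2"
    if y: "y \<in> cball y0 r" for y
  proof
    define h where "h = y - y0"
    define u where "u = height p (chart_inv c y)"
    have hr: "norm h \<le> r" using y by (simp add: h_def dist_norm norm_minus_commute)
    have yO: "y \<in> chart_image c" using y sub by blast
    have yr: "y \<in> cball y0 r1" "y0 \<in> cball y0 r1" using y r(2) r1(1) by auto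
    define D where "D = frechet_derivative f (at y0) h"
    define R where "R = f y - f y0 - D"
    have R: "norm R \<le> C * (norm h)\<^sup>2" using C(2) yr by (auto simp: R_def D_def h_def)
    have fy: "f y - p = D + R" using y0 by (simp add: R_def f_def)
    have "mink (f y - p) (f y - p) = mink D D + 2 * mink D R + mink R R"
      by (simp add: fy mink_linear mink_commute[of R D])
    moreover have "\<bar>mink D R\<bar> \<le> M * norm h * (C * (norm h)\<^sup>2) * K"
      using K(1) M0 C(1) M[of h] unfolding D_def[symmetric]
      by (intro order_trans[OF K(2)[of D R, unfolded real_norm_def]] mult_right_mono mult_mono R) auto
    moreover have "\<bar>mink R R\<bar> \<le> (C * (norm h)\<^sup>2) * (C * (norm h)\<^sup>2) * K"
      using K(1) C(1)
      by (intro order_trans[OF K(2)[of R R, unfolded real_norm_def]] mult_right_mono mult_mono R) auto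
    ultimately have "mink (f y - p) (f y - p) \<ge> B\<^sup>2 * (norm h)\<^sup>2 - 2 * (M * norm h * (C * (norm h)\<^sup>2) * K)
        - (C * (norm h)\<^sup>2) * (C * (norm h)\<^sup>2) * K"
      using q[of h] unfolding D_def[symmetric] by linarith
    also have "B\<^sup>2 * (norm h)\<^sup>2 - 2 * (M * norm h * (C * (norm h)\<^sup>2) * K) - (C * (norm h)\<^sup>2) * (C * (norm h)\<^sup>2) * K
       = (norm h)\<^sup>2 * (B\<^sup>2 - norm h * (2 * K * M * C + K * C\<^sup>2 * norm h))"
      by (simp add: power2_eq_square algebra_simps)
    finally have 1: "(norm h)\<^sup>2 * (B\<^sup>2 - norm h * (2 * K * M * C + K * C\<^sup>2 * norm h)) \<le> mink (f y - p) (f y - p)" .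
    have "K * C\<^sup>2 * norm h \<le> K * C\<^sup>2 * 1" using hr r(3) K(1) by (intro mult_left_mono) auto
    hence t: "2 * K * M * C + K * C\<^sup>2 * norm h \<le> T" using T(2) by linarith
    have "norm h * (2 * K * M * C + K * C\<^sup>2 * norm h) \<le> r * T"
      by (rule mult_mono[OF hr t]) (use r(1) K(1) M0 C(1) in auto)
    hence "B\<^sup>2 / 2 \<le> B\<^sup>2 - norm h * (2 * K * M * C + K * C\<^sup>2 * norm h)" using r(4) by linarith
    hence "(norm h)\<^sup>2 * (B\<^sup>2 / 2) \<le> (norm h)\<^sup>2 * (B\<^sup>2 - norm h * (2 * K * M * C + K * C\<^sup>2 * norm h))"
      by (rule mult_left_mono) simp
    with 1 have "(norm h)\<^sup>2 * (B\<^sup>2 / 2) \<le> mink (f y - p) (f y - p)" by linarith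
    moreover have "C1 * (norm h)\<^sup>2 = (norm h)\<^sup>2 * (B\<^sup>2 / 2) / 2" by (simp add: C1_def)
    ultimately have hu: "C1 * (norm h)\<^sup>2 \<le> u"
      unfolding u_def height_eq_half_square[OF c(1) yO p] f_def[symmetric] by linarith
    thus "C1 * (norm (y - y0))\<^sup>2 \<le> height p (chart_inv c y)" by (simp add: u_def h_def)
    \<comment> \<open>This expansion starts from \<open>y\<close>, not from \<open>y0\<close>, since
      the normal part at \<open>y\<close> refers to the tangent plane there.\<close>
    define R' where "R' = f y0 - f y - frechet_derivative f (at y) (y0 - y)"
    have R': "norm R' \<le> C * (norm h)\<^sup>2" 
      using bspec[OF bspec[OF C(2) yr(1)] yr(2)] norm_minus_commute[of y0 y] by (simp add: R'_def h_def)
    \<comment> \<open>The added tangent vector is the differential at \<open>y\<close> applied to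
      \<open>y0 - y\<close>. It cancels \<open>X\<close> to first order and leaves only
      \<open>- R' + u *\<^sub>R f y\<close>.\<close>
    define v where "v = hyp_proj (f y) (- p) + ((y0 - y) $ 1) *\<^sub>R partial_deriv 1 f y + ((y0 - y) $ 2) *\<^sub>R partial_deriv 2 f y"
    have mp: "mink p (f y) = - 1 - u" by (simp add: u_def height_chart f_def)
    have v: "v = - R' + u *\<^sub>R f y"
      using y0 unfolding v_def R'_def frechet_derivative_apply_partial[OF d[OF yO]]
      by (simp add: hyp_proj_def mink_linear mp[unfolded f_def] f_def algebra_simps)
    have q: "f y \<in> hyp_space" unfolding f_def by (rule in_chart_F_hyp[OF c(1) yO])
    have "mink (f y) v = 0"
      using mink_F_partial[OF c(1) yO] mink_hyp_proj(1)[OF q] by (simp add: v_def mink_linear f_def)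
    hence Rf: "mink R' (f y) = - u" unfolding v by (simp add: mink_linear hyp_space_mink[OF q] mink_commute[of "f y" R'])
    have "mink v v = mink R' R' - 2 * u * mink R' (f y) + u * u * mink (f y) (f y)"
      unfolding v by (simp add: mink_linear mink_commute[of "f y" R'] algebra_simps)
    also have "\<dots> = mink R' R' + u\<^sup>2" by (simp add: Rf hyp_space_mink[OF q] power2_eq_square)
    also have "\<dots> \<le> (norm R')\<^sup>2 + u\<^sup>2" using mink_self_le[of R'] by simp
    also have "\<dots> \<le> (C * (norm h)\<^sup>2)\<^sup>2 + u\<^sup>2" 
      by (rule add_right_mono[OF power_mono[OF R' norm_ge_zero]])
    also have "\<dots> \<le> (C / C1 * u)\<^sup>2 + u\<^sup>2"
    proof -
      have "(norm h)\<^sup>2 \<le> u / C1" using hu C1 by (simp add: pos_le_divide_eq mult.commute)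
      hence "C * (norm h)\<^sup>2 \<le> C * (u / C1)" by (rule mult_left_mono[OF _ C(1)])
      hence "C * (norm h)\<^sup>2 \<le> C / C1 * u" by simp
      thus ?thesis using C(1) by (intro add_right_mono power_mono) auto
    qed
    also have "\<dots> = ((C / C1)\<^sup>2 + 1) * u\<^sup>2" by (simp add: power_mult_distrib power_divide distrib_right)
    finally have "mink v v \<le> ((C / C1)\<^sup>2 + 1) * u\<^sup>2" .
    with X_normal_normsq_le(1)[OF c(1) yO, of p "(y0 - y) $ 1" "(y0 - y) $ 2"]
    show "hyp_normsq (X_normal p (chart_inv c y)) \<le> ((C / C1)\<^sup>2 + 1) * (height p (chart_inv c y))\<^sup>2"
      unfolding v_def f_def u_def by linarith
  qed
  show ?thesis
    by (rule exI[of _ r], rule conjI[OF r(1)], rule exI[of _ C1], rule conjI[OF C1], rule exI[of _ "(C / C1)\<^sup>2 + 1"],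
        rule conjI[OF sub], rule ballI, rule main)
qed

lemma continuous_on_height_chart: "c \<in> \<A> \<Longrightarrow> continuous_on (chart_image c) (\<lambda>y. height p (chart_inv c y))"
  unfolding height_chart
  by (intro continuous_on_diff continuous_on_const Ck1_continuous[OF Ck1_minus_mink[OF Ck1_F]])

lemma continuous_on_height: "continuous_on S (height p)"
  by (rule continuous_on_S_chartI) (simp add: in_chart_apply[abs_def] continuous_on_height_chart)

text \<open>With \<open>(s n)^2\<close> in the role of \<open>e\<close>, the substitution y = y0 + s
  z turns the integrand into 2 W / (1 + u / s^2)^2, where u / s^2 tends to |A z|^2 / 2 for the
  Cholesky factor \<open>A\<close> of the metric at \<open>y0\<close>. The lower bound
  \<open>low\<close> gives a dominating function of the same shape.\<close>

lemma local_concentration: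
  assumes c: "c \<in> \<A>" "y0 \<in> chart_image c" and p: "p \<in> hyp_space" and y0: "in_chart F c y0 = p"
    and r: "0 < r" "cball y0 r \<subseteq> chart_image c" and C1: "0 < C1"
    and low: "\<And>y. y \<in> cball y0 r \<Longrightarrow> C1 * (norm (y - y0))\<^sup>2 \<le> height p (chart_inv c y)"
    and s: "\<And>n. 0 < s n" "s \<longlonglongrightarrow> 0"
  shows "(\<lambda>n. \<integral>x. indicator (chart_inv c ` ball y0 r) x * (2 * (s n)\<^sup>2 / (height p x + (s n)\<^sup>2)\<^sup>2) \<partial>area) \<longlonglongrightarrow> 4 * pi"
proof -
  define f where "f = in_chart F c"
  define W where "W = area_density f"
  define u where "u y = height p (chart_inv c y)" for y
  define V where "V = chart_inv c ` ball y0 r"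
  let ?a = "partial_deriv 1 f y0" and ?b = "partial_deriv 2 f y0"
  have sub: "ball y0 r \<subseteq> chart_image c" using r(2) ball_subset_cball by blast
  have Vs: "V \<in> sets borel_S" unfolding V_def
    by (rule openin_sets_borel_S[OF openin_chart_inv_image[OF c(1) open_ball sub]])
  have Vind: "indicator V (chart_inv c y) = (indicator (ball y0 r) y :: real)" if y: "y \<in> chart_image c" for y
  proof -
    have "chart_inv c y \<in> V \<longleftrightarrow> y \<in> ball y0 r"
    proof
      assume "chart_inv c y \<in> V"
      then obtain z where z: "z \<in> ball y0 r" "chart_inv c y = chart_inv c z" unfolding V_def by (elim imageE)
      have "y = snd c (chart_inv c z)" using chart_chart_inv[OF y] unfolding z(2) by (rule sym)
      hence "y = z" unfolding chart_chart_inv[OF subsetD[OF sub z(1)]] .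
      thus "y \<in> ball y0 r" using z(1) by (rule ssubst)
    qed (simp add: V_def)
    thus ?thesis by (simp add: indicator_def)
  qed
  have u0: "0 \<le> u y" if "y \<in> chart_image c" for y
    unfolding u_def by (rule height_nonneg[OF p chart_inv_in_S[OF c(1) that]])
  define g where "g n y = indicator (ball y0 r) y * (W y * (2 * (s n)\<^sup>2 / (u y + (s n)\<^sup>2)\<^sup>2))" for n y
  have upos: "0 < u y + (s n)\<^sup>2" if "y \<in> chart_image c" for n y
    using u0[OF that] s(1)[of n] by (intro add_nonneg_pos) auto
  have gm: "g n \<in> borel_measurable borel" for n
  proof -
    have "continuous_on (ball y0 r) (\<lambda>y. W y * (2 * (s n)\<^sup>2 / (u y + (s n)\<^sup>2)\<^sup>2))"
    proof (intro continuous_on_mult continuous_on_divide continuous_on_const continuous_on_power continuous_on_add ballI)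
      show "continuous_on (ball y0 r) W" unfolding W_def f_def
        by (rule continuous_on_subset[OF continuous_on_area_density[OF c(1)] sub])
      show "continuous_on (ball y0 r) u" unfolding u_def[abs_def]
        by (rule continuous_on_subset[OF continuous_on_height_chart[OF c(1)] sub])
      fix y assume "y \<in> ball y0 r"
      from upos[OF subsetD[OF sub this], of n] show "(u y + (s n)\<^sup>2)\<^sup>2 \<noteq> 0" by simp
    qed
    from borel_measurable_continuous_on_indicator[OF _ this] show ?thesis
      by (simp add: g_def[abs_def])
  qed
  have I: "(\<integral>x. indicator V x * (2 * (s n)\<^sup>2 / (height p x + (s n)\<^sup>2)\<^sup>2) \<partial>area) = (\<integral>z. (s n)\<^sup>2 * g n (y0 + s n *\<^sub>R z) \<partial>lborel)" for n
  proof -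
    have hm: "height p \<in> borel_measurable borel_S"
      by (rule borel_measurable_continuous_on_restrict[OF continuous_on_height])
    have im: "(\<lambda>x. indicator V x * (2 * (s n)\<^sup>2 / (height p x + (s n)\<^sup>2)\<^sup>2)) \<in> borel_measurable borel_S"
      by (intro borel_measurable_times borel_measurable_divide borel_measurable_power borel_measurable_add
          borel_measurable_const hm borel_measurable_indicator Vs)
    have "(\<integral>x. indicator V x * (2 * (s n)\<^sup>2 / (height p x + (s n)\<^sup>2)\<^sup>2) \<partial>area)
      = (\<integral>y. indicator (chart_image c) y * (area_density (in_chart F c) y * (indicator V (chart_inv c y) * (2 * (s n)\<^sup>2 / (height p (chart_inv c y) + (s n)\<^sup>2)\<^sup>2))) \<partial>lborel)"
    proof (rule integral_area_chart[OF c(1) im])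
      fix x assume "x \<in> S - fst c"
      moreover have "V \<subseteq> fst c" unfolding V_def by (rule image_subsetI) (rule chart_inv_in[OF subsetD[OF sub]])
      ultimately have "x \<notin> V" by blast
      thus "indicator V x * (2 * (s n)\<^sup>2 / (height p x + (s n)\<^sup>2)\<^sup>2) = 0" by simp
    qed
    also have "\<dots> = (\<integral>y. g n y \<partial>lborel)"
    proof (rule Bochner_Integration.integral_cong[OF refl])
      fix y
      show "indicator (chart_image c) y * (area_density (in_chart F c) y * (indicator V (chart_inv c y) * (2 * (s n)\<^sup>2 / (height p (chart_inv c y) + (s n)\<^sup>2)\<^sup>2))) = g n y"
      proof (cases "y \<in> chart_image c")
        case True
        thus ?thesis by (simp add: g_def Vind W_def u_def f_def)
      next
        case False
        hence "y \<notin> ball y0 r" using subsetD[OF sub, of y] by metis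
        thus ?thesis using False by (simp add: g_def)
      qed
    qed
    also have "\<dots> = (\<integral>z. (s n)\<^sup>2 * g n (y0 + s n *\<^sub>R z) \<partial>lborel)"
      by (rule integral_lborel_scale[OF s(1) gm])
    finally show ?thesis .
  qed
  have val: "(s n)\<^sup>2 * g n (y0 + s n *\<^sub>R z) = 2 * W (y0 + s n *\<^sub>R z) / (1 + u (y0 + s n *\<^sub>R z) / (s n)\<^sup>2)\<^sup>2"
    if "y0 + s n *\<^sub>R z \<in> ball y0 r" for n z
  proof -
    have "s n \<noteq> 0" using s(1)[of n] by simp
    hence "u (y0 + s n *\<^sub>R z) + (s n)\<^sup>2 = (s n)\<^sup>2 * (1 + u (y0 + s n *\<^sub>R z) / (s n)\<^sup>2)"
      by (simp add: distrib_left)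
    thus ?thesis using that \<open>s n \<noteq> 0\<close> by (simp add: g_def power_mult_distrib power2_eq_square)
  qed
  obtain A :: "real^2 \<Rightarrow> real^2" where A: "linear A" "\<bar>det (matrix A)\<bar> = sqrt (gram_det ?a ?b)"
      "\<forall>z. (norm (A z))\<^sup>2 = mink ((z $ 1) *\<^sub>R ?a + (z $ 2) *\<^sub>R ?b) ((z $ 1) *\<^sub>R ?a + (z $ 2) *\<^sub>R ?b)"
    using positive_form_eq_norm_square[OF first_fund_form_pos[OF c] gram_det_pos[OF c]] unfolding f_def by (elim exE conjE)
  \<comment> \<open>The density at \<open>y0\<close> cancels against the determinant in the model
    integral, leaving 2 times 2 pi in every chart.\<close>
  have W0: "W y0 = \<bar>det (matrix A)\<bar>" unfolding A(2) W_def by (rule area_density_eq_gram)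
  have Wpos: "0 < W y0" unfolding W_def f_def by (rule area_density_pos[OF c])
  have dA: "det (matrix A) \<noteq> 0" using W0 Wpos by auto
  have df: "f differentiable (at y0)" unfolding f_def by (rule in_chart_F_differentiable[OF c])
  have lim: "(\<lambda>n. (s n)\<^sup>2 * g n (y0 + s n *\<^sub>R z)) \<longlonglongrightarrow> 2 * W y0 * (1 / (1 + (norm (A z))\<^sup>2 / 2)\<^sup>2)" for z
  proof -
    have yl: "(\<lambda>n. y0 + s n *\<^sub>R z) \<longlonglongrightarrow> y0"
      using tendsto_add[OF tendsto_const tendsto_scaleR[OF s(2) tendsto_const], of y0 z] by simp
    have ev: "eventually (\<lambda>n. y0 + s n *\<^sub>R z \<in> ball y0 r) sequentially"
      by (rule topological_tendstoD[OF yl open_ball]) (use r(1) in simp)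
    have "isCont W y0"
      unfolding W_def f_def
      by (rule bspec[OF iffD1[OF continuous_on_eq_continuous_at[OF open_chart_image[OF c(1)]] continuous_on_area_density[OF c(1)]] c(2)])
    hence Wl: "(\<lambda>n. W (y0 + s n *\<^sub>R z)) \<longlonglongrightarrow> W y0"
      using yl by (rule isCont_tendsto_compose)
    have vd: "((\<lambda>t. f (y0 + t *\<^sub>R z)) has_vector_derivative frechet_derivative f (at y0) z) (at 0)"
      by (rule has_derivative_imp_directional[OF iffD1[OF frechet_derivative_works df]])
    have "filterlim s (at 0) sequentially"
      by (rule filterlim_atI[OF s(2)]) (use s(1) in \<open>simp add: less_imp_neq[symmetric]\<close>)
    from filterlim_compose[OF has_vector_derivative_imp_quotient_tendsto[OF vd] this]
    have "(\<lambda>n. (1 / s n) *\<^sub>R (f (y0 + s n *\<^sub>R z) - p)) \<longlonglongrightarrow> frechet_derivative f (at y0) z"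
      using y0 by (simp add: f_def)
    from tendsto_divide[OF mink.tendsto[OF this this] tendsto_const[of 2]]
    have "(\<lambda>n. mink ((1 / s n) *\<^sub>R (f (y0 + s n *\<^sub>R z) - p)) ((1 / s n) *\<^sub>R (f (y0 + s n *\<^sub>R z) - p)) / 2)
       \<longlonglongrightarrow> (norm (A z))\<^sup>2 / 2"
      unfolding frechet_derivative_apply_partial[OF df] A(3)[rule_format] by simp
    moreover have "eventually (\<lambda>n. mink ((1 / s n) *\<^sub>R (f (y0 + s n *\<^sub>R z) - p)) ((1 / s n) *\<^sub>R (f (y0 + s n *\<^sub>R z) - p)) / 2
        = u (y0 + s n *\<^sub>R z) / (s n)\<^sup>2) sequentially"
      using ev
    proof eventually_elim
      case (elim n)
      have "y0 + s n *\<^sub>R z \<in> chart_image c" using elim sub by (rule rev_subsetD)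
      note h = height_eq_half_square[OF c(1) this p]
      show ?case unfolding u_def f_def h mink.scaleR_left mink.scaleR_right by (simp add: power2_eq_square)
    qed
    ultimately have "(\<lambda>n. u (y0 + s n *\<^sub>R z) / (s n)\<^sup>2) \<longlonglongrightarrow> (norm (A z))\<^sup>2 / 2"
      by (rule Lim_transform_eventually)
    from tendsto_divide[OF tendsto_mult[OF tendsto_const Wl] tendsto_power[OF tendsto_add[OF tendsto_const this]], of "1" 2 2]
    have "(\<lambda>n. 2 * W (y0 + s n *\<^sub>R z) / (1 + u (y0 + s n *\<^sub>R z) / (s n)\<^sup>2)\<^sup>2) \<longlonglongrightarrow> 2 * W y0 / (1 + (norm (A z))\<^sup>2 / 2)\<^sup>2"
      by (simp add: add_nonneg_eq_0_iff)
    moreover have "eventually (\<lambda>n. 2 * W (y0 + s n *\<^sub>R z) / (1 + u (y0 + s n *\<^sub>R z) / (s n)\<^sup>2)\<^sup>2 = (s n)\<^sup>2 * g n (y0 + s n *\<^sub>R z)) sequentially"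
      using ev by eventually_elim (rule val[symmetric])
    ultimately have "(\<lambda>n. (s n)\<^sup>2 * g n (y0 + s n *\<^sub>R z)) \<longlonglongrightarrow> 2 * W y0 / (1 + (norm (A z))\<^sup>2 / 2)\<^sup>2"
      by (rule Lim_transform_eventually)
    thus ?thesis by simp
  qed
  have "compact (W ` cball y0 r)"
    unfolding W_def f_def by (rule compact_continuous_image[OF continuous_on_subset[OF continuous_on_area_density[OF c(1)] r(2)] compact_cball])
  from compact_imp_bounded[OF this] obtain Wm where Wm: "\<forall>w\<in>W ` cball y0 r. norm w \<le> Wm" unfolding bounded_iff by blast
  have Wm0: "0 \<le> Wm"
  proof -
    have "W y0 \<in> W ` cball y0 r" using r(1) by (intro imageI) simp
    from bspec[OF Wm this] show ?thesis by simp
  qed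
  \<comment> \<open>Scaled so that |A' z|^2 / 2 = C1 |z|^2: the dominating function is then itself
    an instance of the model integral and integrable for the same reason.\<close>
  define A' :: "real^2 \<Rightarrow> real^2" where "A' z = sqrt (2 * C1) *\<^sub>R z" for z
  have A': "linear A'" "det (matrix A') \<noteq> 0"
  proof -
    show "linear A'" by (rule linearI) (simp_all add: A'_def algebra_simps)
    show "det (matrix A') \<noteq> 0" using C1 by (simp add: det_2 matrix_def A'_def axis_def)
  qed
  have nA': "(norm (A' z))\<^sup>2 / 2 = C1 * (norm z)\<^sup>2" for z using C1 by (simp add: A'_def power_mult_distrib)
  have bnd: "norm ((s n)\<^sup>2 * g n (y0 + s n *\<^sub>R z)) \<le> 2 * Wm * (1 / (1 + (norm (A' z))\<^sup>2 / 2)\<^sup>2)" for n z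
  proof (cases "y0 + s n *\<^sub>R z \<in> ball y0 r")
    case True
    have Yc: "y0 + s n *\<^sub>R z \<in> cball y0 r" using True by simp
    have "C1 * (s n * norm z)\<^sup>2 \<le> u (y0 + s n *\<^sub>R z)"
      using low[OF Yc] s(1)[of n] by (simp add: u_def)
    hence "C1 * (norm z)\<^sup>2 \<le> u (y0 + s n *\<^sub>R z) / (s n)\<^sup>2"
      using s(1)[of n] by (simp add: pos_le_divide_eq power_mult_distrib mult_ac)
    hence le: "1 + C1 * (norm z)\<^sup>2 \<le> 1 + u (y0 + s n *\<^sub>R z) / (s n)\<^sup>2" by simp
    have p1: "0 < 1 + C1 * (norm z)\<^sup>2" using C1 by (intro add_pos_nonneg) auto
    have Wn: "\<bar>W (y0 + s n *\<^sub>R z)\<bar> \<le> Wm"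
    proof -
      have "W (y0 + s n *\<^sub>R z) \<in> W ` cball y0 r" by (rule imageI[OF Yc])
      from bspec[OF Wm this] show ?thesis by simp
    qed
    have "norm (2 * W (y0 + s n *\<^sub>R z) / (1 + u (y0 + s n *\<^sub>R z) / (s n)\<^sup>2)\<^sup>2)
       = 2 * \<bar>W (y0 + s n *\<^sub>R z)\<bar> / (1 + u (y0 + s n *\<^sub>R z) / (s n)\<^sup>2)\<^sup>2" by (simp add: abs_mult)
    also have "\<dots> \<le> 2 * Wm / (1 + C1 * (norm z)\<^sup>2)\<^sup>2"
      using Wn le p1 Wm0 by (intro frac_le power_mono) auto
    finally show ?thesis unfolding val[OF True] nA' by simp
  next
    case False
    thus ?thesis using Wm0 by (simp add: g_def)
  qed
  have km: "(\<lambda>z. (s n)\<^sup>2 * g n (y0 + s n *\<^sub>R z)) \<in> borel_measurable lborel" for n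
    using gm[of n] by measurable
  have "(\<lambda>n. \<integral>z. (s n)\<^sup>2 * g n (y0 + s n *\<^sub>R z) \<partial>lborel) \<longlonglongrightarrow> (\<integral>z. 2 * W y0 * (1 / (1 + (norm (A z))\<^sup>2 / 2)\<^sup>2) \<partial>lborel)"
  proof (rule integral_dominated_convergence[where w = "\<lambda>z. 2 * Wm * (1 / (1 + (norm (A' z))\<^sup>2 / 2)\<^sup>2)"])
    show "(\<lambda>z. 2 * W y0 * (1 / (1 + (norm (A z))\<^sup>2 / 2)\<^sup>2)) \<in> borel_measurable lborel"
      using integrable_inverse_square_quadratic[OF A(1) dA] by (intro borel_measurable_times borel_measurable_const borel_measurable_integrable)
    show "integrable lborel (\<lambda>z. 2 * Wm * (1 / (1 + (norm (A' z))\<^sup>2 / 2)\<^sup>2))"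
      by (intro integrable_mult_right integrable_inverse_square_quadratic[OF A'])
    show "AE z in lborel. (\<lambda>n. (s n)\<^sup>2 * g n (y0 + s n *\<^sub>R z)) \<longlonglongrightarrow> 2 * W y0 * (1 / (1 + (norm (A z))\<^sup>2 / 2)\<^sup>2)"
      by (rule AE_I2) (rule lim)
    show "AE z in lborel. norm ((s n)\<^sup>2 * g n (y0 + s n *\<^sub>R z)) \<le> 2 * Wm * (1 / (1 + (norm (A' z))\<^sup>2 / 2)\<^sup>2)" for n
      by (rule AE_I2) (rule bnd)
  qed (rule km)
  also have "(\<integral>z. 2 * W y0 * (1 / (1 + (norm (A z))\<^sup>2 / 2)\<^sup>2) \<partial>lborel) = 4 * pi"
    unfolding integral_mult_right_zero integral_inverse_square_quadratic[OF A(1) dA] W0 using dA by simp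
  finally show ?thesis unfolding V_def[symmetric] I .
qed

end

section \<open>The area identity\<close>

context closed_immersed_surface
begin

text \<open>The prescribed open set \<open>W\<close> allows the neighbourhoods of different
  preimages to be taken disjoint, and the same \<open>V\<close> serves all sequences tending to
  0.\<close>

lemma concentration_at:
  assumes x: "x \<in> S" "F x = p" and p: "p \<in> hyp_space" and W: "open W" "x \<in> W"
  shows "\<exists>V C. openin (top_of_set S) V \<and> x \<in> V \<and> V \<subseteq> W \<and>
    (\<forall>z\<in>V. hyp_normsq (X_normal p z) \<le> C * (height p z)\<^sup>2) \<and>
    (\<forall>s. (\<forall>n. 0 < s n) \<and> s \<longlonglongrightarrow> 0 \<longrightarrow>
      (\<lambda>n. \<integral>x. indicator V x * (2 * (s n)\<^sup>2 / (height p x + (s n)\<^sup>2)\<^sup>2) \<partial>area) \<longlonglongrightarrow> 4 * pi)"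
proof -
  obtain c where c: "c \<in> \<A>" "x \<in> fst c" using chart_cover[OF x(1)] by (elim bexE)
  define y0 where "y0 = snd c x"
  have y0: "y0 \<in> chart_image c" unfolding y0_def by (rule in_chart_image[OF c(2)])
  have xy: "chart_inv c y0 = x" unfolding y0_def by (rule chart_inv_chart[OF c])
  have fy: "in_chart F c y0 = p" unfolding in_chart_apply xy by (rule x(2))
  obtain r C1 C2 where r: "r > 0" "C1 > 0" "cball y0 r \<subseteq> chart_image c"
    and b: "\<forall>y\<in>cball y0 r. C1 * (norm (y - y0))\<^sup>2 \<le> height p (chart_inv c y) \<and>
     hyp_normsq (X_normal p (chart_inv c y)) \<le> C2 * (height p (chart_inv c y))\<^sup>2"
    using local_bounds[OF c(1) y0 p fy] by (elim exE conjE)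
  have oW: "open (snd c ` (fst c \<inter> (S \<inter> W)))"
    by (rule open_chart_overlap[OF c(1) openin_open_Int[OF W(1)]])
  have "y0 \<in> snd c ` (fst c \<inter> (S \<inter> W))" unfolding y0_def using c(2) x(1) W(2) by (intro imageI IntI)
  with oW obtain r' where r': "r' > 0" "ball y0 r' \<subseteq> snd c ` (fst c \<inter> (S \<inter> W))"
    unfolding open_contains_ball by (elim ballE) auto
  define q where "q = min r r'"
  have q: "0 < q" using r(1) r'(1) by (simp add: q_def)
  have qc: "cball y0 q \<subseteq> cball y0 r" by (simp add: q_def subset_cball)
  have qb: "ball y0 q \<subseteq> ball y0 r'" by (simp add: q_def subset_ball)
  have qO: "cball y0 q \<subseteq> chart_image c" using qc r(3) by (rule order_trans)
  have bO: "ball y0 q \<subseteq> chart_image c" using ball_subset_cball qO by (rule order_trans)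
  define V where "V = chart_inv c ` ball y0 q"
  have 1: "openin (top_of_set S) V" unfolding V_def by (rule openin_chart_inv_image[OF c(1) open_ball bO])
  have 2: "x \<in> V" unfolding V_def using q xy[symmetric] by (intro image_eqI[where x = y0]) simp_all
  have 3: "V \<subseteq> W"
    unfolding V_def
  proof (rule image_subsetI)
    fix y assume "y \<in> ball y0 q"
    with qb r'(2) have "y \<in> snd c ` (fst c \<inter> (S \<inter> W))" by blast
    then obtain z where "y = snd c z" "z \<in> fst c" "z \<in> W" by blast
    thus "chart_inv c y \<in> W" using chart_inv_chart[OF c(1), of z] by simp
  qed
  have 4: "hyp_normsq (X_normal p z) \<le> C2 * (height p z)\<^sup>2" if z: "z \<in> V" for z
  proof -
    obtain y where y: "y \<in> ball y0 q" "z = chart_inv c y" using z unfolding V_def by (elim imageE)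
    have "y \<in> cball y0 r" using y(1) qc ball_subset_cball by blast
    from bspec[OF b this] show ?thesis unfolding y(2) by (rule conjunct2)
  qed
  have 5: "(\<lambda>n. \<integral>x. indicator V x * (2 * (s n)\<^sup>2 / (height p x + (s n)\<^sup>2)\<^sup>2) \<partial>area) \<longlonglongrightarrow> 4 * pi"
    if s: "\<And>n. 0 < s n" "s \<longlonglongrightarrow> 0" for s
    unfolding V_def
  proof (rule local_concentration[OF c(1) y0 p fy q qO r(2) _ s])
    fix y assume "y \<in> cball y0 q"
    with qc have "y \<in> cball y0 r" by (rule subsetD)
    from bspec[OF b this] show "C1 * (norm (y - y0))\<^sup>2 \<le> height p (chart_inv c y)" by (rule conjunct1)
  qed
  show ?thesis
    by (rule exI[of _ V], rule exI[of _ C2], intro conjI 1 2 3 ballI allI impI)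
       (erule 4, elim conjE, rule 5, blast, assumption)
qed

lemma height_bounded: "\<exists>M. \<forall>x\<in>S. \<bar>height p x\<bar> \<le> M"
proof -
  have "compact (height p ` S)" by (rule compact_continuous_image[OF continuous_on_height compact_S])
  from compact_imp_bounded[OF this] show ?thesis unfolding bounded_iff by simp
qed

lemma height_lower_bound:
  assumes U: "compact U" "U \<subseteq> S" and p: "p \<in> hyp_space" and nz: "\<And>x. x \<in> U \<Longrightarrow> F x \<noteq> p"
  shows "\<exists>\<delta>>0. \<forall>x\<in>U. \<delta> \<le> height p x"
proof (cases "U = {}")
  case False
  obtain x where x: "x \<in> U" "\<forall>y\<in>U. height p x \<le> height p y"
    using continuous_attains_inf[OF U(1) False continuous_on_subset[OF continuous_on_height[of p] U(2)]] by (elim bexE)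
  have xS: "x \<in> S" by (rule subsetD[OF U(2) x(1)])
  have "height p x \<noteq> 0" using height_eq_0_iff[OF p xS] nz[OF x(1)] by simp
  hence "0 < height p x" using height_nonneg[OF p xS] by simp
  with x(2) show ?thesis by (intro exI[of _ "height p x"] conjI)
qed (auto intro: exI[of _ 1])

text \<open>Disjoint neighbourhoods of the finitely many preimages contribute 4 pi each. What is
  left of the surface is compact and avoids the preimages, so the height has a positive lower bound
  there: the kernel tends to 0 uniformly, and \<open>X_normal_global_bound\<close> yields a
  quadratic bound.\<close>

lemma global_concentration:
  assumes p: "p \<in> hyp_space" and fin: "finite {x \<in> S. F x = p}"
  shows "\<exists>C. \<forall>x\<in>S. hyp_normsq (X_normal p x) \<le> C * (height p x)\<^sup>2"
    and "(\<And>n. 0 < s n) \<Longrightarrow> s \<longlonglongrightarrow> 0 \<Longrightarrow>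
      (\<lambda>n. \<integral>x. 2 * (s n)\<^sup>2 / (height p x + (s n)\<^sup>2)\<^sup>2 \<partial>area) \<longlonglongrightarrow> 4 * pi * real (card {x \<in> S. F x = p})"
proof -
  define P where "P = {x \<in> S. F x = p}"
  have finP: "finite P" using fin by (simp add: P_def)
  obtain W where W: "\<forall>x\<in>P. open (W x) \<and> x \<in> W x" "\<forall>x\<in>P. \<forall>y\<in>P. x \<noteq> y \<longrightarrow> W x \<inter> W y = {}"
    using finite_separation[OF finP] by (elim exE conjE)
  have "\<forall>x\<in>P. \<exists>VC. openin (top_of_set S) (fst VC) \<and> x \<in> fst VC \<and> fst VC \<subseteq> W x \<and>
    (\<forall>z\<in>fst VC. hyp_normsq (X_normal p z) \<le> snd VC * (height p z)\<^sup>2) \<and>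
    (\<forall>s. (\<forall>n. 0 < s n) \<and> s \<longlonglongrightarrow> 0 \<longrightarrow>
      (\<lambda>n. \<integral>x. indicator (fst VC) x * (2 * (s n)\<^sup>2 / (height p x + (s n)\<^sup>2)\<^sup>2) \<partial>area) \<longlonglongrightarrow> 4 * pi)"
  proof
    fix x assume x: "x \<in> P"
    hence "x \<in> S" "F x = p" by (simp_all add: P_def)
    from concentration_at[OF this p conjunct1[OF bspec[OF W(1) x]] conjunct2[OF bspec[OF W(1) x]]]
    obtain V C where "openin (top_of_set S) V \<and> x \<in> V \<and> V \<subseteq> W x \<and>
    (\<forall>z\<in>V. hyp_normsq (X_normal p z) \<le> C * (height p z)\<^sup>2) \<and>
    (\<forall>s. (\<forall>n. 0 < s n) \<and> s \<longlonglongrightarrow> 0 \<longrightarrow>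
      (\<lambda>n. \<integral>x. indicator V x * (2 * (s n)\<^sup>2 / (height p x + (s n)\<^sup>2)\<^sup>2) \<partial>area) \<longlonglongrightarrow> 4 * pi)"
      by (elim exE)
    note VCx = this
    show "\<exists>VC. openin (top_of_set S) (fst VC) \<and> x \<in> fst VC \<and> fst VC \<subseteq> W x \<and>
    (\<forall>z\<in>fst VC. hyp_normsq (X_normal p z) \<le> snd VC * (height p z)\<^sup>2) \<and>
    (\<forall>s. (\<forall>n. 0 < s n) \<and> s \<longlonglongrightarrow> 0 \<longrightarrow>
      (\<lambda>n. \<integral>x. indicator (fst VC) x * (2 * (s n)\<^sup>2 / (height p x + (s n)\<^sup>2)\<^sup>2) \<partial>area) \<longlonglongrightarrow> 4 * pi)"
      by (rule exI[of _ "(V, C)"], unfold fst_conv snd_conv, rule VCx)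
  qed
  from bchoice[OF this] obtain VC where VC: "\<forall>x\<in>P. openin (top_of_set S) (fst (VC x)) \<and> x \<in> fst (VC x) \<and> fst (VC x) \<subseteq> W x \<and>
    (\<forall>z\<in>fst (VC x). hyp_normsq (X_normal p z) \<le> snd (VC x) * (height p z)\<^sup>2) \<and>
    (\<forall>s. (\<forall>n. 0 < s n) \<and> s \<longlonglongrightarrow> 0 \<longrightarrow>
      (\<lambda>n. \<integral>z. indicator (fst (VC x)) z * (2 * (s n)\<^sup>2 / (height p z + (s n)\<^sup>2)\<^sup>2) \<partial>area) \<longlonglongrightarrow> 4 * pi)"
    by (elim exE)
  define V where "V x = fst (VC x)" for x
  define C where "C x = snd (VC x)" for x
  note VC' = VC[folded V_def C_def]
  have V: "openin (top_of_set S) (V x)" "x \<in> V x" "V x \<subseteq> W x"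
    and VCb: "\<forall>z\<in>V x. hyp_normsq (X_normal p z) \<le> C x * (height p z)\<^sup>2"
    and Vlim: "\<forall>s. (\<forall>n. 0 < s n) \<and> s \<longlonglongrightarrow> 0 \<longrightarrow>
      (\<lambda>n. \<integral>z. indicator (V x) z * (2 * (s n)\<^sup>2 / (height p z + (s n)\<^sup>2)\<^sup>2) \<partial>area) \<longlonglongrightarrow> 4 * pi"
    if "x \<in> P" for x
    using bspec[OF VC' that] by - (elim conjE, assumption)+
  define U where "U = S - (\<Union>x\<in>P. V x)"
  have "openin (top_of_set S) (\<Union>x\<in>P. V x)" by (rule openin_Union) (use V(1) in blast)
  then obtain T where T: "open T" "(\<Union>x\<in>P. V x) = S \<inter> T" unfolding openin_open by (elim exE conjE)
  have "U = S \<inter> - T" unfolding U_def T(2) by blast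
  hence U: "compact U" "U \<subseteq> S" using compact_S T(1) by (simp_all add: compact_Int_closed closed_Compl)
  have nz: "F x \<noteq> p" if x: "x \<in> U" for x
  proof
    assume "F x = p"
    with x have "x \<in> P" unfolding U_def P_def by blast
    from V(2)[OF this] this x show False unfolding U_def by blast
  qed
  have "\<exists>\<delta>>0. \<forall>x\<in>U. \<delta> \<le> height p x" by (rule height_lower_bound[OF U p]) (rule nz)
  then obtain \<delta> where \<delta>: "\<delta> > 0" "\<forall>x\<in>U. \<delta> \<le> height p x" by (elim exE conjE)
  obtain M where M: "\<forall>x\<in>S. \<bar>height p x\<bar> \<le> M" using height_bounded[of p] by (elim exE)
  show "\<exists>C. \<forall>x\<in>S. hyp_normsq (X_normal p x) \<le> C * (height p x)\<^sup>2"
  proof (intro exI ballI)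
    fix x assume x: "x \<in> S"
    have h0: "0 \<le> height p x" by (rule height_nonneg[OF p x])
    have hM: "height p x \<le> M" using bspec[OF M x] by simp
    have M0: "0 \<le> M * (M + 2) / \<delta>\<^sup>2" using h0 hM by simp
    \<comment> \<open>The sum of absolute values majorizes each local constant; the other summand
      covers the compact rest, where M bounds the height above and \<delta> bounds it below.\<close>
    show "hyp_normsq (X_normal p x) \<le> ((\<Sum>y\<in>P. \<bar>C y\<bar>) + M * (M + 2) / \<delta>\<^sup>2) * (height p x)\<^sup>2"
    proof (cases "x \<in> U")
      case True
      have "hyp_normsq (X_normal p x) \<le> height p x * (height p x + 2)" by (rule X_normal_global_bound[OF x p])
      also have "\<dots> \<le> M * (M + 2)" using h0 hM by (intro mult_mono) auto
      also have "\<dots> = M * (M + 2) / \<delta>\<^sup>2 * \<delta>\<^sup>2" using \<delta>(1) by simp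
      also have "\<dots> \<le> M * (M + 2) / \<delta>\<^sup>2 * (height p x)\<^sup>2"
        using M0 \<delta>(1) bspec[OF \<delta>(2) True] by (intro mult_left_mono power_mono) auto
      also have "\<dots> \<le> ((\<Sum>y\<in>P. \<bar>C y\<bar>) + M * (M + 2) / \<delta>\<^sup>2) * (height p x)\<^sup>2"
        by (intro mult_right_mono) (simp_all add: sum_nonneg)
      finally show ?thesis .
    next
      case False
      then obtain y where y: "y \<in> P" "x \<in> V y" using x unfolding U_def by blast
      have "hyp_normsq (X_normal p x) \<le> C y * (height p x)\<^sup>2" by (rule bspec[OF VCb[OF y(1)] y(2)])
      also have "\<dots> \<le> ((\<Sum>y\<in>P. \<bar>C y\<bar>) + M * (M + 2) / \<delta>\<^sup>2) * (height p x)\<^sup>2"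
      proof (rule mult_right_mono)
        have "C y \<le> \<bar>C y\<bar>" by simp
        also have "\<dots> \<le> (\<Sum>y\<in>P. \<bar>C y\<bar>)" by (rule member_le_sum[OF y(1)]) (simp_all add: finP)
        finally show "C y \<le> (\<Sum>y\<in>P. \<bar>C y\<bar>) + M * (M + 2) / \<delta>\<^sup>2" using M0 by simp
      qed simp
      finally show ?thesis .
    qed
  qed
  assume s: "\<And>n. 0 < s n" "s \<longlonglongrightarrow> 0"
  define g where "g n x = 2 * (s n)\<^sup>2 / (height p x + (s n)\<^sup>2)\<^sup>2" for n x
  have hs: "0 < height p x + (s n)\<^sup>2" if "x \<in> S" for n x
    by (rule height_plus_pos[OF p _ that]) (use s(1)[of n] in simp)
  have gc: "continuous_on S (g n)" for n
    unfolding g_def[abs_def]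
  proof (intro continuous_on_divide continuous_on_const continuous_on_power continuous_on_add continuous_on_height ballI)
    fix x assume "x \<in> S"
    from hs[OF this, of n] show "(height p x + (s n)\<^sup>2)\<^sup>2 \<noteq> 0" by simp
  qed
  have gi: "integrable area (\<lambda>x. indicator B x * g n x)" if "B \<in> sets borel_S" for B n
    using integrable_mult_indicator[OF _ integrable_area_continuous[OF gc[of n]], of B] that by (simp add: sets_area)
  have Us: "U \<in> sets borel_S" unfolding U_def
    using openin_sets_borel_S[OF V(1)] finP space_borel_S sets.top[of borel_S] by (intro sets.Diff sets.finite_UN) auto
  have dec: "g n x = (\<Sum>y\<in>P. indicator (V y) x * g n x) + indicator U x * g n x" if x: "x \<in> S" for n x
  proof (cases "x \<in> U")
    case True
    hence "x \<notin> V y" if "y \<in> P" for y using that unfolding U_def by blast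
    thus ?thesis using True by simp
  next
    case False
    then obtain y where y: "y \<in> P" "x \<in> V y" using x unfolding U_def by blast
    have "x \<notin> V z" if "z \<in> P" "z \<noteq> y" for z
      using bspec[OF bspec[OF W(2) that(1)] y(1)] that V(3)[OF that(1)] V(3)[OF y(1)] y(2) by blast
    hence "(\<Sum>z\<in>P. indicator (V z) x * g n x) = (\<Sum>z\<in>P. if z = y then g n x else 0)"
      using y(2) by (intro sum.cong refl) auto
    thus ?thesis using False y(1) finP by simp
  qed
  have split: "(\<integral>x. g n x \<partial>area) = (\<Sum>y\<in>P. \<integral>x. indicator (V y) x * g n x \<partial>area) + (\<integral>x. indicator U x * g n x \<partial>area)" for n
  proof -
    have "(\<integral>x. g n x \<partial>area) = (\<integral>x. (\<Sum>y\<in>P. indicator (V y) x * g n x) + indicator U x * g n x \<partial>area)"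
      by (rule Bochner_Integration.integral_cong[OF refl]) (rule dec, simp only: space_area)
    also have "\<dots> = (\<integral>x. (\<Sum>y\<in>P. indicator (V y) x * g n x) \<partial>area) + (\<integral>x. indicator U x * g n x \<partial>area)"
      by (intro Bochner_Integration.integral_add Bochner_Integration.integrable_sum gi Us openin_sets_borel_S V(1))
    also have "(\<integral>x. (\<Sum>y\<in>P. indicator (V y) x * g n x) \<partial>area) = (\<Sum>y\<in>P. \<integral>x. indicator (V y) x * g n x \<partial>area)"
      by (intro Bochner_Integration.integral_sum gi openin_sets_borel_S V(1))
    finally show ?thesis .
  qed
  have l1: "(\<lambda>n. \<integral>x. indicator (V y) x * g n x \<partial>area) \<longlonglongrightarrow> 4 * pi" if "y \<in> P" for y
    using Vlim[OF that] s unfolding g_def by blast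
  have l2: "(\<lambda>n. \<integral>x. indicator U x * g n x \<partial>area) \<longlonglongrightarrow> 0"
  proof (rule tendsto_sandwich[where f = "\<lambda>_. 0" and h = "\<lambda>n. 2 * (s n)\<^sup>2 / \<delta>\<^sup>2 * measure area S"])
    show "(\<lambda>n. 2 * (s n)\<^sup>2 / \<delta>\<^sup>2 * measure area S) \<longlonglongrightarrow> 0"
      using tendsto_mult[OF tendsto_divide[OF tendsto_mult[OF tendsto_const tendsto_power[OF s(2), of 2]] tendsto_const] tendsto_const, of "\<delta>\<^sup>2" 2 "measure area S"] \<delta>(1)
      by simp
    show "eventually (\<lambda>n. 0 \<le> (\<integral>x. indicator U x * g n x \<partial>area)) sequentially"
      by (intro always_eventually allI Bochner_Integration.integral_nonneg) (simp add: g_def)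
    show "eventually (\<lambda>n. (\<integral>x. indicator U x * g n x \<partial>area) \<le> 2 * (s n)\<^sup>2 / \<delta>\<^sup>2 * measure area S) sequentially"
    proof (intro always_eventually allI)
      fix n
      have "(\<integral>x. indicator U x * g n x \<partial>area) \<le> (\<integral>x. 2 * (s n)\<^sup>2 / \<delta>\<^sup>2 \<partial>area)"
      proof (rule integral_mono[OF gi[OF Us]])
        show "integrable area (\<lambda>x. 2 * (s n)\<^sup>2 / \<delta>\<^sup>2)"
          by (rule integrable_area_continuous[OF continuous_on_const])
        fix x
        show "indicator U x * g n x \<le> 2 * (s n)\<^sup>2 / \<delta>\<^sup>2"
        proof (cases "x \<in> U")
          case True
          have "\<delta> \<le> height p x + (s n)\<^sup>2" using bspec[OF \<delta>(2) True] by (rule add_increasing2[rotated]) simp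
          hence "\<delta>\<^sup>2 \<le> (height p x + (s n)\<^sup>2)\<^sup>2" using \<delta>(1) by (intro power_mono) auto
          thus ?thesis using True \<delta>(1) by (simp add: g_def frac_le)
        qed simp
      qed
      also have "\<dots> = 2 * (s n)\<^sup>2 / \<delta>\<^sup>2 * measure area S" by (simp add: space_area)
      finally show "(\<integral>x. indicator U x * g n x \<partial>area) \<le> 2 * (s n)\<^sup>2 / \<delta>\<^sup>2 * measure area S" .
    qed
  qed (rule tendsto_const)
  have "(\<lambda>n. \<integral>x. g n x \<partial>area) \<longlonglongrightarrow> (\<Sum>y\<in>P. 4 * pi) + 0"
    unfolding split by (intro tendsto_add tendsto_sum l1 l2)
  thus "(\<lambda>n. \<integral>x. 2 * (s n)\<^sup>2 / (height p x + (s n)\<^sup>2)\<^sup>2 \<partial>area) \<longlonglongrightarrow> 4 * pi * real (card {x \<in> S. F x = p})"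
    unfolding g_def P_def by (simp add: mult_ac)
qed

lemma mink_F_normal:
  assumes c: "c \<in> \<A>" "y \<in> chart_image c"
  shows "mink (in_chart F c y) (second_ff (in_chart F c) y i j) = 0"
proof -
  have a: "mink (in_chart F c y) (partial_deriv k (in_chart F c) y) = 0" for k by (rule mink_F_partial[OF c])
  have "mink (in_chart F c y) (hyp_proj (in_chart F c y) v) = 0" for v
    by (rule mink_hyp_proj(1)[OF in_chart_F_hyp[OF c]])
  thus ?thesis by (simp add: second_ff_def normal_proj_def mink_linear a)
qed

lemma mink_F_mean_curvature:
  assumes x: "x \<in> S"
  shows "mink (F x) (mean_curvature \<A> F x) = 0" and "mink (F x) (X_normal p x) = 0"
proof -
  obtain c where c: "c \<in> \<A>" "x \<in> fst c" using chart_cover[OF x] by (elim bexE)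
  have y: "snd c x \<in> chart_image c" by (rule in_chart_image[OF c(2)])
  have Fx: "in_chart F c (snd c x) = F x" by (simp add: in_chart_apply chart_inv_chart[OF c])
  show "mink (F x) (mean_curvature \<A> F x) = 0"
    unfolding mean_curvature_chart[OF c] mean_curv_def Let_def
    using mink_F_normal[OF c(1) y] by (simp add: mink_linear Fx)
  show "mink (F x) (X_normal p x) = 0"
    using mink_X_normal(1,2)[OF c(1) y, of p] by (simp add: Fx chart_inv_chart[OF c] mink_commute)
qed

lemma X_normal_at_p:
  assumes x: "x \<in> S" "F x = p" and p: "p \<in> hyp_space"
  shows "X_normal p x = 0"
proof -
  obtain c where c: "c \<in> \<A>" "x \<in> fst c" using chart_cover[OF x(1)] by (elim bexE)
  have "hyp_proj (F x) (- p) = 0" using x(2) by (simp add: hyp_proj_def mink_linear hyp_space_mink[OF p])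
  thus ?thesis by (simp add: X_normal_def normal_part_chart[OF c] normal_proj_def tangent_coeff_def mink.zero_left)
qed

lemma continuous_on_mean_curvature_normsq: "continuous_on S (\<lambda>x. hyp_normsq (mean_curvature \<A> F x))"
proof (rule continuous_on_S_chartI)
  fix c assume c: "c \<in> \<A>"
  let ?f = "in_chart F c"
  have f: "continuous_on (chart_image c) ?f" by (rule Ck1_continuous[OF Ck1_F[OF c]])
  have f1: "continuous_on (chart_image c) (partial_deriv i ?f)" for i by (rule Ck1_continuous[OF Ck1_partial_F[OF c]])
  have f2: "continuous_on (chart_image c) (partial_deriv i (partial_deriv j ?f))" for i j
    by (rule Ck1_continuous_partial[OF Ck1_partial_F[OF c]])
  have g: "gram_det (partial_deriv 1 ?f y) (partial_deriv 2 ?f y) \<noteq> 0" "gram_det (partial_deriv 2 ?f y) (partial_deriv 1 ?f y) \<noteq> 0"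
    if "y \<in> chart_image c" for y
    using gram_det_pos[OF c that] by (simp_all add: gram_det_commute)
  have gc: "continuous_on (chart_image c) (\<lambda>y. gram_det (partial_deriv i ?f y) (partial_deriv j ?f y))" for i j
    unfolding gram_det_def by (intro continuous_on_diff continuous_on_mult continuous_on_power mink.continuous_on f1)
  have hp: "continuous_on (chart_image c) (\<lambda>y. hyp_proj (?f y) (partial_deriv i (partial_deriv j ?f) y))" for i j
    unfolding hyp_proj_def by (intro continuous_on_add continuous_on_scaleR mink.continuous_on f f2)
  have sc: "continuous_on (chart_image c) (\<lambda>y. second_ff ?f y i j)" for i j
    unfolding second_ff_def normal_proj_def tangent_coeff_def
    by (intro continuous_on_diff continuous_on_scaleR continuous_on_divide continuous_on_mult mink.continuous_on f1 hp gc ballI g)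
  have mc: "continuous_on (chart_image c) (mean_curv ?f)"
    unfolding mean_curv_def[abs_def] Let_def
    by (intro continuous_on_diff continuous_on_add continuous_on_scaleR continuous_on_divide continuous_on_mult
        continuous_on_const mink.continuous_on f1 sc gc ballI g)
  have "continuous_on (chart_image c) (\<lambda>y. hyp_normsq (mean_curv ?f y))"
    unfolding hyp_normsq_def by (intro mink.continuous_on mc)
  thus "continuous_on (chart_image c) (in_chart (\<lambda>x. hyp_normsq (mean_curvature \<A> F x)) c)"
  proof (rule continuous_on_eq)
    fix y assume y: "y \<in> chart_image c"
    show "hyp_normsq (mean_curv ?f y) = in_chart (\<lambda>x. hyp_normsq (mean_curvature \<A> F x)) c y"
      unfolding in_chart_apply[of "\<lambda>x. hyp_normsq (mean_curvature \<A> F x)"] mean_curvature_chart[OF c chart_inv_in[OF y]] chart_chart_inv[OF y] ..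
  qed
qed

text \<open>The vanishing integral of the divergence with \<open>e n = (s n)^2\<close> expresses the
  integral of the regularized square \<open>Dn n\<close> through the area, the integral of |H|^2 and
  the kernel. Both sides are then passed to the limit, by dominated convergence on the left and by
  concentration on the right.\<close>

theorem area_identity:
  assumes p: "p \<in> hyp_space" and fin: "finite {x \<in> S. F x = p}"
  defines "D \<equiv> \<lambda>x. hyp_normsq ((1 / height p x) *\<^sub>R X_normal p x + (1/2) *\<^sub>R mean_curvature \<A> F x)"
  shows "integrable area D"
    and "measure area S + 4 * real (card {x \<in> S. F x = p}) * pi
      = - (\<integral>x. D x \<partial>area) + 1/4 * (\<integral>x. hyp_normsq (mean_curvature \<A> F x) \<partial>area)"
proof -
  define H2 where "H2 x = hyp_normsq (mean_curvature \<A> F x)" for x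
  define s where "s n = 1 / real (Suc n)" for n
  have s: "0 < s n" for n by (simp add: s_def)
  have s0: "s \<longlonglongrightarrow> 0" unfolding s_def[abs_def] by (rule LIMSEQ_Suc[OF lim_1_over_n])
  define e where "e n = (s n)\<^sup>2" for n
  have e: "0 < e n" for n using s[of n] by (simp add: e_def)
  have e0: "e \<longlonglongrightarrow> 0" using tendsto_power[OF s0, of 2] by (simp add: e_def[abs_def])
  define Dn where "Dn n x = hyp_normsq ((1 / (height p x + e n)) *\<^sub>R X_normal p x + (1/2) *\<^sub>R mean_curvature \<A> F x)" for n x
  define g where "g n x = 2 * (s n)\<^sup>2 / (height p x + (s n)\<^sup>2)\<^sup>2" for n x
  have hpos: "0 < height p x + e n" if "x \<in> S" for n x by (rule height_plus_pos[OF p e that])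
  have H2c: "continuous_on S H2" unfolding H2_def[abs_def] by (rule continuous_on_mean_curvature_normsq)
  have gc: "continuous_on S (g n)" for n
    unfolding g_def[abs_def]
  proof (intro continuous_on_divide continuous_on_const continuous_on_power continuous_on_add continuous_on_height ballI)
    fix x assume "x \<in> S"
    from hpos[OF this, of n] show "(height p x + (s n)\<^sup>2)\<^sup>2 \<noteq> 0" by (simp add: e_def)
  qed
  have Dn: "Dn n x = divergence p (e n) x - 1 - (1 - e n / 2) * g n x + 1/4 * H2 x" if "x \<in> S" for n x
  proof -
    \<comment> \<open>Factoring out the kernel \<open>g n\<close> leaves 1 - e / 2, which tends to
      1, so the term in e^2 has no effect in the limit.\<close>
    have "2 * e n - (e n)\<^sup>2 = (1 - e n / 2) * (2 * e n)" by (simp add: power2_eq_square algebra_simps)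
    hence "(2 * e n - (e n)\<^sup>2) / (height p x + e n)\<^sup>2 = (1 - e n / 2) * g n x"
      by (simp only: g_def e_def times_divide_eq_right)
    thus ?thesis by (simp add: divergence_def Dn_def H2_def)
  qed
  have Dnc: "continuous_on S (Dn n)" for n
  proof -
    have "continuous_on S (\<lambda>x. divergence p (e n) x - 1 - (1 - e n / 2) * g n x + 1/4 * H2 x)"
      by (intro continuous_on_add continuous_on_diff continuous_on_mult continuous_on_const continuous_on_divergence[OF p e] gc H2c)
    thus ?thesis by (rule continuous_on_eq) (rule Dn[symmetric])
  qed
  have int: "(\<integral>x. Dn n x \<partial>area) = 1/4 * (\<integral>x. H2 x \<partial>area) - measure area S - (1 - e n / 2) * (\<integral>x. g n x \<partial>area)" for n
  proof -
    have i: "integrable area (divergence p (e n))" "integrable area (\<lambda>x. 1 :: real)" "integrable area (\<lambda>x. (1 - e n / 2) * g n x)" "integrable area (\<lambda>x. 1/4 * H2 x)"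
      by (intro integrable_area_continuous continuous_on_divergence[OF p e] continuous_on_const continuous_on_mult gc H2c)+
    have "(\<integral>x. Dn n x \<partial>area) = (\<integral>x. divergence p (e n) x - 1 - (1 - e n / 2) * g n x + 1/4 * H2 x \<partial>area)"
      by (rule Bochner_Integration.integral_cong[OF refl]) (rule Dn, simp only: space_area)
    also have "\<dots> = (\<integral>x. divergence p (e n) x \<partial>area) - (\<integral>x. 1 \<partial>area) - (\<integral>x. (1 - e n / 2) * g n x \<partial>area) + (\<integral>x. 1/4 * H2 x \<partial>area)"
      by (simp only: Bochner_Integration.integral_add[OF Bochner_Integration.integrable_diff[OF Bochner_Integration.integrable_diff[OF i(1,2)] i(3)] i(4)]
         Bochner_Integration.integral_diff[OF Bochner_Integration.integrable_diff[OF i(1,2)] i(3)] Bochner_Integration.integral_diff[OF i(1,2)])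
    finally show ?thesis using integral_divergence_eq_0[OF p e, of n] by (simp add: space_area)
  qed
  obtain C where C: "\<forall>x\<in>S. hyp_normsq (X_normal p x) \<le> C * (height p x)\<^sup>2"
    using global_concentration(1)[OF p fin] by (elim exE)
  have "compact (H2 ` S)" by (rule compact_continuous_image[OF H2c compact_S])
  from compact_imp_bounded[OF this] obtain K where K: "\<forall>z\<in>H2 ` S. norm z \<le> K" unfolding bounded_iff by blast
  \<comment> \<open>Both vectors are orthogonal to \<open>F x\<close> and hence tangent to the
    hyperboloid, where the Minkowski form is nonnegative.\<close>
  have tan: "0 \<le> hyp_normsq (a *\<^sub>R X_normal p x + b *\<^sub>R mean_curvature \<A> F x)" if "x \<in> S" for a b x
    unfolding hyp_normsq_def
    by (rule mink_nonneg_tangent[OF F_hyp[OF that]]) (simp add: mink_linear mink_F_mean_curvature[OF that])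
  have bnd: "norm (Dn n x) \<le> 2 * \<bar>C\<bar> + K / 2" if x: "x \<in> S" for n x
  proof -
    let ?a = "1 / (height p x + e n)" and ?N = "X_normal p x" and ?H = "mean_curvature \<A> F x"
    have q: "hyp_normsq (a *\<^sub>R ?N + b *\<^sub>R ?H) = a\<^sup>2 * hyp_normsq ?N + 2 * (a * b) * mink ?N ?H + b\<^sup>2 * H2 x" for a b
      by (simp add: hyp_normsq_def H2_def mink_linear mink_commute[of ?H ?N] power2_eq_square algebra_simps)
    \<comment> \<open>The parallelogram law: adding the square with the opposite sign removes the
      mixed term and bounds \<open>Dn n x\<close> by twice the separate squares.\<close>
    have "0 \<le> hyp_normsq (?a *\<^sub>R ?N + (- (1/2)) *\<^sub>R ?H)" by (rule tan[OF x])
    moreover have "Dn n x = ?a\<^sup>2 * hyp_normsq ?N + 2 * (?a * (1/2)) * mink ?N ?H + (1/2)\<^sup>2 * H2 x"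
      unfolding Dn_def by (rule q)
    ultimately have 1: "Dn n x \<le> 2 * (?a\<^sup>2 * hyp_normsq ?N) + 1/2 * H2 x"
      unfolding q by (simp add: power2_eq_square)
    have h0: "0 \<le> height p x" by (rule height_nonneg[OF p x])
    \<comment> \<open>Since 0 \<le> u \<le> u + e, the quadratic bound on the normal part absorbs
      the singular factor with a constant independent of \<open>n\<close>.\<close>
    have "?a\<^sup>2 * hyp_normsq ?N \<le> ?a\<^sup>2 * (\<bar>C\<bar> * (height p x + e n)\<^sup>2)"
    proof (rule mult_left_mono)
      have "hyp_normsq ?N \<le> C * (height p x)\<^sup>2" by (rule bspec[OF C x])
      also have "\<dots> \<le> \<bar>C\<bar> * (height p x + e n)\<^sup>2" using h0 e[of n] by (intro mult_mono power_mono) auto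
      finally show "hyp_normsq ?N \<le> \<bar>C\<bar> * (height p x + e n)\<^sup>2" .
    qed simp
    also have "\<dots> = \<bar>C\<bar>" using hpos[OF x, of n] by (simp add: power_divide)
    finally have 2: "?a\<^sup>2 * hyp_normsq ?N \<le> \<bar>C\<bar>" .
    have 3: "H2 x \<le> K" using bspec[OF K imageI[OF x]] by simp
    have 4: "0 \<le> Dn n x" unfolding Dn_def by (rule tan[OF x])
    from 1 2 3 4 show ?thesis by simp
  qed
  have lim: "(\<lambda>n. Dn n x) \<longlonglongrightarrow> D x" if x: "x \<in> S" for x
  proof (cases "F x = p")
    case True
    \<comment> \<open>At a preimage of \<open>p\<close> the factor 1 / 0 is 0 by convention, but
      \<open>X_normal\<close> vanishes there anyway; convergence therefore holds at every point of
      \<open>S\<close>.\<close>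
    have "Dn n x = D x" for n by (simp add: Dn_def D_def X_normal_at_p[OF x True p])
    thus ?thesis by simp
  next
    case False
    hence h: "height p x \<noteq> 0" using height_eq_0_iff[OF p x] by simp
    have "(\<lambda>n. 1 / (height p x + e n)) \<longlonglongrightarrow> 1 / (height p x + 0)"
      using h by (intro tendsto_divide tendsto_const tendsto_add e0) simp
    hence a: "(\<lambda>n. 1 / (height p x + e n)) \<longlonglongrightarrow> 1 / height p x" by simp
    show ?thesis unfolding Dn_def D_def hyp_normsq_def
      by (intro mink.tendsto tendsto_add tendsto_scaleR a tendsto_const)
  qed
  have Dnm: "Dn n \<in> borel_measurable area" for n
    unfolding measurable_area by (rule borel_measurable_continuous_on_restrict[OF Dnc])
  have Dm: "D \<in> borel_measurable area"
    by (rule borel_measurable_LIMSEQ_real[OF _ Dnm]) (rule lim, simp only: space_area)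
  have ic: "integrable area (\<lambda>x. 2 * \<bar>C\<bar> + K / 2)" by (rule integrable_area_continuous[OF continuous_on_const])
  have A1: "AE x in area. (\<lambda>n. Dn n x) \<longlonglongrightarrow> D x" by (rule AE_I2) (rule lim, simp only: space_area)
  have A2: "AE x in area. norm (Dn n x) \<le> 2 * \<bar>C\<bar> + K / 2" for n by (rule AE_I2) (rule bnd, simp only: space_area)
  show "integrable area D" by (rule integrable_dominated_convergence[OF Dm Dnm ic A1 A2])
  have L: "(\<lambda>n. \<integral>x. Dn n x \<partial>area) \<longlonglongrightarrow> (\<integral>x. D x \<partial>area)"
    by (rule integral_dominated_convergence[OF Dm Dnm ic A1 A2])
  have G: "(\<lambda>n. \<integral>x. g n x \<partial>area) \<longlonglongrightarrow> 4 * pi * real (card {x \<in> S. F x = p})"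
    unfolding g_def by (rule global_concentration(2)[OF p fin s s0])
  have "(\<lambda>n. 1/4 * (\<integral>x. H2 x \<partial>area) - measure area S - (1 - e n / 2) * (\<integral>x. g n x \<partial>area))
     \<longlonglongrightarrow> 1/4 * (\<integral>x. H2 x \<partial>area) - measure area S - (1 - 0 / 2) * (4 * pi * real (card {x \<in> S. F x = p}))"
    by (intro tendsto_diff tendsto_const tendsto_mult tendsto_divide e0 G) simp
  with L have "(\<integral>x. D x \<partial>area) = 1/4 * (\<integral>x. H2 x \<partial>area) - measure area S - (1 - 0 / 2) * (4 * pi * real (card {x \<in> S. F x = p}))"
    unfolding int by (rule LIMSEQ_unique)
  thus "measure area S + 4 * real (card {x \<in> S. F x = p}) * pi
      = - (\<integral>x. D x \<partial>area) + 1/4 * (\<integral>x. hyp_normsq (mean_curvature \<A> F x) \<partial>area)"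
    unfolding H2_def by (simp add: mult_ac)
qed

end

theorem theorem4:
  fixes S :: "'m::t2_space set" and \<A> :: "'m chart set"
    and F :: "'m \<Rightarrow> real \<times> (real^'n)" and p :: "real \<times> (real^'n)" and k :: nat
  assumes "closed_surface S \<A>"
    and "smooth_immersion S \<A> F"
    and "p \<in> hyp_space"
    and "card {x \<in> S. F x = p} = k"
    and "k \<ge> 1"
  shows "let \<mu> = area_measure S \<A> F;
             H = mean_curvature \<A> F;
             D = (\<lambda>x. hyp_normsq ((1 / w (hyp_dist p (F x))) *\<^sub>R normal_part \<A> F x (radial_field p (F x))
                        + (1/2) *\<^sub>R H x))
         in integrable \<mu> D \<and>
            measure \<mu> S + 4 * real k * pi
              = - (\<integral>x. D x \<partial>\<mu>) + 1/4 * (\<integral>x. hyp_normsq (H x) \<partial>\<mu>)"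
proof -
  interpret closed_immersed_surface S \<A> F by unfold_locales (rule assms(1,2))+
  \<comment> \<open>An infinite set has cardinality 0, so \<open>k \<ge> 1\<close> yields
    finiteness.\<close>
  have fin: "finite {x \<in> S. F x = p}" by (rule card_ge_0_finite) (use assms(4,5) in simp)
  \<comment> \<open>The translation from the intrinsic \<open>w\<close>, \<open>hyp_dist\<close> and
    \<open>radial_field\<close> to affine expressions is valid on the hyperboloid, hence at all
    points of the space of the area measure.\<close>
  have D: "hyp_normsq ((1 / w (hyp_dist p (F x))) *\<^sub>R normal_part \<A> F x (radial_field p (F x)) + (1/2) *\<^sub>R mean_curvature \<A> F x)
    = hyp_normsq ((1 / height p x) *\<^sub>R X_normal p x + (1/2) *\<^sub>R mean_curvature \<A> F x)" if "x \<in> space area" for x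
  proof -
    have "F x \<in> hyp_space" using that by (intro F_hyp) (simp only: space_area)
    thus ?thesis by (simp only: w_hyp_dist[OF assms(3)] radial_field_eq[OF assms(3)] height_def X_normal_def)
  qed
  have "integrable area (\<lambda>x. hyp_normsq ((1 / w (hyp_dist p (F x))) *\<^sub>R normal_part \<A> F x (radial_field p (F x)) + (1/2) *\<^sub>R mean_curvature \<A> F x))"
    by (rule iffD2[OF Bochner_Integration.integrable_cong[OF refl D] area_identity(1)[OF assms(3) fin]])
  moreover have "(\<integral>x. hyp_normsq ((1 / w (hyp_dist p (F x))) *\<^sub>R normal_part \<A> F x (radial_field p (F x)) + (1/2) *\<^sub>R mean_curvature \<A> F x) \<partial>area)
      = (\<integral>x. hyp_normsq ((1 / height p x) *\<^sub>R X_normal p x + (1/2) *\<^sub>R mean_curvature \<A> F x) \<partial>area)"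
    by (rule Bochner_Integration.integral_cong[OF refl D])
  ultimately show ?thesis
    using area_identity(2)[OF assms(3) fin] unfolding Let_def assms(4) by (simp only: simp_thms)
qed

end
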